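(* Let $\mathcal{A}$ be a rigid abelian $\otimes$-category. For an ideal $I$ of $Z(\mathcal{A})$ let $I_\oplus$ be the $\otimes$-ideal of morphisms of $\mathcal{A}$ which become $0$ in $\mathcal{A}/\!\!/I$; equivalently $I_\oplus=\{f\mid e(f)\in I\}$. Let $\pi:\operatorname{Spec}^\otimes\mathcal{A}\to\operatorname{Spec}Z(\mathcal{A})$ be the map $\mathbb{P}\mapsto\mathbb{P}(\mathbf{1},\mathbf{1})$. Then: a) $I_\oplus\subseteq\mathbb{I}(I)$ and $\pi(I_\oplus)=I$ for every ideal $I$ of $Z(\mathcal{A})$. b) For $P\in\operatorname{Spec}Z(\mathcal{A})$, $P_\oplus$ is prime. The map $\sigma:\operatorname{Spec}Z(\mathcal{A})\to\operatorname{Spec}^\otimes\mathcal{A}$, $P\mapsto P_\oplus$, is a section of $\pi$ such that $\sigma(P)\subseteq\sigma_{\operatorname{tr}}(P)$ for all $P$. It is spectral. c) Any $\mathbb{P}\in\operatorname{Spec}^\otimes\mathcal{A}$ contains $\sigma(\pi(\mathbb{P}))$. d) For any ideal $I$ of $Z(\mathcal{A})$, the obvious $\otimes$-functor $\mathcal{A}/I_\oplus\to\mathcal{A}/\!\!/I$ is an equivalence of categories.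
   Context: A $\otimes$-category is an additive symmetric monoidal category with unit $\mathbf{1}$ and biadditive tensor product; it is rigid if every object has a dual; a rigid abelian $\otimes$-category is one whose underlying category is abelian. $Z(\mathcal{A})=\operatorname{End}_{\mathcal{A}}(\mathbf{1})$. A $\otimes$-ideal is a two-sided additive ideal stable under tensor product with arbitrary morphisms; $\mathcal{A}/\mathbb{I}$ is the additive quotient. A $\otimes$-category is integral if $f\otimes g=0$ implies $f=0$ or $g=0$; a proper $\otimes$-ideal $\mathbb{P}$ is prime if $\mathcal{A}/\mathbb{P}$ is integral. $\operatorname{Spec}^\otimes\mathcal{A}$ is the set of prime $\otimes$-ideals with closed subsets $V(\mathbb{I})=\{\mathbb{P}\mid\mathbb{I}\subseteq\mathbb{P}\}$; it is a spectral space, and a continuous map of spectral spaces is spectral if inverse images of quasi-compact open sets are quasi-compact. For a $\otimes$-ideal $\mathbb{I}$, $\pi(\mathbb{I})=\mathbb{I}(\mathbf{1},\mathbf{1})$; for an ideal $I$ of $Z(\mathcal{A})$, $\mathbb{I}(I)(C,D)=I\cdot\mathcal{A}(C,D)$. For $P\in\operatorname{Spec}Z(\mathcal{A})$, $\sigma_{\operatorname{tr}}(P)$ is the prime $\otimes$-ideal of those $f:C\to D$ with $\operatorname{tr}(gf)\in P$ for all $g:D\to C$. Every subobject $U$ of $\mathbf{1}$ has a unique complement $U^\perp$ with $\mathbf{1}=U\oplus U^\perp$; $e(U)\in Z(\mathcal{A})$ is the idempotent with image $U$ and kernel $U^\perp$. For a morphism $f:A\to B$ with adjoint $\tilde f:\mathbf{1}\to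 A^\vee\otimes B$, $\operatorname{Supp}(f)=\operatorname{Ker}(\tilde f)^\perp\simeq\operatorname{Im}\tilde f$ and $e(f)=e(\operatorname{Supp}(f))$; $e(A)=e(1_A)$. For an ideal $I$ of $Z(\mathcal{A})$, $\mathcal{I}(I)=\{A\in\mathcal{A}\mid e(A)\in I\}$ is a Serre subcategory stable under tensoring with any object of $\mathcal{A}$, and $\mathcal{A}/\!\!/I$ denotes the Serre quotient of $\mathcal{A}$ by $\mathcal{I}(I)$ (a rigid abelian $\otimes$-category). *)

theory Defs
  imports "HOL-Algebra.Ideal" "HOL-Algebra.Generated_Groups" "HOL-Analysis.Abstract_Topology"
begin

record ('o, 'm) cat =
  Ob :: "'o set"
  Ar :: "'m set"
  src :: "'m \<Rightarrow> 'o"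
  tgt :: "'m \<Rightarrow> 'o"
  cid :: "'o \<Rightarrow> 'm"
  ccomp :: "'m \<Rightarrow> 'm \<Rightarrow> 'm" (infixr "\<cdot>\<index>" 75)

definition Hom :: "('o, 'm, 'x) cat_scheme \<Rightarrow> 'o \<Rightarrow> 'o \<Rightarrow> 'm set" where
  "Hom C A B = {f \<in> Ar C. src C f = A \<and> tgt C f = B}"

locale category =
  fixes C (structure)
  assumes src_Ob: "f \<in> Ar C \<Longrightarrow> src C f \<in> Ob C"
    and tgt_Ob: "f \<in> Ar C \<Longrightarrow> tgt C f \<in> Ob C"
    and cid_Hom: "A \<in> Ob C \<Longrightarrow> cid C A \<in> Hom C A A"
    and comp_Hom: "\<lbrakk>f \<in> Hom C A B; g \<in> Hom C B D\<rbrakk> \<Longrightarrow> g \<cdot> f \<in> Hom C A D"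
    and comp_assoc: "\<lbrakk>f \<in> Hom C A B; g \<in> Hom C B D; h \<in> Hom C D E\<rbrakk>
      \<Longrightarrow> h \<cdot> (g \<cdot> f) = (h \<cdot> g) \<cdot> f"
    and comp_cid_left: "f \<in> Hom C A B \<Longrightarrow> cid C B \<cdot> f = f"
    and comp_cid_right: "f \<in> Hom C A B \<Longrightarrow> f \<cdot> cid C A = f"

definition is_mono :: "('o, 'm, 'x) cat_scheme \<Rightarrow> 'm \<Rightarrow> bool" where
  "is_mono C f \<longleftrightarrow> f \<in> Ar C \<and>
    (\<forall>A. \<forall>g \<in> Hom C A (src C f). \<forall>h \<in> Hom C A (src C f). f \<cdot>\<^bsub>C\<^esub> g = f \<cdot>\<^bsub>C\<^esub> h \<longrightarrow> g = h)"

definition is_epi :: "('o, 'm, 'x) cat_scheme \<Rightarrow> 'm \<Rightarrow> bool" where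
  "is_epi C f \<longleftrightarrow> f \<in> Ar C \<and>
    (\<forall>B. \<forall>g \<in> Hom C (tgt C f) B. \<forall>h \<in> Hom C (tgt C f) B. g \<cdot>\<^bsub>C\<^esub> f = h \<cdot>\<^bsub>C\<^esub> f \<longrightarrow> g = h)"

definition inverse_arrows :: "('o, 'm, 'x) cat_scheme \<Rightarrow> 'm \<Rightarrow> 'm \<Rightarrow> bool" where
  "inverse_arrows C f g \<longleftrightarrow> f \<in> Ar C \<and> g \<in> Hom C (tgt C f) (src C f) \<and>
    g \<cdot>\<^bsub>C\<^esub> f = cid C (src C f) \<and> f \<cdot>\<^bsub>C\<^esub> g = cid C (tgt C f)"

definition is_iso :: "('o, 'm, 'x) cat_scheme \<Rightarrow> 'm \<Rightarrow> bool" where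
  "is_iso C f \<longleftrightarrow> (\<exists>g. inverse_arrows C f g)"

definition inverse_arrow :: "('o, 'm, 'x) cat_scheme \<Rightarrow> 'm \<Rightarrow> 'm" where
  "inverse_arrow C f = (THE g. inverse_arrows C f g)"

definition is_functor ::
  "('o, 'm, 'x) cat_scheme \<Rightarrow> ('p, 'n, 'y) cat_scheme \<Rightarrow> ('o \<Rightarrow> 'p) \<Rightarrow> ('m \<Rightarrow> 'n) \<Rightarrow> bool" where
  "is_functor C D Fo Fa \<longleftrightarrow> category C \<and> category D \<and>
    (\<forall>A \<in> Ob C. Fo A \<in> Ob D) \<and>
    (\<forall>f \<in> Ar C. Fa f \<in> Hom D (Fo (src C f)) (Fo (tgt C f))) \<and>
    (\<forall>A \<in> Ob C. Fa (cid C A) = cid D (Fo A)) \<and>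
    (\<forall>f \<in> Ar C. \<forall>g \<in> Ar C. src C g = tgt C f \<longrightarrow> Fa (g \<cdot>\<^bsub>C\<^esub> f) = Fa g \<cdot>\<^bsub>D\<^esub> Fa f)"

definition natural_iso ::
  "('o, 'm, 'x) cat_scheme \<Rightarrow> ('p, 'n, 'y) cat_scheme \<Rightarrow> ('o \<Rightarrow> 'p) \<Rightarrow> ('m \<Rightarrow> 'n) \<Rightarrow>
   ('o \<Rightarrow> 'p) \<Rightarrow> ('m \<Rightarrow> 'n) \<Rightarrow> ('o \<Rightarrow> 'n) \<Rightarrow> bool" where
  "natural_iso C D Fo Fa Go Ga \<eta> \<longleftrightarrow> is_functor C D Fo Fa \<and> is_functor C D Go Ga \<and>
    (\<forall>A \<in> Ob C. \<eta> A \<in> Hom D (Fo A) (Go A) \<and> is_iso D (\<eta> A)) \<and>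
    (\<forall>f \<in> Ar C. \<eta> (tgt C f) \<cdot>\<^bsub>D\<^esub> Fa f = Ga f \<cdot>\<^bsub>D\<^esub> \<eta> (src C f))"

definition is_equivalence ::
  "('o, 'm, 'x) cat_scheme \<Rightarrow> ('p, 'n, 'y) cat_scheme \<Rightarrow> ('o \<Rightarrow> 'p) \<Rightarrow> ('m \<Rightarrow> 'n) \<Rightarrow> bool" where
  "is_equivalence C D Fo Fa \<longleftrightarrow> is_functor C D Fo Fa \<and>
    (\<exists>Go Ga \<eta> \<epsilon>. is_functor D C Go Ga \<and>
       natural_iso C C id id (Go \<circ> Fo) (Ga \<circ> Fa) \<eta> \<and>
       natural_iso D D (Fo \<circ> Go) (Fa \<circ> Ga) id id \<epsilon>)"

record ('o, 'm) add_cat = "('o, 'm) cat" +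
  czero :: "'o \<Rightarrow> 'o \<Rightarrow> 'm"
  cplus :: "'m \<Rightarrow> 'm \<Rightarrow> 'm" (infixl "\<boxplus>\<index>" 65)

text \<open>The additive group of morphisms, written multiplicatively as is usual for \<^typ>\<open>'a monoid\<close>.\<close>

definition hom_group :: "('o, 'm, 'x) add_cat_scheme \<Rightarrow> 'o \<Rightarrow> 'o \<Rightarrow> 'm monoid" where
  "hom_group C A B = \<lparr>carrier = Hom C A B, monoid.mult = cplus C, one = czero C A B\<rparr>"

definition is_zero_object :: "('o, 'm, 'x) cat_scheme \<Rightarrow> 'o \<Rightarrow> bool" where
  "is_zero_object C Z \<longleftrightarrow> Z \<in> Ob C \<and>
    (\<forall>A \<in> Ob C. (\<exists>!f. f \<in> Hom C A Z) \<and> (\<exists>!f. f \<in> Hom C Z A))"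

definition is_biproduct ::
  "('o, 'm, 'x) add_cat_scheme \<Rightarrow> 'o \<Rightarrow> 'o \<Rightarrow> 'o \<Rightarrow> 'm \<Rightarrow> 'm \<Rightarrow> 'm \<Rightarrow> 'm \<Rightarrow> bool" where
  "is_biproduct C S A B i j p q \<longleftrightarrow>
    i \<in> Hom C A S \<and> j \<in> Hom C B S \<and> p \<in> Hom C S A \<and> q \<in> Hom C S B \<and>
    p \<cdot>\<^bsub>C\<^esub> i = cid C A \<and> q \<cdot>\<^bsub>C\<^esub> j = cid C B \<and>
    q \<cdot>\<^bsub>C\<^esub> i = czero C A B \<and> p \<cdot>\<^bsub>C\<^esub> j = czero C B A \<and>
    i \<cdot>\<^bsub>C\<^esub> p \<boxplus>\<^bsub>C\<^esub> j \<cdot>\<^bsub>C\<^esub> q = cid C S"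

locale additive_category = category +
  assumes Hom_group: "\<lbrakk>A \<in> Ob C; B \<in> Ob C\<rbrakk> \<Longrightarrow> comm_group (hom_group C A B)"
    and comp_add_right: "\<lbrakk>f \<in> Hom C A B; f' \<in> Hom C A B; g \<in> Hom C B D\<rbrakk>
      \<Longrightarrow> g \<cdot> (f \<boxplus> f') = g \<cdot> f \<boxplus> g \<cdot> f'"
    and comp_add_left: "\<lbrakk>f \<in> Hom C A B; g \<in> Hom C B D; g' \<in> Hom C B D\<rbrakk>
      \<Longrightarrow> (g \<boxplus> g') \<cdot> f = g \<cdot> f \<boxplus> g' \<cdot> f"
    and ex_zero_object: "\<exists>Z. is_zero_object C Z"
    and ex_biproduct: "\<lbrakk>A \<in> Ob C; B \<in> Ob C\<rbrakk>
      \<Longrightarrow> \<exists>S \<in> Ob C. \<exists>i j p q. is_biproduct C S A B i j p q"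

definition is_kernel :: "('o, 'm, 'x) add_cat_scheme \<Rightarrow> 'm \<Rightarrow> 'm \<Rightarrow> bool" where
  "is_kernel C f k \<longleftrightarrow> f \<in> Ar C \<and> k \<in> Ar C \<and> tgt C k = src C f \<and>
    f \<cdot>\<^bsub>C\<^esub> k = czero C (src C k) (tgt C f) \<and>
    (\<forall>h \<in> Ar C. tgt C h = src C f \<and> f \<cdot>\<^bsub>C\<^esub> h = czero C (src C h) (tgt C f) \<longrightarrow>
       (\<exists>!u. u \<in> Hom C (src C h) (src C k) \<and> k \<cdot>\<^bsub>C\<^esub> u = h))"

definition is_cokernel :: "('o, 'm, 'x) add_cat_scheme \<Rightarrow> 'm \<Rightarrow> 'm \<Rightarrow> bool" where
  "is_cokernel C f q \<longleftrightarrow> f \<in> Ar C \<and> q \<in> Ar C \<and> src C q = tgt C f \<and>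
    q \<cdot>\<^bsub>C\<^esub> f = czero C (src C f) (tgt C q) \<and>
    (\<forall>h \<in> Ar C. src C h = tgt C f \<and> h \<cdot>\<^bsub>C\<^esub> f = czero C (src C f) (tgt C h) \<longrightarrow>
       (\<exists>!u. u \<in> Hom C (tgt C q) (tgt C h) \<and> u \<cdot>\<^bsub>C\<^esub> q = h))"

definition is_image :: "('o, 'm, 'x) add_cat_scheme \<Rightarrow> 'm \<Rightarrow> 'm \<Rightarrow> bool" where
  "is_image C f m \<longleftrightarrow> (\<exists>q. is_cokernel C f q \<and> is_kernel C q m)"

locale abelian_category = additive_category +
  assumes ex_kernel: "f \<in> Ar C \<Longrightarrow> \<exists>k. is_kernel C f k"
    and ex_cokernel: "f \<in> Ar C \<Longrightarrow> \<exists>q. is_cokernel C f q"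
    and mono_is_kernel: "is_mono C f \<Longrightarrow> \<exists>g. is_kernel C g f"
    and epi_is_cokernel: "is_epi C f \<Longrightarrow> \<exists>g. is_cokernel C g f"

record ('o, 'm) tensor_cat = "('o, 'm) add_cat" +
  tunit :: 'o
  tens_ob :: "'o \<Rightarrow> 'o \<Rightarrow> 'o" (infixr "\<otimes>\<^sub>o\<index>" 80)
  tens :: "'m \<Rightarrow> 'm \<Rightarrow> 'm" (infixr "\<otimes>\<^sub>m\<index>" 80)
  assoc :: "'o \<Rightarrow> 'o \<Rightarrow> 'o \<Rightarrow> 'm"
  lunit :: "'o \<Rightarrow> 'm"
  runit :: "'o \<Rightarrow> 'm"
  braid :: "'o \<Rightarrow> 'o \<Rightarrow> 'm"

locale symmetric_monoidal_category = category +
  assumes tunit_Ob: "tunit C \<in> Ob C"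
    and tens_Ob: "\<lbrakk>A \<in> Ob C; B \<in> Ob C\<rbrakk> \<Longrightarrow> A \<otimes>\<^sub>o B \<in> Ob C"
    and tens_Hom: "\<lbrakk>f \<in> Hom C A A'; g \<in> Hom C B B'\<rbrakk>
      \<Longrightarrow> f \<otimes>\<^sub>m g \<in> Hom C (A \<otimes>\<^sub>o B) (A' \<otimes>\<^sub>o B')"
    and tens_cid: "\<lbrakk>A \<in> Ob C; B \<in> Ob C\<rbrakk> \<Longrightarrow> cid C A \<otimes>\<^sub>m cid C B = cid C (A \<otimes>\<^sub>o B)"
    and tens_comp: "\<lbrakk>f \<in> Hom C A A'; f' \<in> Hom C A' A''; g \<in> Hom C B B'; g' \<in> Hom C B' B''\<rbrakk>
      \<Longrightarrow> (f' \<cdot> f) \<otimes>\<^sub>m (g' \<cdot> g) = (f' \<otimes>\<^sub>m g') \<cdot> (f \<otimes>\<^sub>m g)"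
    and assoc_Hom: "\<lbrakk>A \<in> Ob C; B \<in> Ob C; D \<in> Ob C\<rbrakk>
      \<Longrightarrow> assoc C A B D \<in> Hom C ((A \<otimes>\<^sub>o B) \<otimes>\<^sub>o D) (A \<otimes>\<^sub>o (B \<otimes>\<^sub>o D))"
    and assoc_iso: "\<lbrakk>A \<in> Ob C; B \<in> Ob C; D \<in> Ob C\<rbrakk> \<Longrightarrow> is_iso C (assoc C A B D)"
    and assoc_natural: "\<lbrakk>f \<in> Hom C A A'; g \<in> Hom C B B'; h \<in> Hom C D D'\<rbrakk>
      \<Longrightarrow> assoc C A' B' D' \<cdot> ((f \<otimes>\<^sub>m g) \<otimes>\<^sub>m h) = (f \<otimes>\<^sub>m (g \<otimes>\<^sub>m h)) \<cdot> assoc C A B D"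
    and lunit_Hom: "A \<in> Ob C \<Longrightarrow> lunit C A \<in> Hom C (tunit C \<otimes>\<^sub>o A) A"
    and lunit_iso: "A \<in> Ob C \<Longrightarrow> is_iso C (lunit C A)"
    and lunit_natural: "f \<in> Hom C A B
      \<Longrightarrow> lunit C B \<cdot> (cid C (tunit C) \<otimes>\<^sub>m f) = f \<cdot> lunit C A"
    and runit_Hom: "A \<in> Ob C \<Longrightarrow> runit C A \<in> Hom C (A \<otimes>\<^sub>o tunit C) A"
    and runit_iso: "A \<in> Ob C \<Longrightarrow> is_iso C (runit C A)"
    and runit_natural: "f \<in> Hom C A B
      \<Longrightarrow> runit C B \<cdot> (f \<otimes>\<^sub>m cid C (tunit C)) = f \<cdot> runit C A"
    and braid_Hom: "\<lbrakk>A \<in> Ob C; B \<in> Ob C\<rbrakk> \<Longrightarrow> braid C A B \<in> Hom C (A \<otimes>\<^sub>o B) (B \<otimes>\<^sub>o A)"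
    and braid_natural: "\<lbrakk>f \<in> Hom C A A'; g \<in> Hom C B B'\<rbrakk>
      \<Longrightarrow> braid C A' B' \<cdot> (f \<otimes>\<^sub>m g) = (g \<otimes>\<^sub>m f) \<cdot> braid C A B"
    and braid_symmetric: "\<lbrakk>A \<in> Ob C; B \<in> Ob C\<rbrakk>
      \<Longrightarrow> braid C B A \<cdot> braid C A B = cid C (A \<otimes>\<^sub>o B)"
    and pentagon: "\<lbrakk>A \<in> Ob C; B \<in> Ob C; D \<in> Ob C; E \<in> Ob C\<rbrakk>
      \<Longrightarrow> assoc C A B (D \<otimes>\<^sub>o E) \<cdot> assoc C (A \<otimes>\<^sub>o B) D E =
          (cid C A \<otimes>\<^sub>m assoc C B D E) \<cdot> assoc C A (B \<otimes>\<^sub>o D) E \<cdot> (assoc C A B D \<otimes>\<^sub>m cid C E)"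
    and triangle: "\<lbrakk>A \<in> Ob C; B \<in> Ob C\<rbrakk>
      \<Longrightarrow> (cid C A \<otimes>\<^sub>m lunit C B) \<cdot> assoc C A (tunit C) B = runit C A \<otimes>\<^sub>m cid C B"
    and hexagon: "\<lbrakk>A \<in> Ob C; B \<in> Ob C; D \<in> Ob C\<rbrakk>
      \<Longrightarrow> assoc C B D A \<cdot> braid C A (B \<otimes>\<^sub>o D) \<cdot> assoc C A B D =
          (cid C B \<otimes>\<^sub>m braid C A D) \<cdot> assoc C B A D \<cdot> (braid C A B \<otimes>\<^sub>m cid C D)"

locale tensor_category = additive_category + symmetric_monoidal_category +
  assumes tens_add_left: "\<lbrakk>f \<in> Hom C A A'; f' \<in> Hom C A A'; g \<in> Hom C B B'\<rbrakk>
      \<Longrightarrow> (f \<boxplus> f') \<otimes>\<^sub>m g = (f \<otimes>\<^sub>m g) \<boxplus> (f' \<otimes>\<^sub>m g)"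
    and tens_add_right: "\<lbrakk>f \<in> Hom C A A'; g \<in> Hom C B B'; g' \<in> Hom C B B'\<rbrakk>
      \<Longrightarrow> f \<otimes>\<^sub>m (g \<boxplus> g') = (f \<otimes>\<^sub>m g) \<boxplus> (f \<otimes>\<^sub>m g')"

text \<open>Additive symmetric strong monoidal functors, with structure isomorphisms
  \<open>\<phi> A B : F A \<otimes> F B \<rightarrow> F (A \<otimes> B)\<close> and \<open>u : 1 \<rightarrow> F 1\<close>.\<close>

definition is_tensor_functor ::
  "('o, 'm, 'x) tensor_cat_scheme \<Rightarrow> ('p, 'n, 'y) tensor_cat_scheme \<Rightarrow>
   ('o \<Rightarrow> 'p) \<Rightarrow> ('m \<Rightarrow> 'n) \<Rightarrow> ('o \<Rightarrow> 'o \<Rightarrow> 'n) \<Rightarrow> 'n \<Rightarrow> bool" where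
  "is_tensor_functor C D Fo Fa \<phi> u \<longleftrightarrow>
    tensor_category C \<and> tensor_category D \<and> is_functor C D Fo Fa \<and>
    (\<forall>A B. \<forall>f \<in> Hom C A B. \<forall>g \<in> Hom C A B. Fa (f \<boxplus>\<^bsub>C\<^esub> g) = Fa f \<boxplus>\<^bsub>D\<^esub> Fa g) \<and>
    (\<forall>A \<in> Ob C. \<forall>B \<in> Ob C.
       \<phi> A B \<in> Hom D (Fo A \<otimes>\<^sub>o\<^bsub>D\<^esub> Fo B) (Fo (A \<otimes>\<^sub>o\<^bsub>C\<^esub> B)) \<and> is_iso D (\<phi> A B)) \<and>
    u \<in> Hom D (tunit D) (Fo (tunit C)) \<and> is_iso D u \<and>
    (\<forall>f \<in> Ar C. \<forall>g \<in> Ar C.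
       \<phi> (tgt C f) (tgt C g) \<cdot>\<^bsub>D\<^esub> (Fa f \<otimes>\<^sub>m\<^bsub>D\<^esub> Fa g) =
       Fa (f \<otimes>\<^sub>m\<^bsub>C\<^esub> g) \<cdot>\<^bsub>D\<^esub> \<phi> (src C f) (src C g)) \<and>
    (\<forall>A \<in> Ob C. \<forall>B \<in> Ob C. \<forall>E \<in> Ob C.
       Fa (assoc C A B E) \<cdot>\<^bsub>D\<^esub> \<phi> (A \<otimes>\<^sub>o\<^bsub>C\<^esub> B) E \<cdot>\<^bsub>D\<^esub> (\<phi> A B \<otimes>\<^sub>m\<^bsub>D\<^esub> cid D (Fo E)) =
       \<phi> A (B \<otimes>\<^sub>o\<^bsub>C\<^esub> E) \<cdot>\<^bsub>D\<^esub> (cid D (Fo A) \<otimes>\<^sub>m\<^bsub>D\<^esub> \<phi> B E) \<cdot>\<^bsub>D\<^esub> assoc D (Fo A) (Fo B) (Fo E)) \<and>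
    (\<forall>A \<in> Ob C.
       Fa (lunit C A) \<cdot>\<^bsub>D\<^esub> \<phi> (tunit C) A \<cdot>\<^bsub>D\<^esub> (u \<otimes>\<^sub>m\<^bsub>D\<^esub> cid D (Fo A)) = lunit D (Fo A) \<and>
       Fa (runit C A) \<cdot>\<^bsub>D\<^esub> \<phi> A (tunit C) \<cdot>\<^bsub>D\<^esub> (cid D (Fo A) \<otimes>\<^sub>m\<^bsub>D\<^esub> u) = runit D (Fo A)) \<and>
    (\<forall>A \<in> Ob C. \<forall>B \<in> Ob C.
       Fa (braid C A B) \<cdot>\<^bsub>D\<^esub> \<phi> A B = \<phi> B A \<cdot>\<^bsub>D\<^esub> braid D (Fo A) (Fo B))"

definition is_dual ::
  "('o, 'm, 'x) tensor_cat_scheme \<Rightarrow> 'o \<Rightarrow> 'o \<Rightarrow> 'm \<Rightarrow> 'm \<Rightarrow> bool" where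
  "is_dual C A A' ev coev \<longleftrightarrow> A \<in> Ob C \<and> A' \<in> Ob C \<and>
    ev \<in> Hom C (A \<otimes>\<^sub>o\<^bsub>C\<^esub> A') (tunit C) \<and> coev \<in> Hom C (tunit C) (A' \<otimes>\<^sub>o\<^bsub>C\<^esub> A) \<and>
    lunit C A \<cdot>\<^bsub>C\<^esub> (ev \<otimes>\<^sub>m\<^bsub>C\<^esub> cid C A) \<cdot>\<^bsub>C\<^esub> inverse_arrow C (assoc C A A' A)
      \<cdot>\<^bsub>C\<^esub> (cid C A \<otimes>\<^sub>m\<^bsub>C\<^esub> coev) \<cdot>\<^bsub>C\<^esub> inverse_arrow C (runit C A) = cid C A \<and>
    runit C A' \<cdot>\<^bsub>C\<^esub> (cid C A' \<otimes>\<^sub>m\<^bsub>C\<^esub> ev) \<cdot>\<^bsub>C\<^esub> assoc C A' A A'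
      \<cdot>\<^bsub>C\<^esub> (coev \<otimes>\<^sub>m\<^bsub>C\<^esub> cid C A') \<cdot>\<^bsub>C\<^esub> inverse_arrow C (lunit C A') = cid C A'"

locale rigid_abelian_tensor_category = tensor_category + abelian_category +
  assumes ex_dual: "A \<in> Ob C \<Longrightarrow> \<exists>A' ev coev. is_dual C A A' ev coev"

text \<open>Duals are unique up to unique isomorphism; traces and kernels of adjuncts do not depend on the
  choice made here.\<close>

definition dual_data :: "('o, 'm, 'x) tensor_cat_scheme \<Rightarrow> 'o \<Rightarrow> 'o \<times> 'm \<times> 'm" where
  "dual_data C A = (SOME (A', ev, coev). is_dual C A A' ev coev)"

definition dual :: "('o, 'm, 'x) tensor_cat_scheme \<Rightarrow> 'o \<Rightarrow> 'o" where
  "dual C A = fst (dual_data C A)"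

definition ev :: "('o, 'm, 'x) tensor_cat_scheme \<Rightarrow> 'o \<Rightarrow> 'm" where
  "ev C A = fst (snd (dual_data C A))"

definition coev :: "('o, 'm, 'x) tensor_cat_scheme \<Rightarrow> 'o \<Rightarrow> 'm" where
  "coev C A = snd (snd (dual_data C A))"

definition adjunct :: "('o, 'm, 'x) tensor_cat_scheme \<Rightarrow> 'm \<Rightarrow> 'm" where
  "adjunct C f = (cid C (dual C (src C f)) \<otimes>\<^sub>m\<^bsub>C\<^esub> f) \<cdot>\<^bsub>C\<^esub> coev C (src C f)"

definition tr :: "('o, 'm, 'x) tensor_cat_scheme \<Rightarrow> 'm \<Rightarrow> 'm" where
  "tr C f = ev C (src C f) \<cdot>\<^bsub>C\<^esub> braid C (dual C (src C f)) (src C f) \<cdot>\<^bsub>C\<^esub> adjunct C f"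

definition End_unit :: "('o, 'm, 'x) tensor_cat_scheme \<Rightarrow> 'm ring" where
  "End_unit C = \<lparr>carrier = Hom C (tunit C) (tunit C), monoid.mult = ccomp C,
    one = cid C (tunit C), ring.zero = czero C (tunit C) (tunit C), ring.add = cplus C\<rparr>"

definition scalar :: "('o, 'm, 'x) tensor_cat_scheme \<Rightarrow> 'm \<Rightarrow> 'm \<Rightarrow> 'm" where
  "scalar C z f = lunit C (tgt C f) \<cdot>\<^bsub>C\<^esub> (z \<otimes>\<^sub>m\<^bsub>C\<^esub> f) \<cdot>\<^bsub>C\<^esub> inverse_arrow C (lunit C (src C f))"

text \<open>An ideal is given by the set of all its morphisms; its component \<open>\<II>(A, B)\<close> is
  \<open>\<II> \<inter> Hom C A B\<close>.\<close>

definition tensor_ideal :: "('o, 'm, 'x) tensor_cat_scheme \<Rightarrow> 'm set \<Rightarrow> bool" where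
  "tensor_ideal C \<II> \<longleftrightarrow> \<II> \<subseteq> Ar C \<and>
    (\<forall>A \<in> Ob C. \<forall>B \<in> Ob C. subgroup (\<II> \<inter> Hom C A B) (hom_group C A B)) \<and>
    (\<forall>f \<in> \<II>. \<forall>g \<in> Ar C. src C g = tgt C f \<longrightarrow> g \<cdot>\<^bsub>C\<^esub> f \<in> \<II>) \<and>
    (\<forall>f \<in> \<II>. \<forall>g \<in> Ar C. tgt C g = src C f \<longrightarrow> f \<cdot>\<^bsub>C\<^esub> g \<in> \<II>) \<and>
    (\<forall>f \<in> \<II>. \<forall>g \<in> Ar C. f \<otimes>\<^sub>m\<^bsub>C\<^esub> g \<in> \<II> \<and> g \<otimes>\<^sub>m\<^bsub>C\<^esub> f \<in> \<II>)"

definition ideal_class :: "('o, 'm, 'x) tensor_cat_scheme \<Rightarrow> 'm set \<Rightarrow> 'm \<Rightarrow> 'm set" where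
  "ideal_class C \<II> f = {f \<boxplus>\<^bsub>C\<^esub> d | d. d \<in> \<II> \<inter> Hom C (src C f) (tgt C f)}"

definition ideal_quotient ::
  "('o, 'm, 'x) tensor_cat_scheme \<Rightarrow> 'm set \<Rightarrow> ('o, 'm set) tensor_cat" where
  "ideal_quotient C \<II> = (let cl = ideal_class C \<II>; rep = (\<lambda>X. SOME f. f \<in> X) in
    \<lparr>Ob = Ob C, Ar = cl ` Ar C,
     src = (\<lambda>X. src C (rep X)), tgt = (\<lambda>X. tgt C (rep X)),
     cid = (\<lambda>A. cl (cid C A)),
     ccomp = (\<lambda>Y X. cl (rep Y \<cdot>\<^bsub>C\<^esub> rep X)),
     czero = (\<lambda>A B. cl (czero C A B)),
     cplus = (\<lambda>X Y. cl (rep X \<boxplus>\<^bsub>C\<^esub> rep Y)),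
     tunit = tunit C, tens_ob = tens_ob C,
     tens = (\<lambda>X Y. cl (rep X \<otimes>\<^sub>m\<^bsub>C\<^esub> rep Y)),
     assoc = (\<lambda>A B D. cl (assoc C A B D)),
     lunit = (\<lambda>A. cl (lunit C A)), runit = (\<lambda>A. cl (runit C A)),
     braid = (\<lambda>A B. cl (braid C A B))\<rparr>)"

definition integral_tensor_cat :: "('o, 'm, 'x) tensor_cat_scheme \<Rightarrow> bool" where
  "integral_tensor_cat C \<longleftrightarrow> (\<forall>f \<in> Ar C. \<forall>g \<in> Ar C.
    f \<otimes>\<^sub>m\<^bsub>C\<^esub> g = czero C (src C f \<otimes>\<^sub>o\<^bsub>C\<^esub> src C g) (tgt C f \<otimes>\<^sub>o\<^bsub>C\<^esub> tgt C g) \<longrightarrow>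
    f = czero C (src C f) (tgt C f) \<or> g = czero C (src C g) (tgt C g))"

definition prime_tensor_ideal :: "('o, 'm, 'x) tensor_cat_scheme \<Rightarrow> 'm set \<Rightarrow> bool" where
  "prime_tensor_ideal C \<P> \<longleftrightarrow>
    tensor_ideal C \<P> \<and> \<P> \<noteq> Ar C \<and> integral_tensor_cat (ideal_quotient C \<P>)"

definition tensor_Spec :: "('o, 'm, 'x) tensor_cat_scheme \<Rightarrow> 'm set set" where
  "tensor_Spec C = {\<P>. prime_tensor_ideal C \<P>}"

definition ring_Spec :: "('a, 'x) ring_scheme \<Rightarrow> 'a set set" where
  "ring_Spec R = {P. primeideal P R}"

text \<open>The topology on \<open>S\<close> whose closed sets are \<open>V(I) = {P \<in> S. I \<subseteq> P}\<close> for \<open>I \<in> \<J>\<close>.\<close>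

definition hull_topology :: "'a set set \<Rightarrow> 'a set set \<Rightarrow> 'a set topology" where
  "hull_topology S \<J> = topology (\<lambda>U. \<exists>I \<in> \<J>. U = S - {P \<in> S. I \<subseteq> P})"

definition tensor_Spec_topology :: "('o, 'm, 'x) tensor_cat_scheme \<Rightarrow> 'm set topology" where
  "tensor_Spec_topology C = hull_topology (tensor_Spec C) {\<II>. tensor_ideal C \<II>}"

definition ring_Spec_topology :: "('a, 'x) ring_scheme \<Rightarrow> 'a set topology" where
  "ring_Spec_topology R = hull_topology (ring_Spec R) {I. ideal I R}"

definition spectral_map :: "'a topology \<Rightarrow> 'b topology \<Rightarrow> ('a \<Rightarrow> 'b) \<Rightarrow> bool" where
  "spectral_map X Y f \<longleftrightarrow> continuous_map X Y f \<and>
    (\<forall>U. openin Y U \<and> compactin Y U \<longrightarrow> compactin X {x \<in> topspace X. f x \<in> U})"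

definition ideal_at_unit :: "('o, 'm, 'x) tensor_cat_scheme \<Rightarrow> 'm set \<Rightarrow> 'm set" where
  "ideal_at_unit C \<II> = \<II> \<inter> Hom C (tunit C) (tunit C)"

definition extended_ideal :: "('o, 'm, 'x) tensor_cat_scheme \<Rightarrow> 'm set \<Rightarrow> 'm set" where
  "extended_ideal C I = (\<Union>A \<in> Ob C. \<Union>B \<in> Ob C.
    generate (hom_group C A B) {scalar C z f | z f. z \<in> I \<and> f \<in> Hom C A B})"

definition sigma_tr :: "('o, 'm, 'x) tensor_cat_scheme \<Rightarrow> 'm set \<Rightarrow> 'm set" where
  "sigma_tr C P = {f \<in> Ar C. \<forall>g \<in> Hom C (tgt C f) (src C f). tr C (g \<cdot>\<^bsub>C\<^esub> f) \<in> P}"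

text \<open>Subobjects are represented by monomorphisms. Kernels and complements are only determined
  up to isomorphism over the ambient object; the idempotents defined below are independent of
  the choice.\<close>

definition is_complement :: "('o, 'm, 'x) add_cat_scheme \<Rightarrow> 'm \<Rightarrow> 'm \<Rightarrow> bool" where
  "is_complement C u v \<longleftrightarrow>
    (\<exists>p q. is_biproduct C (tgt C u) (src C u) (src C v) u v p q)"

definition complement :: "('o, 'm, 'x) add_cat_scheme \<Rightarrow> 'm \<Rightarrow> 'm" where
  "complement C u = (SOME v. is_complement C u v)"

definition subunit_idem :: "('o, 'm, 'x) tensor_cat_scheme \<Rightarrow> 'm \<Rightarrow> 'm" where
  "subunit_idem C u = (THE e. e \<in> Hom C (tunit C) (tunit C) \<and> e \<cdot>\<^bsub>C\<^esub> e = e \<and>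
    is_image C e u \<and> is_kernel C e (complement C u))"

definition Supp :: "('o, 'm, 'x) tensor_cat_scheme \<Rightarrow> 'm \<Rightarrow> 'm" where
  "Supp C f = complement C (SOME k. is_kernel C (adjunct C f) k)"

definition supp_idem :: "('o, 'm, 'x) tensor_cat_scheme \<Rightarrow> 'm \<Rightarrow> 'm" where
  "supp_idem C f = subunit_idem C (Supp C f)"

definition serre_ideal :: "('o, 'm, 'x) tensor_cat_scheme \<Rightarrow> 'm set \<Rightarrow> 'o set" where
  "serre_ideal C I = {A \<in> Ob C. supp_idem C (cid C A) \<in> I}"

text \<open>The Serre quotient of \<open>C\<close> by a Serre subcategory with object set \<open>S\<close> is the localization of
  \<open>C\<close> at the morphisms with kernel and cokernel in \<open>S\<close>. A morphism from \<open>A\<close> to \<open>B\<close> is an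
  equivalence class of fractions \<open>(s, f)\<close>, standing for \<open>f s\<^sup>-\<^sup>1\<close>, with \<open>s : A' \<rightarrow> A\<close> inverted and
  \<open>f : A' \<rightarrow> B\<close>.\<close>

definition inverted :: "('o, 'm, 'x) add_cat_scheme \<Rightarrow> 'o set \<Rightarrow> 'm set" where
  "inverted C S = {s \<in> Ar C. (\<exists>k. is_kernel C s k \<and> src C k \<in> S) \<and>
                             (\<exists>q. is_cokernel C s q \<and> tgt C q \<in> S)}"

definition fractions :: "('o, 'm, 'x) add_cat_scheme \<Rightarrow> 'o set \<Rightarrow> ('m \<times> 'm) set" where
  "fractions C S = {(s, f). s \<in> inverted C S \<and> f \<in> Ar C \<and> src C s = src C f}"

definition common_denominator ::
  "('o, 'm, 'x) add_cat_scheme \<Rightarrow> 'o set \<Rightarrow> 'm \<Rightarrow> 'm \<Rightarrow> 'm \<Rightarrow> 'm \<Rightarrow> bool" where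
  "common_denominator C S s t u v \<longleftrightarrow>
    u \<in> Ar C \<and> v \<in> Ar C \<and> src C u = src C v \<and> tgt C u = src C s \<and> tgt C v = src C t \<and>
    s \<cdot>\<^bsub>C\<^esub> u = t \<cdot>\<^bsub>C\<^esub> v \<and> s \<cdot>\<^bsub>C\<^esub> u \<in> inverted C S"

definition fraction_class ::
  "('o, 'm, 'x) add_cat_scheme \<Rightarrow> 'o set \<Rightarrow> 'm \<times> 'm \<Rightarrow> ('m \<times> 'm) set" where
  "fraction_class C S = (\<lambda>(s, f). {(t, g) \<in> fractions C S.
    tgt C s = tgt C t \<and> tgt C f = tgt C g \<and>
    (\<exists>u v. common_denominator C S s t u v \<and> f \<cdot>\<^bsub>C\<^esub> u = g \<cdot>\<^bsub>C\<^esub> v)})"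

definition localize :: "('o, 'm, 'x) add_cat_scheme \<Rightarrow> 'o set \<Rightarrow> 'm \<Rightarrow> ('m \<times> 'm) set" where
  "localize C S f = fraction_class C S (cid C (src C f), f)"

text \<open>Composition, sum and tensor product are written as unions over all choices of
  representatives (and of Ore squares \<open>f u = t h\<close>, respectively common denominators);
  all choices yield the same class.\<close>

definition serre_quotient ::
  "('o, 'm, 'x) tensor_cat_scheme \<Rightarrow> 'o set \<Rightarrow> ('o, ('m \<times> 'm) set) tensor_cat" where
  "serre_quotient C S = (let cl = fraction_class C S; Q = localize C S in
    \<lparr>Ob = Ob C, Ar = cl ` fractions C S,
     src = (\<lambda>X. tgt C (fst (SOME r. r \<in> X))), tgt = (\<lambda>X. tgt C (snd (SOME r. r \<in> X))),
     cid = (\<lambda>A. Q (cid C A)),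
     ccomp = (\<lambda>Y X. \<Union> {cl (s \<cdot>\<^bsub>C\<^esub> u, g \<cdot>\<^bsub>C\<^esub> h) | s f t g u h.
       (s, f) \<in> X \<and> (t, g) \<in> Y \<and> u \<in> inverted C S \<and> h \<in> Ar C \<and> src C u = src C h \<and>
       tgt C u = src C s \<and> tgt C h = src C t \<and> f \<cdot>\<^bsub>C\<^esub> u = t \<cdot>\<^bsub>C\<^esub> h}),
     czero = (\<lambda>A B. Q (czero C A B)),
     cplus = (\<lambda>X Y. \<Union> {cl (s \<cdot>\<^bsub>C\<^esub> u, f \<cdot>\<^bsub>C\<^esub> u \<boxplus>\<^bsub>C\<^esub> g \<cdot>\<^bsub>C\<^esub> v) | s f t g u v.
       (s, f) \<in> X \<and> (t, g) \<in> Y \<and> common_denominator C S s t u v}),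
     tunit = tunit C, tens_ob = tens_ob C,
     tens = (\<lambda>X Y. \<Union> {cl (s \<otimes>\<^sub>m\<^bsub>C\<^esub> t, f \<otimes>\<^sub>m\<^bsub>C\<^esub> g) | s f t g. (s, f) \<in> X \<and> (t, g) \<in> Y}),
     assoc = (\<lambda>A B D. Q (assoc C A B D)),
     lunit = (\<lambda>A. Q (lunit C A)), runit = (\<lambda>A. Q (runit C A)),
     braid = (\<lambda>A B. Q (braid C A B))\<rparr>)"

definition serre_quot_by :: "('o, 'm, 'x) tensor_cat_scheme \<Rightarrow> 'm set \<Rightarrow>
    ('o, ('m \<times> 'm) set) tensor_cat" where
  "serre_quot_by C I = serre_quotient C (serre_ideal C I)"

definition ideal_oplus :: "('o, 'm, 'x) tensor_cat_scheme \<Rightarrow> 'm set \<Rightarrow> 'm set" where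
  "ideal_oplus C I = {f \<in> Ar C. localize C (serre_ideal C I) f =
     czero (serre_quot_by C I) (src C f) (tgt C f)}"

text \<open>The morphism part of the functor; it is the identity on objects. For \<open>X\<close> a class modulo
  \<^term>\<open>ideal_oplus C I\<close> the value does not depend on the representative.\<close>

definition oplus_functor ::
  "('o, 'm, 'x) tensor_cat_scheme \<Rightarrow> 'm set \<Rightarrow> 'm set \<Rightarrow> ('m \<times> 'm) set" where
  "oplus_functor C I X = localize C (serre_ideal C I) (SOME f. f \<in> X)"

end

theory Submission
  imports Defs "HOL-Algebra.Ring_Divisibility"
begin

text \<open>
  Scalars \<open>z \<in> Z(\<A>)\<close> act on every morphism, and \<open>e(f)\<close> is the idempotent which generates the
  complement of the annihilator of \<open>f\<close>. It exists because subobjects of the unit split off: if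
  \<open>U \<rightarrow> \<one>\<close> has cokernel \<open>Q\<close>, then \<open>U \<otimes> Q = 0\<close> by exactness of the tensor product, so that
  \<open>U \<rightarrow> \<one>\<close> becomes invertible after tensoring with \<open>U\<close>. Thus \<open>f \<in> I\<^sub>\<oplus>\<close> if and only if \<open>m f = 0\<close> for some idempotent
  \<open>m\<close> with \<open>1 - m \<in> I\<close>.

  Since kernels and cokernels are compatible with splitting along such an \<open>m\<close>, a morphism \<open>s\<close> is
  inverted in \<open>\<A>//I\<close> exactly if it is invertible modulo \<open>I\<^sub>\<oplus>\<close>. A fraction \<open>f s\<^sup>-\<^sup>1\<close> is therefore
  represented by an honest morphism, unique modulo \<open>I\<^sub>\<oplus>\<close>, which makes \<open>\<A>/I\<^sub>\<oplus>\<close> and \<open>\<A>//I\<close> isomorphic.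

  For primality of \<open>P\<^sub>\<oplus>\<close>, the adjoints of \<open>f\<close> and \<open>g\<close> are monomorphisms on their supports and so is
  their tensor product, whence \<open>e(f) e(g) = 0\<close> as soon as \<open>f \<otimes> g = 0\<close>. The inverse image under \<open>\<sigma>\<close> of
  the locus \<open>f \<notin> \<P>\<close> is the locus \<open>e(f) \<notin> P\<close>, open and closed in the quasi-compact space
  \<open>Spec Z(\<A>)\<close>, so \<open>\<sigma>\<close> is spectral.
\<close>

text \<open>The hard input is that a subobject of the unit splits: the data contain no retraction,
  and it has to be produced from duality alone. Duality also supplies the exactness that is used.
  Tensoring with a dualizable object is an adjoint, so it keeps monomorphisms or epimorphisms, and
  the braiding moves the result to the other factor.

  Supports are read off adjuncts because scalars act by precomposition on a morphism out of the
  unit: \<open>z\<close> kills \<open>f\<close> exactly if \<open>z\<close> factors through the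
  kernel of the adjunct of \<open>f\<close>. For a scalar \<open>z\<close> the splitting makes
  \<open>z\<close> and \<open>supp_idem C z\<close> generate the same ideal, which is why \<pi>
  gives back all of \<open>I\<close> and not only the part generated by idempotents.

  A relation modulo \<open>I\<close> is kept as an honest equation
  \<open>m \<star> f = m \<star> g\<close>. The admissible \<open>m\<close> are closed under
  products, so finitely many relations share one \<open>m\<close>, and the calculus of fractions
  turns into computations in \<open>C\<close>. Both quotient records are mere data, described by
  chosen representatives or by unions over choices. Once each operation is shown to be the image of
  the one of \<open>C\<close>, the equational axioms follow for both in the same way.\<close>

declare Hom_def [simp]

subsection \<open>Arrows\<close>

context category
begin

lemma src_in_Ob [simp]: "f \<in> Ar C \<Longrightarrow> src C f \<in> Ob C"
  by (rule src_Ob)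

lemma tgt_in_Ob [simp]: "f \<in> Ar C \<Longrightarrow> tgt C f \<in> Ob C"
  by (rule tgt_Ob)

lemma cid_arr [simp]:
  assumes "A \<in> Ob C"
  shows "cid C A \<in> Ar C" "src C (cid C A) = A" "tgt C (cid C A) = A"
  using cid_Hom[OF assms] by auto

lemma comp_arr [simp]:
  assumes "f \<in> Ar C" "g \<in> Ar C" "src C g = tgt C f"
  shows "g \<cdot> f \<in> Ar C" "src C (g \<cdot> f) = src C f" "tgt C (g \<cdot> f) = tgt C g"
  using comp_Hom[of f "src C f" "tgt C f" g "tgt C g"] assms by auto

lemma comp_assoc' [simp]:
  assumes "f \<in> Ar C" "g \<in> Ar C" "h \<in> Ar C" "src C g = tgt C f" "src C h = tgt C g"
  shows "(h \<cdot> g) \<cdot> f = h \<cdot> (g \<cdot> f)"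
  using comp_assoc[of f "src C f" "tgt C f" g "tgt C g" h "tgt C h"] assms by auto

lemma comp_cid [simp]:
  assumes "f \<in> Ar C"
  shows "tgt C f = B \<Longrightarrow> cid C B \<cdot> f = f" "src C f = A \<Longrightarrow> f \<cdot> cid C A = f"
  using comp_cid_left[of f "src C f" "tgt C f"] comp_cid_right[of f "src C f" "tgt C f"] assms by auto

text \<open>Simplification brackets all composites to the right, so a known equation for
  \<open>a \<cdot> b\<close> no longer matches inside \<open>a \<cdot> (b \<cdot> x)\<close>. This
  lemma and the next restore it in that position.\<close>

lemma comp_pull:
  assumes "a \<cdot> b = c" "a \<in> Ar C" "b \<in> Ar C" "x \<in> Ar C" "src C a = tgt C b" "src C b = tgt C x"
  shows "a \<cdot> (b \<cdot> x) = c \<cdot> x"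
  using assms by (metis comp_assoc')

lemma comp_cong_pull:
  assumes "a \<cdot> b = c \<cdot> d" "a \<in> Ar C" "b \<in> Ar C" "c \<in> Ar C" "d \<in> Ar C" "x \<in> Ar C"
    "src C a = tgt C b" "src C c = tgt C d" "src C b = tgt C x" "src C d = tgt C x"
  shows "a \<cdot> (b \<cdot> x) = c \<cdot> (d \<cdot> x)"
  using assms by (metis comp_assoc')

lemma monoD:
  assumes "is_mono C f" "g \<in> Ar C" "h \<in> Ar C" "tgt C g = src C f" "tgt C h = src C f"
    "src C g = src C h" "f \<cdot> g = f \<cdot> h"
  shows "g = h"
  using assms unfolding is_mono_def by auto

lemma epiD:
  assumes "is_epi C f" "g \<in> Ar C" "h \<in> Ar C" "src C g = tgt C f" "src C h = tgt C f"
    "tgt C g = tgt C h" "g \<cdot> f = h \<cdot> f"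
  shows "g = h"
  using assms unfolding is_epi_def by auto

lemma inverse_arrowsD:
  assumes "inverse_arrows C f g"
  shows "f \<in> Ar C" "g \<in> Ar C" "src C g = tgt C f" "tgt C g = src C f"
    "g \<cdot> f = cid C (src C f)" "f \<cdot> g = cid C (tgt C f)"
  using assms unfolding inverse_arrows_def by auto

lemma inverse_arrows_sym: "inverse_arrows C f g \<Longrightarrow> inverse_arrows C g f"
  unfolding inverse_arrows_def by auto

lemma inverse_arrows_unique:
  assumes "inverse_arrows C f g" "inverse_arrows C f h"
  shows "g = h"
proof -
  note a = inverse_arrowsD[OF assms(1)] and b = inverse_arrowsD[OF assms(2)]
  have "g = g \<cdot> (f \<cdot> h)" using a b by simp
  also have "\<dots> = (g \<cdot> f) \<cdot> h" by (rule comp_assoc'[symmetric]) (use a b in auto)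
  also have "\<dots> = h" unfolding a(5) using b by simp
  finally show ?thesis .
qed

lemma inverse_arrow_eq: "inverse_arrows C f g \<Longrightarrow> inverse_arrow C f = g"
  unfolding inverse_arrow_def using inverse_arrows_unique by blast

lemma inverse_arrows_inverse_arrow: "is_iso C f \<Longrightarrow> inverse_arrows C f (inverse_arrow C f)"
  unfolding is_iso_def using inverse_arrow_eq by metis

lemmas inverse_arrow_arr [simp] = inverse_arrowsD(2-4)[OF inverse_arrows_inverse_arrow]
lemmas inverse_arrow_comp = inverse_arrowsD(5,6)[OF inverse_arrows_inverse_arrow]

lemma is_iso_arr: "is_iso C f \<Longrightarrow> f \<in> Ar C"
  using inverse_arrows_inverse_arrow inverse_arrowsD by blast

lemma inverse_arrow_comp_left [simp]:
  assumes "is_iso C f"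
  shows "A = src C f \<Longrightarrow> inverse_arrow C f \<cdot> f = cid C A"
    "x \<in> Ar C \<Longrightarrow> tgt C x = src C f \<Longrightarrow> inverse_arrow C f \<cdot> (f \<cdot> x) = x"
  using assms is_iso_arr[OF assms] by (simp_all add: inverse_arrow_comp comp_pull[OF inverse_arrow_comp(1)])

lemma inverse_arrow_comp_right [simp]:
  assumes "is_iso C f"
  shows "f \<cdot> inverse_arrow C f = cid C (tgt C f)"
    "x \<in> Ar C \<Longrightarrow> tgt C x = tgt C f \<Longrightarrow> f \<cdot> (inverse_arrow C f \<cdot> x) = x"
  using assms is_iso_arr[OF assms] by (simp_all add: inverse_arrow_comp comp_pull[OF inverse_arrow_comp(2)])

lemma isoI:
  assumes "f \<in> Ar C" "g \<in> Ar C" "src C g = tgt C f" "tgt C g = src C f"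
    "g \<cdot> f = cid C (src C f)" "f \<cdot> g = cid C (tgt C f)"
  shows "is_iso C f"
  unfolding is_iso_def inverse_arrows_def using assms by auto

lemma iso_cid [simp]: "A \<in> Ob C \<Longrightarrow> is_iso C (cid C A)"
  by (rule isoI[of _ "cid C A"]) auto

lemma iso_cancel_left:
  assumes "is_iso C f" "f \<cdot> g = f \<cdot> h" "g \<in> Ar C" "h \<in> Ar C" "tgt C g = src C f" "tgt C h = src C f"
  shows "g = h"
  using assms inverse_arrow_comp_left(2) by metis

lemma iso_cancel_right:
  assumes "is_iso C f" "g \<cdot> f = h \<cdot> f" "g \<in> Ar C" "h \<in> Ar C" "src C g = tgt C f" "src C h = tgt C f"
  shows "g = h"
proof -
  note [simp] = assms(1,3-6) is_iso_arr[OF assms(1)]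
  have "g = (g \<cdot> f) \<cdot> inverse_arrow C f" by simp
  also have "\<dots> = h" unfolding assms(2) by simp
  finally show ?thesis .
qed

lemma iso_mono: "is_iso C f \<Longrightarrow> is_mono C f"
  unfolding is_mono_def by (auto dest: is_iso_arr iso_cancel_left)

lemma iso_comp:
  assumes "is_iso C f" "is_iso C g" "src C g = tgt C f"
  shows "is_iso C (g \<cdot> f)"
  using assms is_iso_arr[of f] is_iso_arr[of g]
  by (intro isoI[of _ "inverse_arrow C f \<cdot> inverse_arrow C g"]) auto

lemma mono_arr: "is_mono C f \<Longrightarrow> f \<in> Ar C"
  unfolding is_mono_def by auto

lemma epi_arr: "is_epi C f \<Longrightarrow> f \<in> Ar C"
  unfolding is_epi_def by auto

lemma mono_comp:
  assumes "is_mono C f" "is_mono C g" "src C g = tgt C f"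
  shows "is_mono C (g \<cdot> f)"
  unfolding is_mono_def
proof (intro conjI allI ballI impI)
  note [simp] = mono_arr[OF assms(1)] mono_arr[OF assms(2)]
  show "g \<cdot> f \<in> Ar C" using assms by simp
  fix A x y assume a: "x \<in> Hom C A (src C (g \<cdot> f))" "y \<in> Hom C A (src C (g \<cdot> f))"
    "(g \<cdot> f) \<cdot> x = (g \<cdot> f) \<cdot> y"
  then have "g \<cdot> (f \<cdot> x) = g \<cdot> (f \<cdot> y)" using assms by simp
  then have "f \<cdot> x = f \<cdot> y" using a assms by - (rule monoD[OF assms(2)], auto)
  then show "x = y" using a assms by - (rule monoD[OF assms(1)], auto)
qed

end

subsection \<open>Coherence in symmetric monoidal categories\<close>

context symmetric_monoidal_category
begin

lemma tens_arr [simp]: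
  assumes "f \<in> Ar C" "g \<in> Ar C"
  shows "f \<otimes>\<^sub>m g \<in> Ar C" "src C (f \<otimes>\<^sub>m g) = src C f \<otimes>\<^sub>o src C g"
    "tgt C (f \<otimes>\<^sub>m g) = tgt C f \<otimes>\<^sub>o tgt C g"
  using tens_Hom[of f "src C f" "tgt C f" g "src C g" "tgt C g"] assms by auto

declare tunit_Ob [simp] tens_Ob [simp] tens_cid [simp]
declare assoc_iso [simp] lunit_iso [simp] runit_iso [simp]

lemma assoc_arr [simp]:
  assumes "A \<in> Ob C" "B \<in> Ob C" "D \<in> Ob C"
  shows "assoc C A B D \<in> Ar C" "src C (assoc C A B D) = (A \<otimes>\<^sub>o B) \<otimes>\<^sub>o D"
    "tgt C (assoc C A B D) = A \<otimes>\<^sub>o (B \<otimes>\<^sub>o D)"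
  using assoc_Hom[OF assms] by auto

lemma lunit_arr [simp]:
  assumes "A \<in> Ob C"
  shows "lunit C A \<in> Ar C" "src C (lunit C A) = tunit C \<otimes>\<^sub>o A" "tgt C (lunit C A) = A"
  using lunit_Hom[OF assms] by auto

lemma runit_arr [simp]:
  assumes "A \<in> Ob C"
  shows "runit C A \<in> Ar C" "src C (runit C A) = A \<otimes>\<^sub>o tunit C" "tgt C (runit C A) = A"
  using runit_Hom[OF assms] by auto

lemma braid_arr [simp]:
  assumes "A \<in> Ob C" "B \<in> Ob C"
  shows "braid C A B \<in> Ar C" "src C (braid C A B) = A \<otimes>\<^sub>o B" "tgt C (braid C A B) = B \<otimes>\<^sub>o A"
  using braid_Hom[OF assms] by auto

lemma braid_iso [simp]: "A \<in> Ob C \<Longrightarrow> B \<in> Ob C \<Longrightarrow> is_iso C (braid C A B)"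
  by (rule isoI[of _ "braid C B A"]) (auto simp: braid_symmetric)

lemma tens_comp' [simp]:
  assumes "f \<in> Ar C" "f' \<in> Ar C" "g \<in> Ar C" "g' \<in> Ar C" "src C f' = tgt C f" "src C g' = tgt C g"
  shows "(f' \<otimes>\<^sub>m g') \<cdot> (f \<otimes>\<^sub>m g) = (f' \<cdot> f) \<otimes>\<^sub>m (g' \<cdot> g)"
    "x \<in> Ar C \<Longrightarrow> tgt C x = src C f \<otimes>\<^sub>o src C g \<Longrightarrow>
      (f' \<otimes>\<^sub>m g') \<cdot> ((f \<otimes>\<^sub>m g) \<cdot> x) = ((f' \<cdot> f) \<otimes>\<^sub>m (g' \<cdot> g)) \<cdot> x"
proof -
  show 1: "(f' \<otimes>\<^sub>m g') \<cdot> (f \<otimes>\<^sub>m g) = (f' \<cdot> f) \<otimes>\<^sub>m (g' \<cdot> g)"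
    using tens_comp[of f "src C f" "tgt C f" f' "tgt C f'" g "src C g" "tgt C g" g' "tgt C g'"] assms by simp
  show "(f' \<otimes>\<^sub>m g') \<cdot> ((f \<otimes>\<^sub>m g) \<cdot> x) = ((f' \<cdot> f) \<otimes>\<^sub>m (g' \<cdot> g)) \<cdot> x"
    if "x \<in> Ar C" "tgt C x = src C f \<otimes>\<^sub>o src C g"
    by (rule comp_pull[OF 1]) (use assms that in auto)
qed

lemma assoc_nat:
  assumes "f \<in> Ar C" "g \<in> Ar C" "h \<in> Ar C" "tgt C f = A" "tgt C g = B" "tgt C h = D"
  shows "assoc C A B D \<cdot> ((f \<otimes>\<^sub>m g) \<otimes>\<^sub>m h) = (f \<otimes>\<^sub>m (g \<otimes>\<^sub>m h)) \<cdot> assoc C (src C f) (src C g) (src C h)"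
    "x \<in> Ar C \<Longrightarrow> tgt C x = (src C f \<otimes>\<^sub>o src C g) \<otimes>\<^sub>o src C h \<Longrightarrow>
     assoc C A B D \<cdot> (((f \<otimes>\<^sub>m g) \<otimes>\<^sub>m h) \<cdot> x) = (f \<otimes>\<^sub>m (g \<otimes>\<^sub>m h)) \<cdot> (assoc C (src C f) (src C g) (src C h) \<cdot> x)"
proof -
  show 1: "assoc C A B D \<cdot> ((f \<otimes>\<^sub>m g) \<otimes>\<^sub>m h) = (f \<otimes>\<^sub>m (g \<otimes>\<^sub>m h)) \<cdot> assoc C (src C f) (src C g) (src C h)"
    using assoc_natural[of f "src C f" "tgt C f" g "src C g" "tgt C g" h "src C h" "tgt C h"] assms by simp
  show "assoc C A B D \<cdot> (((f \<otimes>\<^sub>m g) \<otimes>\<^sub>m h) \<cdot> x) = (f \<otimes>\<^sub>m (g \<otimes>\<^sub>m h)) \<cdot> (assoc C (src C f) (src C g) (src C h) \<cdot> x)"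
    if "x \<in> Ar C" "tgt C x = (src C f \<otimes>\<^sub>o src C g) \<otimes>\<^sub>o src C h"
    by (rule comp_cong_pull[OF 1]) (use assms that in auto)
qed

abbreviation "associ A B D \<equiv> inverse_arrow C (assoc C A B D)"
abbreviation "luniti A \<equiv> inverse_arrow C (lunit C A)"
abbreviation "runiti A \<equiv> inverse_arrow C (runit C A)"

text \<open>Conjugating a commutative square by the inverses of its vertical sides. It yields
  naturality of all inverse structure maps, and of the inverse action map in
  \<open>subunit_retraction\<close>.\<close>

lemma inverse_nat:
  assumes "is_iso C a" "is_iso C b" "b \<cdot> f = g \<cdot> a" "f \<in> Ar C" "g \<in> Ar C" "src C f = src C a"
    "tgt C f = src C b" "src C g = tgt C a" "tgt C g = tgt C b"
  shows "inverse_arrow C b \<cdot> g = f \<cdot> inverse_arrow C a"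
proof -
  note [simp] = is_iso_arr[OF assms(1)] is_iso_arr[OF assms(2)]
  have "inverse_arrow C b \<cdot> g = inverse_arrow C b \<cdot> ((g \<cdot> a) \<cdot> inverse_arrow C a)"
    using assms by simp
  also have "\<dots> = f \<cdot> inverse_arrow C a" unfolding assms(3)[symmetric] using assms(1,2,4-) by simp
  finally show ?thesis .
qed

lemma associ_nat:
  assumes "f \<in> Ar C" "g \<in> Ar C" "h \<in> Ar C" "tgt C f = A" "tgt C g = B" "tgt C h = D"
  shows "associ A B D \<cdot> (f \<otimes>\<^sub>m (g \<otimes>\<^sub>m h)) = ((f \<otimes>\<^sub>m g) \<otimes>\<^sub>m h) \<cdot> associ (src C f) (src C g) (src C h)"
    "x \<in> Ar C \<Longrightarrow> tgt C x = src C f \<otimes>\<^sub>o (src C g \<otimes>\<^sub>o src C h) \<Longrightarrow>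
     associ A B D \<cdot> ((f \<otimes>\<^sub>m (g \<otimes>\<^sub>m h)) \<cdot> x) = ((f \<otimes>\<^sub>m g) \<otimes>\<^sub>m h) \<cdot> (associ (src C f) (src C g) (src C h) \<cdot> x)"
proof -
  show 1: "associ A B D \<cdot> (f \<otimes>\<^sub>m (g \<otimes>\<^sub>m h)) = ((f \<otimes>\<^sub>m g) \<otimes>\<^sub>m h) \<cdot> associ (src C f) (src C g) (src C h)"
    by (rule inverse_nat) (use assms assoc_nat(1)[OF assms] in auto)
  show "associ A B D \<cdot> ((f \<otimes>\<^sub>m (g \<otimes>\<^sub>m h)) \<cdot> x) = ((f \<otimes>\<^sub>m g) \<otimes>\<^sub>m h) \<cdot> (associ (src C f) (src C g) (src C h) \<cdot> x)"
    if "x \<in> Ar C" "tgt C x = src C f \<otimes>\<^sub>o (src C g \<otimes>\<^sub>o src C h)"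
    by (rule comp_cong_pull[OF 1]) (use assms that in auto)
qed

lemma lunit_nat:
  assumes "f \<in> Ar C" "tgt C f = B"
  shows "lunit C B \<cdot> (cid C (tunit C) \<otimes>\<^sub>m f) = f \<cdot> lunit C (src C f)"
    "x \<in> Ar C \<Longrightarrow> tgt C x = tunit C \<otimes>\<^sub>o src C f \<Longrightarrow>
     lunit C B \<cdot> ((cid C (tunit C) \<otimes>\<^sub>m f) \<cdot> x) = f \<cdot> (lunit C (src C f) \<cdot> x)"
proof -
  show 1: "lunit C B \<cdot> (cid C (tunit C) \<otimes>\<^sub>m f) = f \<cdot> lunit C (src C f)"
    using lunit_natural[of f "src C f" B] assms by simp
  show "lunit C B \<cdot> ((cid C (tunit C) \<otimes>\<^sub>m f) \<cdot> x) = f \<cdot> (lunit C (src C f) \<cdot> x)"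
    if "x \<in> Ar C" "tgt C x = tunit C \<otimes>\<^sub>o src C f"
    by (rule comp_cong_pull[OF 1]) (use assms that in auto)
qed

lemma runit_nat:
  assumes "f \<in> Ar C" "tgt C f = B"
  shows "runit C B \<cdot> (f \<otimes>\<^sub>m cid C (tunit C)) = f \<cdot> runit C (src C f)"
    "x \<in> Ar C \<Longrightarrow> tgt C x = src C f \<otimes>\<^sub>o tunit C \<Longrightarrow>
     runit C B \<cdot> ((f \<otimes>\<^sub>m cid C (tunit C)) \<cdot> x) = f \<cdot> (runit C (src C f) \<cdot> x)"
proof -
  show 1: "runit C B \<cdot> (f \<otimes>\<^sub>m cid C (tunit C)) = f \<cdot> runit C (src C f)"
    using runit_natural[of f "src C f" B] assms by simp
  show "runit C B \<cdot> ((f \<otimes>\<^sub>m cid C (tunit C)) \<cdot> x) = f \<cdot> (runit C (src C f) \<cdot> x)"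
    if "x \<in> Ar C" "tgt C x = src C f \<otimes>\<^sub>o tunit C"
    by (rule comp_cong_pull[OF 1]) (use assms that in auto)
qed

lemma luniti_nat:
  assumes "f \<in> Ar C" "tgt C f = B"
  shows "luniti B \<cdot> f = (cid C (tunit C) \<otimes>\<^sub>m f) \<cdot> luniti (src C f)"
  by (rule inverse_nat) (use assms lunit_nat(1)[OF assms] in auto)

lemma runiti_nat:
  assumes "f \<in> Ar C" "tgt C f = B"
  shows "runiti B \<cdot> f = (f \<otimes>\<^sub>m cid C (tunit C)) \<cdot> runiti (src C f)"
  by (rule inverse_nat) (use assms runit_nat(1)[OF assms] in auto)

lemma braid_nat:
  assumes "f \<in> Ar C" "g \<in> Ar C" "tgt C f = A" "tgt C g = B"
  shows "braid C A B \<cdot> (f \<otimes>\<^sub>m g) = (g \<otimes>\<^sub>m f) \<cdot> braid C (src C f) (src C g)"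
    "x \<in> Ar C \<Longrightarrow> tgt C x = src C f \<otimes>\<^sub>o src C g \<Longrightarrow>
     braid C A B \<cdot> ((f \<otimes>\<^sub>m g) \<cdot> x) = (g \<otimes>\<^sub>m f) \<cdot> (braid C (src C f) (src C g) \<cdot> x)"
proof -
  show 1: "braid C A B \<cdot> (f \<otimes>\<^sub>m g) = (g \<otimes>\<^sub>m f) \<cdot> braid C (src C f) (src C g)"
    using braid_natural[of f "src C f" A g "src C g" B] assms by simp
  show "braid C A B \<cdot> ((f \<otimes>\<^sub>m g) \<cdot> x) = (g \<otimes>\<^sub>m f) \<cdot> (braid C (src C f) (src C g) \<cdot> x)"
    if "x \<in> Ar C" "tgt C x = src C f \<otimes>\<^sub>o src C g"
    by (rule comp_cong_pull[OF 1]) (use assms that in auto)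
qed

lemma tens_iso [simp]:
  assumes "is_iso C f" "is_iso C g"
  shows "is_iso C (f \<otimes>\<^sub>m g)"
  using assms is_iso_arr[of f] is_iso_arr[of g]
  by (intro isoI[of _ "inverse_arrow C f \<otimes>\<^sub>m inverse_arrow C g"]) auto

text \<open>Conjugation by the left unitor identifies tensoring with the unit with the identity
  functor, so it is faithful. Coherence identities may therefore be proved after tensoring with the
  unit, where pentagon and triangle apply.\<close>

lemma tunit_tens_cancel:
  assumes "cid C (tunit C) \<otimes>\<^sub>m f = cid C (tunit C) \<otimes>\<^sub>m g" "f \<in> Ar C" "g \<in> Ar C"
    "src C f = src C g" "tgt C f = tgt C g"
  shows "f = g"
proof -
  have "f \<cdot> lunit C (src C f) = g \<cdot> lunit C (src C f)"
    using lunit_nat(1)[of f] lunit_nat(1)[of g] assms by metis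
  then show ?thesis by (rule iso_cancel_right[rotated]) (use assms in auto)
qed

lemma tens_tunit_cancel:
  assumes "f \<otimes>\<^sub>m cid C (tunit C) = g \<otimes>\<^sub>m cid C (tunit C)" "f \<in> Ar C" "g \<in> Ar C"
    "src C f = src C g" "tgt C f = tgt C g"
  shows "f = g"
proof -
  have "f \<cdot> runit C (src C f) = g \<cdot> runit C (src C f)"
    using runit_nat(1)[of f] runit_nat(1)[of g] assms by metis
  then show ?thesis by (rule iso_cancel_right[rotated]) (use assms in auto)
qed

text \<open>Kelly's argument. After tensoring with the unit on the left, the pentagon for the unit,
  the unit, \<open>A\<close> and \<open>B\<close> reduces the claim to two uses of the triangle and
  naturality of the associator; the remaining edges are isomorphisms and cancel.\<close>

lemma lunit_tens:
  assumes [simp]: "A \<in> Ob C" "B \<in> Ob C"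
  shows "lunit C (A \<otimes>\<^sub>o B) \<cdot> assoc C (tunit C) A B = lunit C A \<otimes>\<^sub>m cid C B"
proof (rule tunit_tens_cancel)
  let ?I = "tunit C"
  let ?l = "cid C ?I \<otimes>\<^sub>m (lunit C (A \<otimes>\<^sub>o B) \<cdot> assoc C ?I A B)"
  let ?r = "cid C ?I \<otimes>\<^sub>m (lunit C A \<otimes>\<^sub>m cid C B)"
  let ?y = "assoc C ?I ?I A \<otimes>\<^sub>m cid C B" and ?x = "assoc C ?I (?I \<otimes>\<^sub>o A) B"
  have "?l \<cdot> (?x \<cdot> ?y) = (cid C ?I \<otimes>\<^sub>m lunit C (A \<otimes>\<^sub>o B)) \<cdot> ((cid C ?I \<otimes>\<^sub>m assoc C ?I A B) \<cdot> (?x \<cdot> ?y))"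
    by simp
  also have "\<dots> = (cid C ?I \<otimes>\<^sub>m lunit C (A \<otimes>\<^sub>o B)) \<cdot> (assoc C ?I ?I (A \<otimes>\<^sub>o B) \<cdot> assoc C (?I \<otimes>\<^sub>o ?I) A B)"
    by (simp only: pentagon assms tunit_Ob)
  also have "\<dots> = (runit C ?I \<otimes>\<^sub>m cid C (A \<otimes>\<^sub>o B)) \<cdot> assoc C (?I \<otimes>\<^sub>o ?I) A B"
    by (rule comp_pull[OF triangle]) auto
  also have "\<dots> = assoc C ?I A B \<cdot> ((runit C ?I \<otimes>\<^sub>m cid C A) \<otimes>\<^sub>m cid C B)"
    using assoc_nat(1)[of "runit C ?I" "cid C A" "cid C B"] by simp
  also have "\<dots> = assoc C ?I A B \<cdot> (((cid C ?I \<otimes>\<^sub>m lunit C A) \<otimes>\<^sub>m cid C B) \<cdot> ?y)"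
    by (simp add: triangle)
  also have "\<dots> = ?r \<cdot> (?x \<cdot> ?y)"
    by (subst assoc_nat(2)) auto
  finally have "?l \<cdot> (?x \<cdot> ?y) = ?r \<cdot> (?x \<cdot> ?y)" .
  then show "?l = ?r"
    by (rule iso_cancel_right[rotated]) (auto intro!: iso_comp tens_iso iso_cid)
qed auto

text \<open>The mirror image of \<open>lunit_tens\<close>: tensor with the unit on the right and use
  the pentagon for \<open>A\<close>, \<open>B\<close> and two units.\<close>

lemma runit_tens:
  assumes [simp]: "A \<in> Ob C" "B \<in> Ob C"
  shows "(cid C A \<otimes>\<^sub>m runit C B) \<cdot> assoc C A B (tunit C) = runit C (A \<otimes>\<^sub>o B)"
proof (rule tens_tunit_cancel)
  let ?I = "tunit C"
  let ?l = "((cid C A \<otimes>\<^sub>m runit C B) \<cdot> assoc C A B ?I) \<otimes>\<^sub>m cid C ?I"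
  let ?r = "runit C (A \<otimes>\<^sub>o B) \<otimes>\<^sub>m cid C ?I"
  have "assoc C A B ?I \<cdot> ?r = assoc C A B ?I \<cdot> ((cid C A \<otimes>\<^sub>m cid C B) \<otimes>\<^sub>m lunit C ?I) \<cdot> assoc C (A \<otimes>\<^sub>o B) ?I ?I"
    by (simp add: triangle)
  also have "\<dots> = (cid C A \<otimes>\<^sub>m (cid C B \<otimes>\<^sub>m lunit C ?I)) \<cdot> (assoc C A B (?I \<otimes>\<^sub>o ?I) \<cdot> assoc C (A \<otimes>\<^sub>o B) ?I ?I)"
    by (subst assoc_nat(2)) auto
  also have "\<dots> = (cid C A \<otimes>\<^sub>m (cid C B \<otimes>\<^sub>m lunit C ?I)) \<cdot> ((cid C A \<otimes>\<^sub>m assoc C B ?I ?I) \<cdot> assoc C A (B \<otimes>\<^sub>o ?I) ?I \<cdot> (assoc C A B ?I \<otimes>\<^sub>m cid C ?I))"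
    by (simp only: pentagon assms tunit_Ob)
  also have "\<dots> = (cid C A \<otimes>\<^sub>m (runit C B \<otimes>\<^sub>m cid C ?I)) \<cdot> assoc C A (B \<otimes>\<^sub>o ?I) ?I \<cdot> (assoc C A B ?I \<otimes>\<^sub>m cid C ?I)"
    by (simp add: triangle)
  also have "\<dots> = assoc C A B ?I \<cdot> (((cid C A \<otimes>\<^sub>m runit C B) \<otimes>\<^sub>m cid C ?I) \<cdot> (assoc C A B ?I \<otimes>\<^sub>m cid C ?I))"
    by (subst assoc_nat(2)) auto
  finally have "assoc C A B ?I \<cdot> ?l = assoc C A B ?I \<cdot> ?r" by simp
  then show "?l = ?r" by (rule iso_cancel_left[rotated]) auto
qed auto

text \<open>Naturality of the left unitor at itself gives that tensoring
  \<open>lunit C (tunit C)\<close> with the unit on the left is the left unitor of the doubled unit.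
  Composed with the associator, one side becomes \<open>lunit \<otimes> id\<close> by
  \<open>lunit_tens\<close> and the other \<open>runit \<otimes> id\<close> by the triangle.\<close>

lemma lunit_tunit: "lunit C (tunit C) = runit C (tunit C)"
proof -
  let ?I = "tunit C"
  have "lunit C ?I \<cdot> (cid C ?I \<otimes>\<^sub>m lunit C ?I) = lunit C ?I \<cdot> lunit C (?I \<otimes>\<^sub>o ?I)"
    by (simp add: lunit_nat)
  then have "cid C ?I \<otimes>\<^sub>m lunit C ?I = lunit C (?I \<otimes>\<^sub>o ?I)"
    by (rule iso_cancel_left[rotated]) auto
  then have "lunit C ?I \<otimes>\<^sub>m cid C ?I = runit C ?I \<otimes>\<^sub>m cid C ?I"
    using lunit_tens[of ?I ?I] triangle[of ?I ?I] by simp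
  then show ?thesis by (rule tens_tunit_cancel) auto
qed

end

subsection \<open>Additive and abelian categories\<close>

context additive_category
begin

lemma zero_arr [simp]:
  assumes "A \<in> Ob C" "B \<in> Ob C"
  shows "czero C A B \<in> Ar C" "src C (czero C A B) = A" "tgt C (czero C A B) = B"
proof -
  interpret G: comm_group "hom_group C A B" by (rule Hom_group[OF assms])
  show "czero C A B \<in> Ar C" "src C (czero C A B) = A" "tgt C (czero C A B) = B"
    using G.one_closed by (auto simp: hom_group_def)
qed

lemma add_arr [simp]:
  assumes "f \<in> Ar C" "g \<in> Ar C" "src C f = src C g" "tgt C f = tgt C g"
  shows "f \<boxplus> g \<in> Ar C" "src C (f \<boxplus> g) = src C f" "tgt C (f \<boxplus> g) = tgt C f"
proof -
  interpret G: comm_group "hom_group C (src C f) (tgt C f)" by (rule Hom_group) (use assms in auto)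
  have "f \<boxplus> g \<in> Hom C (src C f) (tgt C f)"
    using G.m_closed[of f g] assms by (simp add: hom_group_def)
  then show "f \<boxplus> g \<in> Ar C" "src C (f \<boxplus> g) = src C f" "tgt C (f \<boxplus> g) = tgt C f" by auto
qed

definition neg :: "'b \<Rightarrow> 'b" where
  "neg f = inv\<^bsub>hom_group C (src C f) (tgt C f)\<^esub> f"

lemma neg_arr [simp]:
  assumes "f \<in> Ar C"
  shows "neg f \<in> Ar C" "src C (neg f) = src C f" "tgt C (neg f) = tgt C f"
proof -
  interpret G: comm_group "hom_group C (src C f) (tgt C f)" by (rule Hom_group) (use assms in auto)
  have "neg f \<in> Hom C (src C f) (tgt C f)"
    using G.inv_closed[of f] assms by (simp add: hom_group_def neg_def)
  then show "neg f \<in> Ar C" "src C (neg f) = src C f" "tgt C (neg f) = tgt C f" by auto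
qed

lemma add_neg [simp]:
  assumes "f \<in> Ar C" "A = src C f" "B = tgt C f"
  shows "f \<boxplus> neg f = czero C A B" "neg f \<boxplus> f = czero C A B"
proof -
  interpret G: comm_group "hom_group C (src C f) (tgt C f)" by (rule Hom_group) (use assms in auto)
  show "f \<boxplus> neg f = czero C A B" "neg f \<boxplus> f = czero C A B"
    using G.r_inv[of f] G.l_inv[of f] assms by (simp_all add: hom_group_def neg_def)
qed

lemma add_assoc [simp]:
  assumes "f \<in> Ar C" "g \<in> Ar C" "h \<in> Ar C" "src C f = src C g" "tgt C f = tgt C g"
    "src C g = src C h" "tgt C g = tgt C h"
  shows "(f \<boxplus> g) \<boxplus> h = f \<boxplus> (g \<boxplus> h)"
proof -
  interpret G: comm_group "hom_group C (src C f) (tgt C f)" by (rule Hom_group) (use assms in auto)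
  show ?thesis
    using G.m_assoc[of f g h] assms by (simp add: hom_group_def)
qed

lemma add_comm:
  assumes "f \<in> Ar C" "g \<in> Ar C" "src C f = src C g" "tgt C f = tgt C g"
  shows "f \<boxplus> g = g \<boxplus> f"
proof -
  interpret G: comm_group "hom_group C (src C f) (tgt C f)" by (rule Hom_group) (use assms in auto)
  show ?thesis
    using G.m_comm[of f g] assms by (simp add: hom_group_def)
qed

lemma add_zero [simp]:
  assumes "f \<in> Ar C"
  shows "A = src C f \<Longrightarrow> B = tgt C f \<Longrightarrow> f \<boxplus> czero C A B = f"
    "A = src C f \<Longrightarrow> B = tgt C f \<Longrightarrow> czero C A B \<boxplus> f = f"
proof -
  interpret G: comm_group "hom_group C (src C f) (tgt C f)" by (rule Hom_group) (use assms in auto)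
  show "A = src C f \<Longrightarrow> B = tgt C f \<Longrightarrow> f \<boxplus> czero C A B = f"
    "A = src C f \<Longrightarrow> B = tgt C f \<Longrightarrow> czero C A B \<boxplus> f = f"
    using G.r_one[of f] G.l_one[of f] assms by (simp_all add: hom_group_def)
qed

lemma add_left_cancel:
  assumes "h \<boxplus> f = h \<boxplus> g" "f \<in> Ar C" "g \<in> Ar C" "h \<in> Ar C" "src C f = src C h" "tgt C f = tgt C h"
    "src C g = src C h" "tgt C g = tgt C h"
  shows "f = g"
proof -
  have *: "neg h \<boxplus> (h \<boxplus> x) = x" if "x \<in> Ar C" "src C x = src C h" "tgt C x = tgt C h" for x
  proof -
    have "neg h \<boxplus> (h \<boxplus> x) = (neg h \<boxplus> h) \<boxplus> x"
      by (rule add_assoc[symmetric]) (use that assms in auto)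
    also have "\<dots> = x" using that assms(4) by simp
    finally show ?thesis .
  qed
  have "f = neg h \<boxplus> (h \<boxplus> f)" using assms(2,5,6) by (simp add: *)
  also have "\<dots> = g" unfolding assms(1) using assms(3,7,8) by (simp add: *)
  finally show ?thesis .
qed

lemma comp_add [simp]:
  assumes "f \<in> Ar C" "f' \<in> Ar C" "src C f = src C f'" "tgt C f = tgt C f'"
  shows "g \<in> Ar C \<Longrightarrow> src C g = tgt C f' \<Longrightarrow> g \<cdot> (f \<boxplus> f') = g \<cdot> f \<boxplus> g \<cdot> f'"
    "g \<in> Ar C \<Longrightarrow> tgt C g = src C f' \<Longrightarrow> (f \<boxplus> f') \<cdot> g = f \<cdot> g \<boxplus> f' \<cdot> g"
  using comp_add_right[of f "src C f" "tgt C f" f' g "tgt C g"]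
    comp_add_left[of g "src C g" "tgt C g" f "tgt C f" f'] assms by auto

lemma comp_zero [simp]:
  assumes "A \<in> Ob C" "B \<in> Ob C" "f \<in> Ar C"
  shows "src C f = B \<Longrightarrow> f \<cdot> czero C A B = czero C A (tgt C f)"
    "tgt C f = A \<Longrightarrow> czero C A B \<cdot> f = czero C (src C f) B"
proof -
  show "f \<cdot> czero C A B = czero C A (tgt C f)" if "src C f = B"
  proof (rule add_left_cancel)
    have "f \<cdot> (czero C A B \<boxplus> czero C A B) = f \<cdot> czero C A B \<boxplus> f \<cdot> czero C A B"
      using that assms by (intro comp_add) auto
    then show "f \<cdot> czero C A B \<boxplus> f \<cdot> czero C A B = f \<cdot> czero C A B \<boxplus> czero C A (tgt C f)"
      using that assms by simp
  qed (use that assms in auto)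
  show "czero C A B \<cdot> f = czero C (src C f) B" if "tgt C f = A"
  proof (rule add_left_cancel)
    have "(czero C A B \<boxplus> czero C A B) \<cdot> f = czero C A B \<cdot> f \<boxplus> czero C A B \<cdot> f"
      using that assms by (intro comp_add) auto
    then show "czero C A B \<cdot> f \<boxplus> czero C A B \<cdot> f = czero C A B \<cdot> f \<boxplus> czero C (src C f) B"
      using that assms by simp
  qed (use that assms in auto)
qed

lemma neg_zero [simp]:
  assumes "A \<in> Ob C" "B \<in> Ob C"
  shows "neg (czero C A B) = czero C A B"
proof -
  have "neg (czero C A B) = czero C A B \<boxplus> neg (czero C A B)"
    by (rule add_zero(2)[symmetric]) (use assms in auto)
  also have "\<dots> = czero C A B" by (rule add_neg) (use assms in auto)
  finally show ?thesis .
qed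

lemma eq_if_add_neg_zero:
  assumes "f \<boxplus> neg g = czero C A B" "f \<in> Ar C" "g \<in> Ar C" "src C f = src C g" "tgt C f = tgt C g"
    "A = src C f" "B = tgt C f"
  shows "f = g"
proof (rule add_left_cancel)
  show "neg g \<boxplus> f = neg g \<boxplus> g"
    using assms add_comm[of f "neg g"] by simp
qed (use assms in auto)

lemma comp_neg [simp]:
  assumes "f \<in> Ar C" "g \<in> Ar C" "src C g = tgt C f"
  shows "g \<cdot> neg f = neg (g \<cdot> f)" "neg g \<cdot> f = neg (g \<cdot> f)"
proof -
  have "g \<cdot> (f \<boxplus> neg f) = g \<cdot> f \<boxplus> g \<cdot> neg f" using assms by (intro comp_add) auto
  then show "g \<cdot> neg f = neg (g \<cdot> f)"
    using assms by - (rule add_left_cancel[of "g \<cdot> f"], auto)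
  have "(g \<boxplus> neg g) \<cdot> f = g \<cdot> f \<boxplus> neg g \<cdot> f" using assms by (intro comp_add) auto
  then show "neg g \<cdot> f = neg (g \<cdot> f)"
    using assms by - (rule add_left_cancel[of "g \<cdot> f"], auto)
qed

lemma monoI:
  assumes "f \<in> Ar C"
    and "\<And>x. \<lbrakk>x \<in> Ar C; tgt C x = src C f; f \<cdot> x = czero C (src C x) (tgt C f)\<rbrakk> \<Longrightarrow> x = czero C (src C x) (src C f)"
  shows "is_mono C f"
  unfolding is_mono_def
proof (intro conjI allI ballI impI)
  fix A g h assume a: "g \<in> Hom C A (src C f)" "h \<in> Hom C A (src C f)" "f \<cdot> g = f \<cdot> h"
  have "g \<boxplus> neg h = czero C A (src C f)"
    using assms(2)[of "g \<boxplus> neg h"] assms(1) a by simp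
  then show "g = h" by (rule eq_if_add_neg_zero) (use a in auto)
qed (rule assms)

lemma epiI:
  assumes "f \<in> Ar C"
    and "\<And>x. \<lbrakk>x \<in> Ar C; src C x = tgt C f; x \<cdot> f = czero C (src C f) (tgt C x)\<rbrakk> \<Longrightarrow> x = czero C (tgt C f) (tgt C x)"
  shows "is_epi C f"
  unfolding is_epi_def
proof (intro conjI allI ballI impI)
  fix A g h assume a: "g \<in> Hom C (tgt C f) A" "h \<in> Hom C (tgt C f) A" "g \<cdot> f = h \<cdot> f"
  have "g \<boxplus> neg h = czero C (tgt C f) A"
    using assms(2)[of "g \<boxplus> neg h"] assms(1) a by simp
  then show "g = h" by (rule eq_if_add_neg_zero) (use a in auto)
qed (rule assms)

section \<open>Kernels and cokernels in an additive category\<close>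

lemma kernelD:
  assumes "is_kernel C f k"
  shows "f \<in> Ar C" "k \<in> Ar C" "tgt C k = src C f" "f \<cdot> k = czero C (src C k) (tgt C f)"
  using assms unfolding is_kernel_def by auto

lemma kernel_ex1:
  assumes "is_kernel C f k" "h \<in> Ar C" "tgt C h = src C f" "f \<cdot> h = czero C (src C h) (tgt C f)"
  shows "\<exists>!u. u \<in> Hom C (src C h) (src C k) \<and> k \<cdot> u = h"
  using assms(1) unfolding is_kernel_def using assms(2-4) by blast

lemma kernel_factor:
  assumes "is_kernel C f k" "h \<in> Ar C" "tgt C h = src C f" "f \<cdot> h = czero C (src C h) (tgt C f)"
  obtains u where "u \<in> Ar C" "src C u = src C h" "tgt C u = src C k" "k \<cdot> u = h"
  using kernel_ex1[OF assms] that unfolding Hom_def by blast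

lemma kernel_mono:
  assumes "is_kernel C f k"
  shows "is_mono C k"
  unfolding is_mono_def
proof (intro conjI allI ballI impI)
  note k = kernelD[OF assms]
  show "k \<in> Ar C" by (rule k)
  fix A g h assume a: "g \<in> Hom C A (src C k)" "h \<in> Hom C A (src C k)" "k \<cdot> g = k \<cdot> h"
  have "f \<cdot> (k \<cdot> g) = (f \<cdot> k) \<cdot> g" by (rule comp_assoc'[symmetric]) (use k a in auto)
  also have "\<dots> = czero C A (tgt C f)" using k a by simp
  finally have "f \<cdot> (k \<cdot> g) = czero C A (tgt C f)" .
  then have "\<exists>!u. u \<in> Hom C A (src C k) \<and> k \<cdot> u = k \<cdot> g"
    using kernel_ex1[OF assms, of "k \<cdot> g"] k a by simp
  then show "g = h" using a by auto
qed

lemma kernelI: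
  assumes "is_mono C k" "f \<in> Ar C" "tgt C k = src C f" "f \<cdot> k = czero C (src C k) (tgt C f)"
    and "\<And>h. \<lbrakk>h \<in> Ar C; tgt C h = src C f; f \<cdot> h = czero C (src C h) (tgt C f)\<rbrakk>
      \<Longrightarrow> \<exists>u \<in> Ar C. src C u = src C h \<and> tgt C u = src C k \<and> k \<cdot> u = h"
  shows "is_kernel C f k"
  unfolding is_kernel_def
proof (intro conjI ballI impI)
  fix h assume "h \<in> Ar C" "tgt C h = src C f \<and> f \<cdot> h = czero C (src C h) (tgt C f)"
  then obtain u where u: "u \<in> Ar C" "src C u = src C h" "tgt C u = src C k" "k \<cdot> u = h"
    using assms(5) by blast
  show "\<exists>!u. u \<in> Hom C (src C h) (src C k) \<and> k \<cdot> u = h"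
  proof (rule ex1I[of _ u])
    show "v = u" if "v \<in> Hom C (src C h) (src C k) \<and> k \<cdot> v = h" for v
      by (rule monoD[OF assms(1)]) (use that u in auto)
  qed (use u in auto)
qed (use assms mono_arr in auto)

lemma cokernelD:
  assumes "is_cokernel C f q"
  shows "f \<in> Ar C" "q \<in> Ar C" "src C q = tgt C f" "q \<cdot> f = czero C (src C f) (tgt C q)"
  using assms unfolding is_cokernel_def by auto

lemma cokernel_ex1:
  assumes "is_cokernel C f q" "h \<in> Ar C" "src C h = tgt C f" "h \<cdot> f = czero C (src C f) (tgt C h)"
  shows "\<exists>!u. u \<in> Hom C (tgt C q) (tgt C h) \<and> u \<cdot> q = h"
  using assms(1) unfolding is_cokernel_def using assms(2-4) by blast

lemma cokernel_factor:
  assumes "is_cokernel C f q" "h \<in> Ar C" "src C h = tgt C f" "h \<cdot> f = czero C (src C f) (tgt C h)"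
  obtains u where "u \<in> Ar C" "src C u = tgt C q" "tgt C u = tgt C h" "u \<cdot> q = h"
  using cokernel_ex1[OF assms] that unfolding Hom_def by blast

lemma cokernel_epi:
  assumes "is_cokernel C f q"
  shows "is_epi C q"
  unfolding is_epi_def
proof (intro conjI allI ballI impI)
  note k = cokernelD[OF assms]
  show "q \<in> Ar C" by (rule k)
  fix A g h assume a: "g \<in> Hom C (tgt C q) A" "h \<in> Hom C (tgt C q) A" "g \<cdot> q = h \<cdot> q"
  have "(g \<cdot> q) \<cdot> f = czero C (src C f) A" using k a(1) by simp
  then have "\<exists>!u. u \<in> Hom C (tgt C q) A \<and> u \<cdot> q = g \<cdot> q"
    using cokernel_ex1[OF assms, of "g \<cdot> q"] k a by simp
  then show "g = h" using a by auto
qed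

lemma cokernelI:
  assumes "is_epi C q" "f \<in> Ar C" "src C q = tgt C f" "q \<cdot> f = czero C (src C f) (tgt C q)"
    and "\<And>h. \<lbrakk>h \<in> Ar C; src C h = tgt C f; h \<cdot> f = czero C (src C f) (tgt C h)\<rbrakk>
      \<Longrightarrow> \<exists>u \<in> Ar C. src C u = tgt C q \<and> tgt C u = tgt C h \<and> u \<cdot> q = h"
  shows "is_cokernel C f q"
  unfolding is_cokernel_def
proof (intro conjI ballI impI)
  fix h assume "h \<in> Ar C" "src C h = tgt C f \<and> h \<cdot> f = czero C (src C f) (tgt C h)"
  then obtain u where u: "u \<in> Ar C" "src C u = tgt C q" "tgt C u = tgt C h" "u \<cdot> q = h"
    using assms(5) by blast
  show "\<exists>!u. u \<in> Hom C (tgt C q) (tgt C h) \<and> u \<cdot> q = h"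
  proof (rule ex1I[of _ u])
    show "v = u" if "v \<in> Hom C (tgt C q) (tgt C h) \<and> v \<cdot> q = h" for v
      by (rule epiD[OF assms(1)]) (use that u in auto)
  qed (use u in auto)
qed (use assms epi_arr in auto)

end

context abelian_category
begin

text \<open>A monomorphism is a kernel of some \<open>g\<close>; being epi as well it forces
  \<open>g\<close> to be zero, so the identity factors through it.\<close>

lemma mono_epi_iso:
  assumes "is_mono C f" "is_epi C f"
  shows "is_iso C f"
proof -
  obtain g where g: "is_kernel C g f" using mono_is_kernel assms by blast
  note k = kernelD[OF g]
  have "g = czero C (tgt C f) (tgt C g)"
    by (rule epiD[OF assms(2)]) (use k in auto)
  then obtain u where u: "u \<in> Ar C" "src C u = tgt C f" "tgt C u = src C f" "f \<cdot> u = cid C (tgt C f)"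
    using kernel_factor[OF g, of "cid C (tgt C f)"] k by (metis cid_arr comp_cid(2) tgt_in_Ob)
  have "f \<cdot> (u \<cdot> f) = f \<cdot> cid C (src C f)" using u k by (simp add: comp_pull[OF u(4)])
  then have "u \<cdot> f = cid C (src C f)"
    by - (rule monoD[OF assms(1)], use u k in auto)
  then show ?thesis by (intro isoI[of f u]) (use u k in auto)
qed

end

subsection \<open>Scalars\<close>

context tensor_category
begin

lemma tens_add [simp]:
  assumes "f \<in> Ar C" "f' \<in> Ar C" "src C f = src C f'" "tgt C f = tgt C f'" "g \<in> Ar C"
  shows "(f \<boxplus> f') \<otimes>\<^sub>m g = (f \<otimes>\<^sub>m g) \<boxplus> (f' \<otimes>\<^sub>m g)"
    "g \<otimes>\<^sub>m (f \<boxplus> f') = (g \<otimes>\<^sub>m f) \<boxplus> (g \<otimes>\<^sub>m f')"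
  using tens_add_left[of f "src C f" "tgt C f" f' g "src C g" "tgt C g"]
    tens_add_right[of g "src C g" "tgt C g" f "src C f" "tgt C f" f'] assms by auto

lemma tens_zero [simp]:
  assumes [simp]: "A \<in> Ob C" "B \<in> Ob C" "f \<in> Ar C"
  shows "f \<otimes>\<^sub>m czero C A B = czero C (src C f \<otimes>\<^sub>o A) (tgt C f \<otimes>\<^sub>o B)"
    "czero C A B \<otimes>\<^sub>m f = czero C (A \<otimes>\<^sub>o src C f) (B \<otimes>\<^sub>o tgt C f)"
proof -
  have "f \<otimes>\<^sub>m (czero C A B \<boxplus> czero C A B) = (f \<otimes>\<^sub>m czero C A B) \<boxplus> (f \<otimes>\<^sub>m czero C A B)"
    by (intro tens_add) auto
  then show "f \<otimes>\<^sub>m czero C A B = czero C (src C f \<otimes>\<^sub>o A) (tgt C f \<otimes>\<^sub>o B)"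
    by - (rule add_left_cancel[of "f \<otimes>\<^sub>m czero C A B"], auto)
  have "(czero C A B \<boxplus> czero C A B) \<otimes>\<^sub>m f = (czero C A B \<otimes>\<^sub>m f) \<boxplus> (czero C A B \<otimes>\<^sub>m f)"
    by (intro tens_add) auto
  then show "czero C A B \<otimes>\<^sub>m f = czero C (A \<otimes>\<^sub>o src C f) (B \<otimes>\<^sub>o tgt C f)"
    by - (rule add_left_cancel[of "czero C A B \<otimes>\<^sub>m f"], auto)
qed

abbreviation smul (infixr "\<star>" 77) where "z \<star> f \<equiv> scalar C z f"
abbreviation unit_object ("\<one>\<^sub>C") where "\<one>\<^sub>C \<equiv> tunit C"
abbreviation "\<R> \<equiv> Hom C (tunit C) (tunit C)"

lemma smul_arr [simp]:
  assumes "z \<in> \<R>" "f \<in> Ar C"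
  shows "z \<star> f \<in> Ar C" "src C (z \<star> f) = src C f" "tgt C (z \<star> f) = tgt C f"
  using assms unfolding scalar_def by auto

lemma smul_comp:
  assumes "z \<in> \<R>" "f \<in> Ar C" "g \<in> Ar C" "src C g = tgt C f"
  shows "(z \<star> g) \<cdot> f = z \<star> (g \<cdot> f)" "g \<cdot> (z \<star> f) = z \<star> (g \<cdot> f)"
proof -
  show "(z \<star> g) \<cdot> f = z \<star> (g \<cdot> f)"
    using assms unfolding scalar_def by (simp add: luniti_nat)
  have "g \<cdot> (z \<star> f) = lunit C (tgt C g) \<cdot> (cid C \<one>\<^sub>C \<otimes>\<^sub>m g) \<cdot> (z \<otimes>\<^sub>m f) \<cdot> luniti (src C f)"
    using assms unfolding scalar_def by (subst lunit_nat(2)) auto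
  also have "\<dots> = z \<star> (g \<cdot> f)"
    using assms unfolding scalar_def by simp
  finally show "g \<cdot> (z \<star> f) = z \<star> (g \<cdot> f)" .
qed

lemma smul_add [simp]:
  assumes "z \<in> \<R>" "f \<in> Ar C" "g \<in> Ar C" "src C f = src C g" "tgt C f = tgt C g"
  shows "z \<star> (f \<boxplus> g) = z \<star> f \<boxplus> z \<star> g"
  using assms unfolding scalar_def by simp

lemma add_smul [simp]:
  assumes "z \<in> \<R>" "w \<in> \<R>" "f \<in> Ar C"
  shows "(z \<boxplus> w) \<star> f = z \<star> f \<boxplus> w \<star> f"
  using assms unfolding scalar_def by simp

lemma smul_smul [simp]:
  assumes "z \<in> \<R>" "w \<in> \<R>" "f \<in> Ar C"
  shows "z \<star> (w \<star> f) = (z \<cdot> w) \<star> f"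
proof -
  have "z \<star> (w \<star> f) = (z \<star> cid C (tgt C f)) \<cdot> (w \<star> f)"
    using assms by (simp add: smul_comp(1))
  also have "\<dots> = (z \<cdot> w) \<star> f"
    using assms unfolding scalar_def by simp
  finally show ?thesis .
qed

lemma one_smul [simp]: "f \<in> Ar C \<Longrightarrow> cid C \<one>\<^sub>C \<star> f = f"
  unfolding scalar_def by (simp add: lunit_nat)

lemma zero_smul [simp]: "f \<in> Ar C \<Longrightarrow> czero C \<one>\<^sub>C \<one>\<^sub>C \<star> f = czero C (src C f) (tgt C f)"
  unfolding scalar_def by simp

lemma smul_zero [simp]: "z \<in> \<R> \<Longrightarrow> A \<in> Ob C \<Longrightarrow> B \<in> Ob C \<Longrightarrow> z \<star> czero C A B = czero C A B"
  unfolding scalar_def by simp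

text \<open>The action is written with the left unitor, while \<open>z \<otimes> id\<close> slides
  through the right one; on the unit object the two agree by \<open>lunit_tunit\<close>.\<close>

lemma smul_from_tunit:
  assumes "z \<in> \<R>" "f \<in> Ar C" "src C f = \<one>\<^sub>C"
  shows "z \<star> f = f \<cdot> z"
proof -
  have "z \<star> cid C \<one>\<^sub>C = z"
    using assms unfolding scalar_def by (simp add: lunit_tunit runit_nat)
  moreover have "f \<cdot> (z \<star> cid C \<one>\<^sub>C) = z \<star> f"
    using assms by (simp add: smul_comp)
  ultimately show ?thesis by simp
qed

lemma smul_tunit:
  assumes "z \<in> \<R>" "w \<in> \<R>"
  shows "z \<star> w = z \<cdot> w"
proof -
  have "z \<star> w = (z \<star> cid C \<one>\<^sub>C) \<cdot> w" using assms by (simp add: smul_comp)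
  also have "\<dots> = z \<cdot> w" using assms by (simp add: smul_from_tunit)
  finally show ?thesis .
qed

text \<open>Eckmann-Hilton: the action of \<open>z\<close> on \<open>w\<close> is composition on the
  left by \<open>smul_tunit\<close> and on the right by \<open>smul_from_tunit\<close>.\<close>

lemma scalar_comm: "z \<in> \<R> \<Longrightarrow> w \<in> \<R> \<Longrightarrow> z \<cdot> w = w \<cdot> z"
  using smul_tunit[of z w] smul_from_tunit[of z w] by simp

text \<open>For the first factor, \<open>lunit_tens\<close> merges the unitor of one factor into the
  unitor of the tensor product. The second factor is reduced to the first by the braiding.\<close>

lemma smul_tens:
  assumes "z \<in> \<R>" "f \<in> Ar C" "g \<in> Ar C"
  shows "(z \<star> f) \<otimes>\<^sub>m g = z \<star> (f \<otimes>\<^sub>m g)" "f \<otimes>\<^sub>m (z \<star> g) = z \<star> (f \<otimes>\<^sub>m g)"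
proof -
  have left: "(z \<star> f) \<otimes>\<^sub>m g = z \<star> (f \<otimes>\<^sub>m g)" if "f \<in> Ar C" "g \<in> Ar C" for f g
  proof -
    let ?A = "src C f" and ?B = "src C g" and ?A' = "tgt C f" and ?B' = "tgt C g"
    have *: "luniti ?A \<otimes>\<^sub>m cid C ?B = associ \<one>\<^sub>C ?A ?B \<cdot> luniti (?A \<otimes>\<^sub>o ?B)"
    proof (rule iso_cancel_left[of "lunit C ?A \<otimes>\<^sub>m cid C ?B"])
      have "(lunit C ?A \<otimes>\<^sub>m cid C ?B) \<cdot> (associ \<one>\<^sub>C ?A ?B \<cdot> luniti (?A \<otimes>\<^sub>o ?B)) = cid C (?A \<otimes>\<^sub>o ?B)"
        using that by (simp flip: lunit_tens)
      then show "(lunit C ?A \<otimes>\<^sub>m cid C ?B) \<cdot> (luniti ?A \<otimes>\<^sub>m cid C ?B)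
        = (lunit C ?A \<otimes>\<^sub>m cid C ?B) \<cdot> (associ \<one>\<^sub>C ?A ?B \<cdot> luniti (?A \<otimes>\<^sub>o ?B))"
        using that by simp
    qed (use that in \<open>auto intro!: tens_iso iso_cid\<close>)
    have "(z \<star> f) \<otimes>\<^sub>m g = (lunit C ?A' \<otimes>\<^sub>m cid C ?B') \<cdot> ((z \<otimes>\<^sub>m f) \<otimes>\<^sub>m g) \<cdot> (luniti ?A \<otimes>\<^sub>m cid C ?B)"
      using that assms unfolding scalar_def by simp
    also have "\<dots> = lunit C (?A' \<otimes>\<^sub>o ?B') \<cdot> assoc C \<one>\<^sub>C ?A' ?B' \<cdot> ((z \<otimes>\<^sub>m f) \<otimes>\<^sub>m g) \<cdot> associ \<one>\<^sub>C ?A ?B \<cdot> luniti (?A \<otimes>\<^sub>o ?B)"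
      unfolding * using that assms by (simp flip: lunit_tens)
    also have "\<dots> = z \<star> (f \<otimes>\<^sub>m g)"
      using that assms unfolding scalar_def by (subst assoc_nat(2)) auto
    finally show ?thesis .
  qed
  show "(z \<star> f) \<otimes>\<^sub>m g = z \<star> (f \<otimes>\<^sub>m g)" using assms by (intro left)
  have "braid C (tgt C f) (tgt C g) \<cdot> (f \<otimes>\<^sub>m (z \<star> g)) = z \<star> (g \<otimes>\<^sub>m f) \<cdot> braid C (src C f) (src C g)"
    using assms by (simp add: braid_nat left smul_comp)
  also have "\<dots> = z \<star> (braid C (tgt C f) (tgt C g) \<cdot> (f \<otimes>\<^sub>m g))"
    using assms by (simp add: braid_nat smul_comp)
  also have "\<dots> = braid C (tgt C f) (tgt C g) \<cdot> (z \<star> (f \<otimes>\<^sub>m g))"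
    using assms by (simp add: smul_comp)
  finally show "f \<otimes>\<^sub>m (z \<star> g) = z \<star> (f \<otimes>\<^sub>m g)"
    by (rule iso_cancel_left[rotated]) (use assms in auto)
qed

lemma cring_End_unit: "cring (End_unit C)"
proof (rule cringI)
  interpret G: comm_group "hom_group C \<one>\<^sub>C \<one>\<^sub>C" by (rule Hom_group) auto
  show "abelian_group (End_unit C)"
    by (rule abelian_groupI)
      (auto simp: End_unit_def intro!: add_comm, metis add_neg(2) neg_arr)
  show "comm_monoid (End_unit C)"
    by (rule comm_monoidI) (auto simp: End_unit_def intro: scalar_comm)
  show "(x \<oplus>\<^bsub>End_unit C\<^esub> y) \<otimes>\<^bsub>End_unit C\<^esub> z = x \<otimes>\<^bsub>End_unit C\<^esub> z \<oplus>\<^bsub>End_unit C\<^esub> y \<otimes>\<^bsub>End_unit C\<^esub> z"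
    if "x \<in> carrier (End_unit C)" "y \<in> carrier (End_unit C)" "z \<in> carrier (End_unit C)" for x y z
    using that by (auto simp: End_unit_def)
qed

lemma ideal_End_unitD:
  assumes "ideal I (End_unit C)"
  shows "z \<in> I \<Longrightarrow> z \<in> \<R>" "czero C \<one>\<^sub>C \<one>\<^sub>C \<in> I" "\<lbrakk>z \<in> I; w \<in> I\<rbrakk> \<Longrightarrow> z \<boxplus> w \<in> I"
    "\<lbrakk>z \<in> I; w \<in> \<R>\<rbrakk> \<Longrightarrow> z \<cdot> w \<in> I" "\<lbrakk>z \<in> I; w \<in> \<R>\<rbrakk> \<Longrightarrow> w \<cdot> z \<in> I"
proof -
  interpret ideal I "End_unit C" by fact
  show "z \<in> I \<Longrightarrow> z \<in> \<R>" "czero C \<one>\<^sub>C \<one>\<^sub>C \<in> I" "\<lbrakk>z \<in> I; w \<in> I\<rbrakk> \<Longrightarrow> z \<boxplus> w \<in> I"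
    "\<lbrakk>z \<in> I; w \<in> \<R>\<rbrakk> \<Longrightarrow> z \<cdot> w \<in> I" "\<lbrakk>z \<in> I; w \<in> \<R>\<rbrakk> \<Longrightarrow> w \<cdot> z \<in> I"
    using Icarr[of z] additive_subgroup.zero_closed[OF is_additive_subgroup]
      additive_subgroup.a_closed[OF is_additive_subgroup, of z w] I_l_closed[of z w] I_r_closed[of z w]
    unfolding End_unit_def by auto
qed

lemma prime_End_unitD:
  assumes "primeideal P (End_unit C)"
  shows "ideal P (End_unit C)" "cid C \<one>\<^sub>C \<notin> P" "\<lbrakk>z \<in> \<R>; w \<in> \<R>; z \<cdot> w \<in> P\<rbrakk> \<Longrightarrow> z \<in> P \<or> w \<in> P"
proof -
  interpret primeideal P "End_unit C" by fact
  show "ideal P (End_unit C)" by (rule ideal_axioms)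
  show "cid C \<one>\<^sub>C \<notin> P" using I_notcarr one_imp_carrier by (auto simp: End_unit_def)
  show "\<lbrakk>z \<in> \<R>; w \<in> \<R>; z \<cdot> w \<in> P\<rbrakk> \<Longrightarrow> z \<in> P \<or> w \<in> P"
    using I_prime[of z w] by (simp add: End_unit_def)
qed

section \<open>Tensor ideals through closure properties of their morphisms\<close>

lemma tensor_idealI:
  assumes "\<II> \<subseteq> Ar C"
    "\<And>A B. \<lbrakk>A \<in> Ob C; B \<in> Ob C\<rbrakk> \<Longrightarrow> czero C A B \<in> \<II>"
    "\<And>f g. \<lbrakk>f \<in> \<II>; g \<in> \<II>; src C f = src C g; tgt C f = tgt C g\<rbrakk> \<Longrightarrow> f \<boxplus> g \<in> \<II>"
    "\<And>f. f \<in> \<II> \<Longrightarrow> neg f \<in> \<II>"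
    "\<And>f g. \<lbrakk>f \<in> \<II>; g \<in> Ar C; src C g = tgt C f\<rbrakk> \<Longrightarrow> g \<cdot> f \<in> \<II>"
    "\<And>f g. \<lbrakk>f \<in> \<II>; g \<in> Ar C; tgt C g = src C f\<rbrakk> \<Longrightarrow> f \<cdot> g \<in> \<II>"
    "\<And>f g. \<lbrakk>f \<in> \<II>; g \<in> Ar C\<rbrakk> \<Longrightarrow> f \<otimes>\<^sub>m g \<in> \<II>" "\<And>f g. \<lbrakk>f \<in> \<II>; g \<in> Ar C\<rbrakk> \<Longrightarrow> g \<otimes>\<^sub>m f \<in> \<II>"
  shows "tensor_ideal C \<II>"
proof -
  have "subgroup (\<II> \<inter> Hom C A B) (hom_group C A B)" if AB [simp]: "A \<in> Ob C" "B \<in> Ob C" for A B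
  proof -
    interpret G: comm_group "hom_group C A B" by (rule Hom_group) auto
    show ?thesis
    proof (rule G.subgroupI)
      show "\<II> \<inter> Hom C A B \<subseteq> carrier (hom_group C A B)" by (auto simp: hom_group_def)
      have "czero C A B \<in> \<II> \<inter> Hom C A B" using assms(2) by simp
      then show "\<II> \<inter> Hom C A B \<noteq> {}" by blast
      fix f assume f: "f \<in> \<II> \<inter> Hom C A B"
      then show "inv\<^bsub>hom_group C A B\<^esub> f \<in> \<II> \<inter> Hom C A B"
        using assms(4)[of f] neg_arr[of f] by (simp add: neg_def)
      fix g assume g: "g \<in> \<II> \<inter> Hom C A B"
      then show "f \<otimes>\<^bsub>hom_group C A B\<^esub> g \<in> \<II> \<inter> Hom C A B"
        using f assms(3)[of f g] by (simp add: hom_group_def)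
    qed
  qed
  then show ?thesis unfolding tensor_ideal_def
    by (intro conjI ballI impI subsetI) (use assms in \<open>simp_all del: Hom_def add: subset_iff\<close>)
qed

lemma tensor_idealD:
  assumes "tensor_ideal C \<II>"
  shows "f \<in> \<II> \<Longrightarrow> f \<in> Ar C"
    "\<lbrakk>A \<in> Ob C; B \<in> Ob C\<rbrakk> \<Longrightarrow> czero C A B \<in> \<II>"
    "\<lbrakk>f \<in> \<II>; g \<in> \<II>; src C f = src C g; tgt C f = tgt C g\<rbrakk> \<Longrightarrow> f \<boxplus> g \<in> \<II>"
    "f \<in> \<II> \<Longrightarrow> neg f \<in> \<II>"
    "\<lbrakk>f \<in> \<II>; g \<in> Ar C; src C g = tgt C f\<rbrakk> \<Longrightarrow> g \<cdot> f \<in> \<II>"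
    "\<lbrakk>f \<in> \<II>; g \<in> Ar C; tgt C g = src C f\<rbrakk> \<Longrightarrow> f \<cdot> g \<in> \<II>"
    "\<lbrakk>f \<in> \<II>; g \<in> Ar C\<rbrakk> \<Longrightarrow> f \<otimes>\<^sub>m g \<in> \<II>" "\<lbrakk>f \<in> \<II>; g \<in> Ar C\<rbrakk> \<Longrightarrow> g \<otimes>\<^sub>m f \<in> \<II>"
proof -
  show Ar: "f \<in> Ar C" if "f \<in> \<II>" for f using assms that unfolding tensor_ideal_def by blast
  have sub: "subgroup (\<II> \<inter> Hom C A B) (hom_group C A B)" if "A \<in> Ob C" "B \<in> Ob C" for A B
    using assms that unfolding tensor_ideal_def by blast
  show "czero C A B \<in> \<II>" if "A \<in> Ob C" "B \<in> Ob C"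
    using subgroup.one_closed[OF sub[OF that]] by (simp add: hom_group_def)
  show "f \<boxplus> g \<in> \<II>" if "f \<in> \<II>" "g \<in> \<II>" "src C f = src C g" "tgt C f = tgt C g"
    using subgroup.m_closed[OF sub, of "src C f" "tgt C f" f g] that Ar[of f] Ar[of g] by (simp add: hom_group_def)
  show "neg f \<in> \<II>" if "f \<in> \<II>"
    using subgroup.m_inv_closed[OF sub, of "src C f" "tgt C f" f] that Ar[of f] by (simp add: neg_def)
  show "\<lbrakk>f \<in> \<II>; g \<in> Ar C; src C g = tgt C f\<rbrakk> \<Longrightarrow> g \<cdot> f \<in> \<II>"
    "\<lbrakk>f \<in> \<II>; g \<in> Ar C; tgt C g = src C f\<rbrakk> \<Longrightarrow> f \<cdot> g \<in> \<II>"
    "\<lbrakk>f \<in> \<II>; g \<in> Ar C\<rbrakk> \<Longrightarrow> f \<otimes>\<^sub>m g \<in> \<II>" "\<lbrakk>f \<in> \<II>; g \<in> Ar C\<rbrakk> \<Longrightarrow> g \<otimes>\<^sub>m f \<in> \<II>"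
    using assms unfolding tensor_ideal_def by blast+
qed

end

subsection \<open>Duality\<close>

context symmetric_monoidal_category
begin

section \<open>Coherence identities solved for the inverse associators and unitors\<close>

lemma runiti_tens:
  assumes [simp]: "A \<in> Ob C" "B \<in> Ob C"
  shows "runiti (A \<otimes>\<^sub>o B) = associ A B (tunit C) \<cdot> (cid C A \<otimes>\<^sub>m runiti B)"
proof (rule iso_cancel_left[of "runit C (A \<otimes>\<^sub>o B)"])
  have "((cid C A \<otimes>\<^sub>m runit C B) \<cdot> assoc C A B (tunit C)) \<cdot> (associ A B (tunit C) \<cdot> (cid C A \<otimes>\<^sub>m runiti B)) = cid C (A \<otimes>\<^sub>o B)"
    by simp
  then show "runit C (A \<otimes>\<^sub>o B) \<cdot> runiti (A \<otimes>\<^sub>o B) = runit C (A \<otimes>\<^sub>o B) \<cdot> (associ A B (tunit C) \<cdot> (cid C A \<otimes>\<^sub>m runiti B))"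
    unfolding runit_tens[OF assms] by simp
qed auto

lemma associ_pentagon:
  assumes [simp]: "A \<in> Ob C" "B \<in> Ob C" "D \<in> Ob C" "E \<in> Ob C"
  shows "(assoc C A B D \<otimes>\<^sub>m cid C E) \<cdot> (associ (A \<otimes>\<^sub>o B) D E \<cdot> associ A B (D \<otimes>\<^sub>o E))
    = associ A (B \<otimes>\<^sub>o D) E \<cdot> (cid C A \<otimes>\<^sub>m associ B D E)"
proof -
  let ?P = "assoc C A B (D \<otimes>\<^sub>o E) \<cdot> assoc C (A \<otimes>\<^sub>o B) D E"
  have "((assoc C A B D \<otimes>\<^sub>m cid C E) \<cdot> (associ (A \<otimes>\<^sub>o B) D E \<cdot> associ A B (D \<otimes>\<^sub>o E))) \<cdot> ?P
    = assoc C A B D \<otimes>\<^sub>m cid C E" by simp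
  also have "\<dots> = (associ A (B \<otimes>\<^sub>o D) E \<cdot> (cid C A \<otimes>\<^sub>m associ B D E)) \<cdot> ?P"
    unfolding pentagon[OF assms] by simp
  finally show ?thesis
    by (rule iso_cancel_right[rotated]) (auto intro: iso_comp)
qed

lemma associ_pentagon':
  assumes [simp]: "A \<in> Ob C" "B \<in> Ob C" "D \<in> Ob C" "E \<in> Ob C"
  shows "associ (A \<otimes>\<^sub>o B) D E \<cdot> (associ A B (D \<otimes>\<^sub>o E) \<cdot> (cid C A \<otimes>\<^sub>m assoc C B D E))
    = (associ A B D \<otimes>\<^sub>m cid C E) \<cdot> associ A (B \<otimes>\<^sub>o D) E"
proof -
  have "((assoc C A B D \<otimes>\<^sub>m cid C E) \<cdot> (associ (A \<otimes>\<^sub>o B) D E \<cdot> associ A B (D \<otimes>\<^sub>o E))) \<cdot> (cid C A \<otimes>\<^sub>m assoc C B D E)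
    = associ A (B \<otimes>\<^sub>o D) E"
    unfolding associ_pentagon[OF assms] by simp
  then have "(assoc C A B D \<otimes>\<^sub>m cid C E) \<cdot> (associ (A \<otimes>\<^sub>o B) D E \<cdot> (associ A B (D \<otimes>\<^sub>o E) \<cdot> (cid C A \<otimes>\<^sub>m assoc C B D E)))
    = (assoc C A B D \<otimes>\<^sub>m cid C E) \<cdot> ((associ A B D \<otimes>\<^sub>m cid C E) \<cdot> associ A (B \<otimes>\<^sub>o D) E)"
    by simp
  then show ?thesis
    by (rule iso_cancel_left[rotated]) (auto intro: tens_iso iso_cid)
qed

lemma triangle':
  assumes [simp]: "A \<in> Ob C" "B \<in> Ob C"
  shows "(runit C A \<otimes>\<^sub>m cid C B) \<cdot> associ A (tunit C) B = cid C A \<otimes>\<^sub>m lunit C B"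
  unfolding triangle[OF assms, symmetric] by simp

lemma triangle_inverse:
  assumes [simp]: "A \<in> Ob C" "B \<in> Ob C"
  shows "associ A (tunit C) B \<cdot> (cid C A \<otimes>\<^sub>m luniti B) = runiti A \<otimes>\<^sub>m cid C B"
proof (rule iso_cancel_left[of "runit C A \<otimes>\<^sub>m cid C B"])
  have "((runit C A \<otimes>\<^sub>m cid C B) \<cdot> associ A (tunit C) B) \<cdot> (cid C A \<otimes>\<^sub>m luniti B)
    = (runit C A \<otimes>\<^sub>m cid C B) \<cdot> (runiti A \<otimes>\<^sub>m cid C B)"
    unfolding triangle'[OF assms] by simp
  then show "(runit C A \<otimes>\<^sub>m cid C B) \<cdot> (associ A (tunit C) B \<cdot> (cid C A \<otimes>\<^sub>m luniti B))
    = (runit C A \<otimes>\<^sub>m cid C B) \<cdot> (runiti A \<otimes>\<^sub>m cid C B)"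
    by simp
qed (auto intro: tens_iso iso_cid)

lemma is_dualD:
  assumes "is_dual C A A' e c"
  shows "A \<in> Ob C" "A' \<in> Ob C" "e \<in> Ar C" "src C e = A \<otimes>\<^sub>o A'" "tgt C e = tunit C"
    "c \<in> Ar C" "src C c = tunit C" "tgt C c = A' \<otimes>\<^sub>o A"
    "lunit C A \<cdot> (e \<otimes>\<^sub>m cid C A) \<cdot> associ A A' A \<cdot> (cid C A \<otimes>\<^sub>m c) \<cdot> runiti A = cid C A"
  using assms unfolding is_dual_def by simp_all

text \<open>The zigzag identity of \<open>W\<close> tensored with \<open>A\<close> on the left. The
  associators are brought into the order in which undoing a transpose
  \<open>X \<otimes> W' \<rightarrow> A\<close> produces them.\<close>

lemma dual_triangle_left:
  assumes "is_dual C W W' e c" and [simp]: "A \<in> Ob C"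
  shows "(runit C A \<otimes>\<^sub>m cid C W) \<cdot> ((cid C A \<otimes>\<^sub>m e) \<otimes>\<^sub>m cid C W) \<cdot> (assoc C A W W' \<otimes>\<^sub>m cid C W) \<cdot>
     associ (A \<otimes>\<^sub>o W) W' W \<cdot> (cid C (A \<otimes>\<^sub>o W) \<otimes>\<^sub>m c) \<cdot> runiti (A \<otimes>\<^sub>o W) = cid C (A \<otimes>\<^sub>o W)"
proof -
  note [simp] = is_dualD(1-8)[OF assms(1)]
  let ?y = "cid C A \<otimes>\<^sub>m ((cid C W \<otimes>\<^sub>m c) \<cdot> runiti W)"
  have "(cid C (A \<otimes>\<^sub>o W) \<otimes>\<^sub>m c) \<cdot> runiti (A \<otimes>\<^sub>o W)
    = ((cid C (A \<otimes>\<^sub>o W) \<otimes>\<^sub>m c) \<cdot> associ A W (tunit C)) \<cdot> (cid C A \<otimes>\<^sub>m runiti W)"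
    by (simp add: runiti_tens)
  also have "(cid C (A \<otimes>\<^sub>o W) \<otimes>\<^sub>m c) \<cdot> associ A W (tunit C) = associ A W (W' \<otimes>\<^sub>o W) \<cdot> (cid C A \<otimes>\<^sub>m (cid C W \<otimes>\<^sub>m c))"
    using associ_nat(1)[of "cid C A" "cid C W" c] by simp
  finally have 1: "(cid C (A \<otimes>\<^sub>o W) \<otimes>\<^sub>m c) \<cdot> runiti (A \<otimes>\<^sub>o W) = associ A W (W' \<otimes>\<^sub>o W) \<cdot> ?y"
    by simp
  have 2: "(assoc C A W W' \<otimes>\<^sub>m cid C W) \<cdot> associ (A \<otimes>\<^sub>o W) W' W \<cdot> associ A W (W' \<otimes>\<^sub>o W) \<cdot> ?y
    = associ A (W \<otimes>\<^sub>o W') W \<cdot> (cid C A \<otimes>\<^sub>m associ W W' W) \<cdot> ?y"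
    using comp_cong_pull[OF associ_pentagon[of A W W' W], of ?y] by simp
  have 3: "((cid C A \<otimes>\<^sub>m e) \<otimes>\<^sub>m cid C W) \<cdot> associ A (W \<otimes>\<^sub>o W') W \<cdot> x = associ A (tunit C) W \<cdot> (cid C A \<otimes>\<^sub>m (e \<otimes>\<^sub>m cid C W)) \<cdot> x"
    if "x \<in> Ar C" "tgt C x = A \<otimes>\<^sub>o ((W \<otimes>\<^sub>o W') \<otimes>\<^sub>o W)" for x
    using associ_nat(2)[of "cid C A" e "cid C W"] that by simp
  have 4: "(runit C A \<otimes>\<^sub>m cid C W) \<cdot> associ A (tunit C) W \<cdot> x = (cid C A \<otimes>\<^sub>m lunit C W) \<cdot> x"
    if "x \<in> Ar C" "tgt C x = A \<otimes>\<^sub>o (tunit C \<otimes>\<^sub>o W)" for x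
    by (rule comp_pull[OF triangle']) (use that in auto)
  have "(runit C A \<otimes>\<^sub>m cid C W) \<cdot> ((cid C A \<otimes>\<^sub>m e) \<otimes>\<^sub>m cid C W) \<cdot> (assoc C A W W' \<otimes>\<^sub>m cid C W) \<cdot>
     associ (A \<otimes>\<^sub>o W) W' W \<cdot> (cid C (A \<otimes>\<^sub>o W) \<otimes>\<^sub>m c) \<cdot> runiti (A \<otimes>\<^sub>o W)
    = (cid C A \<otimes>\<^sub>m lunit C W) \<cdot> (cid C A \<otimes>\<^sub>m (e \<otimes>\<^sub>m cid C W)) \<cdot> (cid C A \<otimes>\<^sub>m associ W W' W) \<cdot> ?y"
    unfolding 1 2 by (subst 3, simp, simp, subst 4) auto
  also have "\<dots> = cid C (A \<otimes>\<^sub>o W)"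
    using is_dualD(9)[OF assms(1)] by simp
  finally show ?thesis .
qed

text \<open>The same zigzag identity tensored with \<open>B\<close> on the right, arranged for
  undoing \<open>transpose\<close>.\<close>

lemma dual_triangle_right:
  assumes "is_dual C W W' e c" and [simp]: "B \<in> Ob C"
  shows "lunit C (W \<otimes>\<^sub>o B) \<cdot> (e \<otimes>\<^sub>m cid C (W \<otimes>\<^sub>o B)) \<cdot> associ W W' (W \<otimes>\<^sub>o B) \<cdot> (cid C W \<otimes>\<^sub>m assoc C W' W B) \<cdot>
    (cid C W \<otimes>\<^sub>m (c \<otimes>\<^sub>m cid C B)) \<cdot> (cid C W \<otimes>\<^sub>m luniti B) = cid C (W \<otimes>\<^sub>o B)"
proof -
  note [simp] = is_dualD(1-8)[OF assms(1)]
  have 1: "lunit C (W \<otimes>\<^sub>o B) = (lunit C W \<otimes>\<^sub>m cid C B) \<cdot> associ (tunit C) W B"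
    by (simp flip: lunit_tens)
  have 2: "associ (tunit C) W B \<cdot> (e \<otimes>\<^sub>m cid C (W \<otimes>\<^sub>o B)) \<cdot> x = ((e \<otimes>\<^sub>m cid C W) \<otimes>\<^sub>m cid C B) \<cdot> associ (W \<otimes>\<^sub>o W') W B \<cdot> x"
    if "x \<in> Ar C" "tgt C x = (W \<otimes>\<^sub>o W') \<otimes>\<^sub>o (W \<otimes>\<^sub>o B)" for x
    using associ_nat(2)[of e "cid C W" "cid C B" "tunit C" W B x] that by simp
  have 3: "associ (W \<otimes>\<^sub>o W') W B \<cdot> associ W W' (W \<otimes>\<^sub>o B) \<cdot> (cid C W \<otimes>\<^sub>m assoc C W' W B) \<cdot> x
    = (associ W W' W \<otimes>\<^sub>m cid C B) \<cdot> associ W (W' \<otimes>\<^sub>o W) B \<cdot> x"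
    if "x \<in> Ar C" "tgt C x = W \<otimes>\<^sub>o ((W' \<otimes>\<^sub>o W) \<otimes>\<^sub>o B)" for x
    using comp_cong_pull[OF associ_pentagon'[of W W' W B], of x] that by simp
  have 4: "associ W (W' \<otimes>\<^sub>o W) B \<cdot> (cid C W \<otimes>\<^sub>m (c \<otimes>\<^sub>m cid C B)) \<cdot> x = ((cid C W \<otimes>\<^sub>m c) \<otimes>\<^sub>m cid C B) \<cdot> associ W (tunit C) B \<cdot> x"
    if "x \<in> Ar C" "tgt C x = W \<otimes>\<^sub>o (tunit C \<otimes>\<^sub>o B)" for x
    using associ_nat(2)[of "cid C W" c "cid C B"] that by simp
  have "lunit C (W \<otimes>\<^sub>o B) \<cdot> (e \<otimes>\<^sub>m cid C (W \<otimes>\<^sub>o B)) \<cdot> associ W W' (W \<otimes>\<^sub>o B) \<cdot> (cid C W \<otimes>\<^sub>m assoc C W' W B) \<cdot>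
    (cid C W \<otimes>\<^sub>m (c \<otimes>\<^sub>m cid C B)) \<cdot> (cid C W \<otimes>\<^sub>m luniti B)
   = (lunit C W \<otimes>\<^sub>m cid C B) \<cdot> associ (tunit C) W B \<cdot> (e \<otimes>\<^sub>m cid C (W \<otimes>\<^sub>o B)) \<cdot> associ W W' (W \<otimes>\<^sub>o B) \<cdot> (cid C W \<otimes>\<^sub>m assoc C W' W B) \<cdot>
    (cid C W \<otimes>\<^sub>m (c \<otimes>\<^sub>m cid C B)) \<cdot> (cid C W \<otimes>\<^sub>m luniti B)"
    unfolding 1 by (rule comp_assoc') auto
  also have "\<dots> = (lunit C W \<otimes>\<^sub>m cid C B) \<cdot> ((e \<otimes>\<^sub>m cid C W) \<otimes>\<^sub>m cid C B) \<cdot> (associ W W' W \<otimes>\<^sub>m cid C B) \<cdot>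
     ((cid C W \<otimes>\<^sub>m c) \<otimes>\<^sub>m cid C B) \<cdot> (runiti W \<otimes>\<^sub>m cid C B)"
    by (subst 2, simp, simp, subst 3, simp, simp, subst 4) (simp_all add: triangle_inverse)
  also have "\<dots> = cid C (W \<otimes>\<^sub>o B)"
    using is_dualD(9)[OF assms(1)] by simp
  finally show ?thesis .
qed

text \<open>Tensoring with \<open>W\<close> on the right is right adjoint to tensoring with a dual of \<open>W\<close>.\<close>

lemma mono_tens_right:
  assumes "is_dual C W W' e c" "is_mono C u"
  shows "is_mono C (u \<otimes>\<^sub>m cid C W)"
proof -
  note [simp] = is_dualD(1-8)[OF assms(1)] mono_arr[OF assms(2)]
  \<comment> \<open>The transpose \<open>X \<otimes> W' \<rightarrow> A\<close> of
    \<open>x : X \<rightarrow> A \<otimes> W\<close>. It determines \<open>x\<close> by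
    \<open>recover\<close> and is natural in \<open>A\<close> by \<open>hat_comp\<close>, so that
    cancelling \<open>u \<otimes> W\<close> reduces to cancelling \<open>u\<close>.\<close>
  define hat where "hat A x = runit C A \<cdot> (cid C A \<otimes>\<^sub>m e) \<cdot> assoc C A W W' \<cdot> (x \<otimes>\<^sub>m cid C W')" for A x
  have recover: "(hat A x \<otimes>\<^sub>m cid C W) \<cdot> associ (src C x) W' W \<cdot> (cid C (src C x) \<otimes>\<^sub>m c) \<cdot> runiti (src C x) = x"
    if [simp]: "A \<in> Ob C" "x \<in> Ar C" "tgt C x = A \<otimes>\<^sub>o W" for A x
  proof -
    let ?X = "src C x"
    have 1: "((x \<otimes>\<^sub>m cid C W') \<otimes>\<^sub>m cid C W) \<cdot> associ ?X W' W \<cdot> (cid C ?X \<otimes>\<^sub>m c) \<cdot> runiti ?X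
      = associ (A \<otimes>\<^sub>o W) W' W \<cdot> (cid C (A \<otimes>\<^sub>o W) \<otimes>\<^sub>m c) \<cdot> runiti (A \<otimes>\<^sub>o W) \<cdot> x"
    proof -
      have "((x \<otimes>\<^sub>m cid C W') \<otimes>\<^sub>m cid C W) \<cdot> associ ?X W' W \<cdot> (cid C ?X \<otimes>\<^sub>m c) \<cdot> runiti ?X
       = associ (A \<otimes>\<^sub>o W) W' W \<cdot> (x \<otimes>\<^sub>m cid C (W' \<otimes>\<^sub>o W)) \<cdot> (cid C ?X \<otimes>\<^sub>m c) \<cdot> runiti ?X"
        using associ_nat(2)[of x "cid C W'" "cid C W" "A \<otimes>\<^sub>o W" W' W "(cid C ?X \<otimes>\<^sub>m c) \<cdot> runiti ?X"] by simp
      also have "\<dots> = associ (A \<otimes>\<^sub>o W) W' W \<cdot> (cid C (A \<otimes>\<^sub>o W) \<otimes>\<^sub>m c) \<cdot> (x \<otimes>\<^sub>m cid C (tunit C)) \<cdot> runiti ?X"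
        by simp
      also have "\<dots> = associ (A \<otimes>\<^sub>o W) W' W \<cdot> (cid C (A \<otimes>\<^sub>o W) \<otimes>\<^sub>m c) \<cdot> runiti (A \<otimes>\<^sub>o W) \<cdot> x"
        using runiti_nat[of x] by simp
      finally show ?thesis .
    qed
    have "(hat A x \<otimes>\<^sub>m cid C W) \<cdot> associ ?X W' W \<cdot> (cid C ?X \<otimes>\<^sub>m c) \<cdot> runiti ?X
      = ((runit C A \<otimes>\<^sub>m cid C W) \<cdot> ((cid C A \<otimes>\<^sub>m e) \<otimes>\<^sub>m cid C W) \<cdot> (assoc C A W W' \<otimes>\<^sub>m cid C W)) \<cdot>
        ((x \<otimes>\<^sub>m cid C W') \<otimes>\<^sub>m cid C W) \<cdot> associ ?X W' W \<cdot> (cid C ?X \<otimes>\<^sub>m c) \<cdot> runiti ?X"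
      by (simp add: hat_def)
    also have "\<dots> = ((runit C A \<otimes>\<^sub>m cid C W) \<cdot> ((cid C A \<otimes>\<^sub>m e) \<otimes>\<^sub>m cid C W) \<cdot> (assoc C A W W' \<otimes>\<^sub>m cid C W) \<cdot>
      associ (A \<otimes>\<^sub>o W) W' W \<cdot> (cid C (A \<otimes>\<^sub>o W) \<otimes>\<^sub>m c) \<cdot> runiti (A \<otimes>\<^sub>o W)) \<cdot> x"
      unfolding 1 by simp
    also have "\<dots> = x" unfolding dual_triangle_left[OF assms(1) that(1)] by simp
    finally show ?thesis .
  qed
  have hat_comp: "hat (tgt C u) ((u \<otimes>\<^sub>m cid C W) \<cdot> x) = u \<cdot> hat (src C u) x"
    if [simp]: "x \<in> Ar C" "tgt C x = src C u \<otimes>\<^sub>o W" for x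
  proof -
    have "hat (tgt C u) ((u \<otimes>\<^sub>m cid C W) \<cdot> x) = runit C (tgt C u) \<cdot> (cid C (tgt C u) \<otimes>\<^sub>m e) \<cdot> assoc C (tgt C u) W W'
      \<cdot> ((u \<otimes>\<^sub>m cid C W) \<otimes>\<^sub>m cid C W') \<cdot> (x \<otimes>\<^sub>m cid C W')"
      by (simp add: hat_def)
    also have "\<dots> = runit C (tgt C u) \<cdot> (u \<otimes>\<^sub>m cid C (tunit C)) \<cdot> (cid C (src C u) \<otimes>\<^sub>m e) \<cdot> assoc C (src C u) W W' \<cdot> (x \<otimes>\<^sub>m cid C W')"
      by (subst assoc_nat(2)) auto
    also have "\<dots> = u \<cdot> hat (src C u) x"
      unfolding hat_def by (subst runit_nat(2)) auto
    finally show ?thesis .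
  qed
  show ?thesis
    unfolding is_mono_def
  proof (intro conjI allI ballI impI)
    fix X x y assume a: "x \<in> Hom C X (src C (u \<otimes>\<^sub>m cid C W))" "y \<in> Hom C X (src C (u \<otimes>\<^sub>m cid C W))"
      "(u \<otimes>\<^sub>m cid C W) \<cdot> x = (u \<otimes>\<^sub>m cid C W) \<cdot> y"
    then have b: "x \<in> Ar C" "y \<in> Ar C" "tgt C x = src C u \<otimes>\<^sub>o W" "tgt C y = src C u \<otimes>\<^sub>o W" "src C x = X" "src C y = X"
      by auto
    have "u \<cdot> hat (src C u) x = u \<cdot> hat (src C u) y"
      using a(3) b by (simp flip: hat_comp)
    then have "hat (src C u) x = hat (src C u) y"
      by - (rule monoD[OF assms(2)], use b in \<open>auto simp: hat_def\<close>)
    then show "x = y"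
      using recover[of "src C u" x] recover[of "src C u" y] b by simp
  qed auto
qed

text \<open>The transpose of \<open>x\<close> under the adjunction between tensoring with \<open>W\<close> and with its dual on the left.\<close>

definition transpose :: "'a \<Rightarrow> 'a \<Rightarrow> 'b \<Rightarrow> 'a \<Rightarrow> 'b \<Rightarrow> 'b" where
  "transpose W W' c B x = (cid C W' \<otimes>\<^sub>m x) \<cdot> assoc C W' W B \<cdot> (c \<otimes>\<^sub>m cid C B) \<cdot> luniti B"

lemma transpose_arr [simp]:
  assumes "is_dual C W W' e c" "B \<in> Ob C" "x \<in> Ar C" "src C x = W \<otimes>\<^sub>o B"
  shows "transpose W W' c B x \<in> Ar C" "src C (transpose W W' c B x) = B"
    "tgt C (transpose W W' c B x) = W' \<otimes>\<^sub>o tgt C x"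
  using is_dualD[OF assms(1)] assms(2-) unfolding transpose_def by auto

lemma transpose_recover:
  assumes "is_dual C W W' e c" and [simp]: "B \<in> Ob C" "x \<in> Ar C" "src C x = W \<otimes>\<^sub>o B"
  shows "lunit C (tgt C x) \<cdot> (e \<otimes>\<^sub>m cid C (tgt C x)) \<cdot> associ W W' (tgt C x) \<cdot> (cid C W \<otimes>\<^sub>m transpose W W' c B x) = x"
proof -
  note [simp] = is_dualD(1-8)[OF assms(1)]
  let ?Y = "tgt C x"
  have 1: "associ W W' ?Y \<cdot> (cid C W \<otimes>\<^sub>m (cid C W' \<otimes>\<^sub>m x)) \<cdot> y = (cid C (W \<otimes>\<^sub>o W') \<otimes>\<^sub>m x) \<cdot> associ W W' (W \<otimes>\<^sub>o B) \<cdot> y"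
    if "y \<in> Ar C" "tgt C y = W \<otimes>\<^sub>o (W' \<otimes>\<^sub>o (W \<otimes>\<^sub>o B))" for y
    using associ_nat(2)[of "cid C W" "cid C W'" x] that by simp
  let ?z = "associ W W' (W \<otimes>\<^sub>o B) \<cdot> (cid C W \<otimes>\<^sub>m assoc C W' W B) \<cdot> (cid C W \<otimes>\<^sub>m (c \<otimes>\<^sub>m cid C B)) \<cdot> (cid C W \<otimes>\<^sub>m luniti B)"
  have "lunit C ?Y \<cdot> (e \<otimes>\<^sub>m cid C ?Y) \<cdot> associ W W' ?Y \<cdot> (cid C W \<otimes>\<^sub>m transpose W W' c B x)
    = lunit C ?Y \<cdot> (e \<otimes>\<^sub>m cid C ?Y) \<cdot> associ W W' ?Y \<cdot> (cid C W \<otimes>\<^sub>m (cid C W' \<otimes>\<^sub>m x)) \<cdot> (cid C W \<otimes>\<^sub>m assoc C W' W B) \<cdot>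
      (cid C W \<otimes>\<^sub>m (c \<otimes>\<^sub>m cid C B)) \<cdot> (cid C W \<otimes>\<^sub>m luniti B)"
    by (simp add: transpose_def)
  also have "\<dots> = lunit C ?Y \<cdot> (cid C (tunit C) \<otimes>\<^sub>m x) \<cdot> (e \<otimes>\<^sub>m cid C (W \<otimes>\<^sub>o B)) \<cdot> ?z"
    by (subst 1) auto
  also have "\<dots> = x \<cdot> lunit C (W \<otimes>\<^sub>o B) \<cdot> (e \<otimes>\<^sub>m cid C (W \<otimes>\<^sub>o B)) \<cdot> ?z"
    by (subst lunit_nat(2)) auto
  also have "\<dots> = x"
    unfolding dual_triangle_right[OF assms(1) assms(2)] by simp
  finally show ?thesis .
qed

lemma transpose_comp:
  assumes "is_dual C W W' e c"
    and [simp]: "x \<in> Ar C" "q \<in> Ar C" "src C x = W \<otimes>\<^sub>o tgt C q"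
  shows "transpose W W' c (src C q) (x \<cdot> (cid C W \<otimes>\<^sub>m q)) = transpose W W' c (tgt C q) x \<cdot> q"
proof -
  note [simp] = is_dualD(1-8)[OF assms(1)]
  have 1: "(cid C W' \<otimes>\<^sub>m (cid C W \<otimes>\<^sub>m q)) \<cdot> assoc C W' W (src C q) \<cdot> y = assoc C W' W (tgt C q) \<cdot> (cid C (W' \<otimes>\<^sub>o W) \<otimes>\<^sub>m q) \<cdot> y"
    if "y \<in> Ar C" "tgt C y = (W' \<otimes>\<^sub>o W) \<otimes>\<^sub>o src C q" for y
    using assoc_nat(2)[of "cid C W'" "cid C W" q W' W "tgt C q" y] that by simp
  have "transpose W W' c (src C q) (x \<cdot> (cid C W \<otimes>\<^sub>m q))
    = (cid C W' \<otimes>\<^sub>m x) \<cdot> (cid C W' \<otimes>\<^sub>m (cid C W \<otimes>\<^sub>m q)) \<cdot> assoc C W' W (src C q) \<cdot> (c \<otimes>\<^sub>m cid C (src C q)) \<cdot> luniti (src C q)"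
    by (simp add: transpose_def)
  also have "\<dots> = (cid C W' \<otimes>\<^sub>m x) \<cdot> assoc C W' W (tgt C q) \<cdot> (c \<otimes>\<^sub>m cid C (tgt C q)) \<cdot> (cid C (tunit C) \<otimes>\<^sub>m q) \<cdot> luniti (src C q)"
    by (subst 1) auto
  also have "\<dots> = transpose W W' c (tgt C q) x \<cdot> q"
    using luniti_nat[of q] by (simp add: transpose_def)
  finally show ?thesis .
qed

lemma transpose_inject:
  assumes "is_dual C W W' e c" "x \<in> Ar C" "y \<in> Ar C" "src C x = W \<otimes>\<^sub>o B" "src C y = W \<otimes>\<^sub>o B" "B \<in> Ob C"
    "tgt C x = tgt C y" "transpose W W' c B x = transpose W W' c B y"
  shows "x = y"
  using transpose_recover[OF assms(1,6,2,4)] transpose_recover[OF assms(1,6,3,5)]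
  unfolding assms(7,8) by (rule trans[OF sym])

text \<open>Left adjoints preserve epimorphisms: under \<open>transpose\<close>, precomposition with
  \<open>W \<otimes> q\<close> becomes precomposition with \<open>q\<close>.\<close>

lemma epi_tens_left:
  assumes "is_dual C W W' e c" "is_epi C q"
  shows "is_epi C (cid C W \<otimes>\<^sub>m q)"
  unfolding is_epi_def
proof (intro conjI allI ballI impI)
  note [simp] = is_dualD(1-8)[OF assms(1)] epi_arr[OF assms(2)]
  show "cid C W \<otimes>\<^sub>m q \<in> Ar C" by simp
  fix Y x y assume a: "x \<in> Hom C (tgt C (cid C W \<otimes>\<^sub>m q)) Y" "y \<in> Hom C (tgt C (cid C W \<otimes>\<^sub>m q)) Y"
    "x \<cdot> (cid C W \<otimes>\<^sub>m q) = y \<cdot> (cid C W \<otimes>\<^sub>m q)"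
  have b: "x \<in> Ar C" "y \<in> Ar C" "src C x = W \<otimes>\<^sub>o tgt C q" "src C y = W \<otimes>\<^sub>o tgt C q" "tgt C x = Y" "tgt C y = Y"
    using a by auto
  have "transpose W W' c (tgt C q) x \<cdot> q = transpose W W' c (tgt C q) y \<cdot> q"
    using transpose_comp[OF assms(1), of x q] transpose_comp[OF assms(1), of y q] a(3) b by simp
  then have "transpose W W' c (tgt C q) x = transpose W W' c (tgt C q) y"
    by - (rule epiD[OF assms(2)], use b transpose_arr[OF assms(1)] in auto)
  then show "x = y"
    by - (rule transpose_inject[OF assms(1)], use b in auto)
qed

end

section \<open>Consequences of rigidity: preservation of monomorphisms, adjuncts and traces\<close>

context rigid_abelian_tensor_category
begin

lemma is_dual_dual: "A \<in> Ob C \<Longrightarrow> is_dual C A (dual C A) (ev C A) (coev C A)"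
proof -
  assume "A \<in> Ob C"
  then have "\<exists>t. case t of (A', e, c) \<Rightarrow> is_dual C A A' e c" using ex_dual by auto
  then have "case dual_data C A of (A', e, c) \<Rightarrow> is_dual C A A' e c"
    unfolding dual_data_def by (rule someI_ex)
  then show ?thesis by (simp add: dual_def ev_def coev_def split_beta)
qed

lemmas dual_arr [simp] = is_dualD(2-8)[OF is_dual_dual]

lemma mono_tens_cid:
  assumes "is_mono C u" "W \<in> Ob C"
  shows "is_mono C (u \<otimes>\<^sub>m cid C W)"
  by (rule mono_tens_right[OF is_dual_dual[OF assms(2)] assms(1)])

lemma mono_cid_tens:
  assumes "is_mono C u" "W \<in> Ob C"
  shows "is_mono C (cid C W \<otimes>\<^sub>m u)"
proof -
  note [simp] = mono_arr[OF assms(1)] assms(2)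
  have "is_mono C (braid C (tgt C u) W \<cdot> (u \<otimes>\<^sub>m cid C W) \<cdot> braid C W (src C u))"
    by (intro mono_comp iso_mono braid_iso mono_tens_cid assms) auto
  moreover have "braid C (tgt C u) W \<cdot> (u \<otimes>\<^sub>m cid C W) \<cdot> braid C W (src C u) = cid C W \<otimes>\<^sub>m u"
    by (subst braid_nat(2)) (auto simp: braid_symmetric)
  ultimately show ?thesis by simp
qed

lemma mono_tens:
  assumes "is_mono C u" "is_mono C v"
  shows "is_mono C (u \<otimes>\<^sub>m v)"
proof -
  note [simp] = mono_arr[OF assms(1)] mono_arr[OF assms(2)]
  have "is_mono C ((u \<otimes>\<^sub>m cid C (tgt C v)) \<cdot> (cid C (src C u) \<otimes>\<^sub>m v))"
    by (intro mono_comp mono_tens_cid mono_cid_tens assms) auto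
  then show ?thesis by simp
qed

lemma adjunct_arr [simp]:
  assumes "f \<in> Ar C"
  shows "adjunct C f \<in> Ar C" "src C (adjunct C f) = \<one>\<^sub>C" "tgt C (adjunct C f) = dual C (src C f) \<otimes>\<^sub>o tgt C f"
  using assms unfolding adjunct_def by auto

text \<open>By the zigzag identity of the source, \<open>f\<close> can be reconstructed from its
  adjunct. Hence vanishing of \<open>f\<close> can be tested on a morphism out of the unit.\<close>

lemma adjunct_recover:
  assumes [simp]: "f \<in> Ar C"
  shows "lunit C (tgt C f) \<cdot> (ev C (src C f) \<otimes>\<^sub>m cid C (tgt C f)) \<cdot> associ (src C f) (dual C (src C f)) (tgt C f) \<cdot>
    (cid C (src C f) \<otimes>\<^sub>m adjunct C f) \<cdot> runiti (src C f) = f"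
proof -
  let ?A = "src C f" and ?B = "tgt C f"
  let ?D = "dual C ?A"
  let ?z = "associ ?A ?D ?A \<cdot> (cid C ?A \<otimes>\<^sub>m coev C ?A) \<cdot> runiti ?A"
  have 1: "associ ?A ?D ?B \<cdot> (cid C ?A \<otimes>\<^sub>m (cid C ?D \<otimes>\<^sub>m f)) \<cdot> y = (cid C (?A \<otimes>\<^sub>o ?D) \<otimes>\<^sub>m f) \<cdot> associ ?A ?D ?A \<cdot> y"
    if "y \<in> Ar C" "tgt C y = ?A \<otimes>\<^sub>o (?D \<otimes>\<^sub>o ?A)" for y
    using associ_nat(2)[of "cid C ?A" "cid C ?D" f] that by simp
  have "lunit C ?B \<cdot> (ev C ?A \<otimes>\<^sub>m cid C ?B) \<cdot> associ ?A ?D ?B \<cdot> (cid C ?A \<otimes>\<^sub>m adjunct C f) \<cdot> runiti ?A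
   = lunit C ?B \<cdot> (ev C ?A \<otimes>\<^sub>m cid C ?B) \<cdot> associ ?A ?D ?B \<cdot> (cid C ?A \<otimes>\<^sub>m (cid C ?D \<otimes>\<^sub>m f)) \<cdot> (cid C ?A \<otimes>\<^sub>m coev C ?A) \<cdot> runiti ?A"
    by (simp add: adjunct_def)
  also have "\<dots> = lunit C ?B \<cdot> (cid C \<one>\<^sub>C \<otimes>\<^sub>m f) \<cdot> (ev C ?A \<otimes>\<^sub>m cid C ?A) \<cdot> ?z"
    by (subst 1) auto
  also have "\<dots> = f \<cdot> lunit C ?A \<cdot> (ev C ?A \<otimes>\<^sub>m cid C ?A) \<cdot> ?z"
    by (subst lunit_nat(2)) auto
  also have "\<dots> = f"
    using is_dualD(9)[OF is_dual_dual[of ?A]] by simp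
  finally show ?thesis .
qed

lemma adjunct_zero [simp]:
  "A \<in> Ob C \<Longrightarrow> B \<in> Ob C \<Longrightarrow> adjunct C (czero C A B) = czero C \<one>\<^sub>C (dual C A \<otimes>\<^sub>o B)"
  unfolding adjunct_def by simp

lemma adjunct_eq_zeroD:
  assumes "f \<in> Ar C" "adjunct C f = czero C \<one>\<^sub>C (dual C (src C f) \<otimes>\<^sub>o tgt C f)"
  shows "f = czero C (src C f) (tgt C f)"
  using adjunct_recover[OF assms(1)] assms by simp

text \<open>The adjunct starts at the unit, where scalars act by precomposition. This is what turns
  annihilators of \<open>f\<close> into a question about the kernel of its adjunct.\<close>

lemma adjunct_smul:
  assumes "z \<in> \<R>" "f \<in> Ar C"
  shows "adjunct C (z \<star> f) = adjunct C f \<cdot> z"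
proof -
  have "adjunct C (z \<star> f) = z \<star> adjunct C f"
    using assms by (simp add: adjunct_def smul_tens smul_comp)
  then show ?thesis using assms smul_from_tunit[of z "adjunct C f"] by simp
qed

lemma tr_arr:
  assumes "f \<in> Ar C" "src C f = tgt C f"
  shows "tr C f \<in> \<R>"
  using assms unfolding tr_def by simp

lemma tr_smul:
  assumes "z \<in> \<R>" "f \<in> Ar C" "src C f = tgt C f"
  shows "tr C (z \<star> f) = tr C f \<cdot> z"
  using assms unfolding tr_def by (simp add: adjunct_smul)

end

subsection \<open>Subobjects of the unit\<close>

context rigid_abelian_tensor_category
begin

lemma zero_if_iso_comp_zero:
  assumes "is_iso C a" "a \<cdot> f = czero C (src C f) (tgt C a)" "f \<in> Ar C" "tgt C f = src C a" "B = tgt C f" "A = src C f"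
  shows "f = czero C A B"
  unfolding assms(5,6) by (rule iso_cancel_left[OF assms(1)]) (use assms is_iso_arr[OF assms(1)] in auto)

lemma tens_zero_assoc:
  assumes "f \<otimes>\<^sub>m g = czero C (src C f \<otimes>\<^sub>o src C g) (tgt C f \<otimes>\<^sub>o tgt C g)" and [simp]: "f \<in> Ar C" "g \<in> Ar C" "h \<in> Ar C"
  shows "(h \<otimes>\<^sub>m f) \<otimes>\<^sub>m g = czero C ((src C h \<otimes>\<^sub>o src C f) \<otimes>\<^sub>o src C g) ((tgt C h \<otimes>\<^sub>o tgt C f) \<otimes>\<^sub>o tgt C g)"
proof (rule zero_if_iso_comp_zero)
  show "assoc C (tgt C h) (tgt C f) (tgt C g) \<cdot> ((h \<otimes>\<^sub>m f) \<otimes>\<^sub>m g) =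
    czero C (src C ((h \<otimes>\<^sub>m f) \<otimes>\<^sub>m g)) (tgt C (assoc C (tgt C h) (tgt C f) (tgt C g)))"
    by (simp add: assoc_nat assms(1))
qed auto

lemma tens_zero_braid:
  assumes "f \<otimes>\<^sub>m g = czero C (src C f \<otimes>\<^sub>o src C g) (tgt C f \<otimes>\<^sub>o tgt C g)" and [simp]: "f \<in> Ar C" "g \<in> Ar C"
  shows "g \<otimes>\<^sub>m f = czero C (src C g \<otimes>\<^sub>o src C f) (tgt C g \<otimes>\<^sub>o tgt C f)"
proof (rule zero_if_iso_comp_zero)
  show "braid C (tgt C g) (tgt C f) \<cdot> (g \<otimes>\<^sub>m f) = czero C (src C (g \<otimes>\<^sub>m f)) (tgt C (braid C (tgt C g) (tgt C f)))"
    by (simp add: braid_nat assms(1))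
qed auto

text \<open>The cokernel \<open>Q\<close> of \<open>u\<close> satisfies \<open>U \<otimes> Q = 0\<close>, so \<open>u \<otimes> X\<close> is invertible whenever \<open>X \<otimes> Q = 0\<close>,
  in particular for \<open>X = U\<close> and \<open>X = U' \<otimes> U\<close>. Inverting it for the latter turns the coevaluation of \<open>U\<close>
  into a retraction of \<open>u\<close>.\<close>

lemma subunit_retraction:
  assumes "is_mono C u" "tgt C u = \<one>\<^sub>C"
  obtains p where "p \<in> Ar C" "src C p = \<one>\<^sub>C" "tgt C p = src C u" "p \<cdot> u = cid C (src C u)"
proof -
  define U where "U = src C u"
  have [simp]: "u \<in> Ar C" "tgt C u = \<one>\<^sub>C" "src C u = U" "U \<in> Ob C"
    using mono_arr[OF assms(1)] assms(2) unfolding U_def by auto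
  obtain q where q: "is_cokernel C u q" using ex_cokernel[of u] by auto
  define Q where "Q = tgt C q"
  have [simp]: "q \<in> Ar C" "src C q = \<one>\<^sub>C" "tgt C q = Q" "Q \<in> Ob C" and qu: "q \<cdot> u = czero C U Q"
    using cokernelD[OF q] unfolding Q_def by auto
  \<comment> \<open>Up to unitors \<open>u \<otimes> q\<close> is \<open>q \<cdot> u\<close>, hence
    zero. Written as \<open>(u \<otimes> Q) \<cdot> (U \<otimes> q)\<close> it first loses the
    monomorphism \<open>u \<otimes> Q\<close> and then the epimorphism \<open>U \<otimes> q\<close>,
    which leaves that the identity of \<open>U \<otimes> Q\<close> is zero.\<close>
  have UQ: "cid C U \<otimes>\<^sub>m cid C Q = czero C (U \<otimes>\<^sub>o Q) (U \<otimes>\<^sub>o Q)"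
  proof -
    have "lunit C Q \<cdot> (u \<otimes>\<^sub>m q) = lunit C Q \<cdot> (cid C \<one>\<^sub>C \<otimes>\<^sub>m q) \<cdot> (u \<otimes>\<^sub>m cid C \<one>\<^sub>C)" by simp
    also have "\<dots> = q \<cdot> runit C \<one>\<^sub>C \<cdot> (u \<otimes>\<^sub>m cid C \<one>\<^sub>C)"
      by (subst lunit_nat(2)) (auto simp: lunit_tunit)
    also have "\<dots> = (q \<cdot> u) \<cdot> runit C U"
      by (simp add: runit_nat)
    also have "\<dots> = czero C (U \<otimes>\<^sub>o \<one>\<^sub>C) Q" by (simp add: qu)
    finally have "u \<otimes>\<^sub>m q = czero C (U \<otimes>\<^sub>o \<one>\<^sub>C) (\<one>\<^sub>C \<otimes>\<^sub>o Q)"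
      by - (rule zero_if_iso_comp_zero[of "lunit C Q"], auto)
    then have "(u \<otimes>\<^sub>m cid C Q) \<cdot> (cid C U \<otimes>\<^sub>m q) = (u \<otimes>\<^sub>m cid C Q) \<cdot> czero C (U \<otimes>\<^sub>o \<one>\<^sub>C) (U \<otimes>\<^sub>o Q)"
      by simp
    then have 1: "cid C U \<otimes>\<^sub>m q = czero C (U \<otimes>\<^sub>o \<one>\<^sub>C) (U \<otimes>\<^sub>o Q)"
      by (rule monoD[OF mono_tens_cid[OF assms(1), of Q], rotated -1]) auto
    show ?thesis
      by (rule epiD[OF epi_tens_left[OF is_dual_dual cokernel_epi[OF q], of U]]) (auto simp: 1)
  qed
  have iso: "is_iso C (lunit C X \<cdot> (u \<otimes>\<^sub>m cid C X))"
    if [simp]: "X \<in> Ob C" and XQ: "cid C X \<otimes>\<^sub>m cid C Q = czero C (X \<otimes>\<^sub>o Q) (X \<otimes>\<^sub>o Q)" for X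
  proof -
    \<comment> \<open>A morphism \<open>x\<close> killed by \<open>X \<otimes> u\<close> has a
      transpose killed by \<open>u\<close>. The transpose factors through \<open>q\<close>, so its
      tensor product with \<open>X\<close> passes through \<open>X \<otimes> Q\<close>, which is
      zero; undoing the transposition gives \<open>x = 0\<close>.\<close>
    have "is_epi C (cid C X \<otimes>\<^sub>m u)"
    proof (rule epiI)
      fix x assume x: "x \<in> Ar C" "src C x = tgt C (cid C X \<otimes>\<^sub>m u)"
        "x \<cdot> (cid C X \<otimes>\<^sub>m u) = czero C (src C (cid C X \<otimes>\<^sub>m u)) (tgt C x)"
      then have [simp]: "src C x = X \<otimes>\<^sub>o \<one>\<^sub>C" "x \<in> Ar C" by auto
      let ?Y = "tgt C x"
      let ?t = "transpose X (dual C X) (coev C X) \<one>\<^sub>C x"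
      note t [simp] = transpose_arr[OF is_dual_dual, of X "\<one>\<^sub>C" x]
      have "?t \<cdot> u = transpose X (dual C X) (coev C X) U (czero C (X \<otimes>\<^sub>o U) ?Y)"
        using transpose_comp[OF is_dual_dual, of X x u] x(3) by simp
      also have "\<dots> = czero C U (dual C X \<otimes>\<^sub>o ?Y)"
        unfolding transpose_def by simp
      finally obtain y where y [simp]: "y \<in> Ar C" "src C y = Q" "tgt C y = dual C X \<otimes>\<^sub>o ?Y" and yq: "y \<cdot> q = ?t"
        using cokernel_factor[OF q, of ?t] by auto
      have "cid C X \<otimes>\<^sub>m ?t = (cid C X \<otimes>\<^sub>m y) \<cdot> (cid C X \<otimes>\<^sub>m cid C Q) \<cdot> (cid C X \<otimes>\<^sub>m q)"
        by (simp add: yq del: tens_cid)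
      also have "\<dots> = czero C (X \<otimes>\<^sub>o \<one>\<^sub>C) (X \<otimes>\<^sub>o (dual C X \<otimes>\<^sub>o ?Y))"
        unfolding XQ by simp
      finally show "x = czero C (tgt C (cid C X \<otimes>\<^sub>m u)) (tgt C x)"
        using transpose_recover[OF is_dual_dual, of X "\<one>\<^sub>C" x] by simp
    qed auto
    then have "is_iso C (cid C X \<otimes>\<^sub>m u)"
      by (intro mono_epi_iso mono_cid_tens assms) auto
    then have "is_iso C (braid C X \<one>\<^sub>C \<cdot> (cid C X \<otimes>\<^sub>m u) \<cdot> braid C U X)"
      by (intro iso_comp) auto
    moreover have "braid C X \<one>\<^sub>C \<cdot> (cid C X \<otimes>\<^sub>m u) \<cdot> braid C U X = u \<otimes>\<^sub>m cid C X"
      by (subst braid_nat(2)) (auto simp: braid_symmetric)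
    ultimately show ?thesis by (intro iso_comp) auto
  qed
  \<comment> \<open>\<open>W\<close> is the target of the coevaluation of \<open>U\<close>. As it
    contains the factor \<open>U\<close>, it satisfies the vanishing condition of
    \<open>iso\<close>, whereas the unit itself need not.\<close>
  define W where "W = dual C U \<otimes>\<^sub>o U"
  have [simp]: "W \<in> Ob C" "tgt C (coev C U) = W" unfolding W_def by auto
  define m where "m X = lunit C X \<cdot> (u \<otimes>\<^sub>m cid C X)" for X
  have m_arr [simp]: "m X \<in> Ar C" "src C (m X) = U \<otimes>\<^sub>o X" "tgt C (m X) = X" if "X \<in> Ob C" for X
    using that by (simp_all add: m_def)
  have m_iso [simp]: "is_iso C (m U)" "is_iso C (m W)"
    using iso[of U] iso[of W] UQ tens_zero_assoc[of "cid C U" "cid C Q" "cid C (dual C U)"]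
    by (simp_all add: m_def W_def)
  have m_nat: "m (tgt C x) \<cdot> (cid C U \<otimes>\<^sub>m x) = x \<cdot> m (src C x)" if "x \<in> Ar C" for x
  proof -
    have "m (tgt C x) \<cdot> (cid C U \<otimes>\<^sub>m x) = lunit C (tgt C x) \<cdot> (cid C \<one>\<^sub>C \<otimes>\<^sub>m x) \<cdot> (u \<otimes>\<^sub>m cid C (src C x))"
      using that by (simp add: m_def)
    also have "\<dots> = x \<cdot> m (src C x)"
      using that unfolding m_def by (subst lunit_nat(2)) auto
    finally show ?thesis .
  qed
  \<comment> \<open>Applying \<open>u\<close> to the left or to the right factor of
    \<open>U \<otimes> U\<close> gives the same map to \<open>U\<close>: after composing with the
    monomorphism \<open>u\<close> both become \<open>u \<otimes> u\<close> up to unitors.\<close>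
  have m_U: "m U = runit C U \<cdot> (cid C U \<otimes>\<^sub>m u)"
  proof (rule monoD[OF assms(1)])
    have "u \<cdot> m U = (u \<cdot> lunit C U) \<cdot> (u \<otimes>\<^sub>m cid C U)" by (simp add: m_def)
    also have "\<dots> = (lunit C \<one>\<^sub>C \<cdot> (cid C \<one>\<^sub>C \<otimes>\<^sub>m u)) \<cdot> (u \<otimes>\<^sub>m cid C U)" using lunit_nat(1)[of u] by simp
    also have "\<dots> = (runit C \<one>\<^sub>C \<cdot> (u \<otimes>\<^sub>m cid C \<one>\<^sub>C)) \<cdot> (cid C U \<otimes>\<^sub>m u)" by (simp add: lunit_tunit)
    also have "\<dots> = u \<cdot> (runit C U \<cdot> (cid C U \<otimes>\<^sub>m u))" using runit_nat(1)[of u] by simp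
    finally show "u \<cdot> m U = u \<cdot> (runit C U \<cdot> (cid C U \<otimes>\<^sub>m u))" .
  qed auto
  \<comment> \<open>Contraction of \<open>U\<close> with the dual factor of \<open>W\<close>; the
    zigzag identity says that it undoes the coevaluation.\<close>
  define h where "h = lunit C U \<cdot> (ev C U \<otimes>\<^sub>m cid C U) \<cdot> associ U (dual C U) U"
  have h_arr [simp]: "h \<in> Ar C" "src C h = U \<otimes>\<^sub>o W" "tgt C h = U"
    by (simp_all add: h_def W_def)
  have h_coev: "h \<cdot> (cid C U \<otimes>\<^sub>m coev C U) = runit C U"
  proof -
    have "(h \<cdot> (cid C U \<otimes>\<^sub>m coev C U)) \<cdot> runiti U = cid C U"
      using is_dualD(9)[OF is_dual_dual, of U] unfolding h_def by (simp add: W_def)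
    then have "((h \<cdot> (cid C U \<otimes>\<^sub>m coev C U)) \<cdot> runiti U) \<cdot> runit C U = runit C U"
      by simp
    then show ?thesis by simp
  qed
  let ?w = "coev C U \<cdot> u"
  have "h \<cdot> (cid C U \<otimes>\<^sub>m ?w) = (h \<cdot> (cid C U \<otimes>\<^sub>m coev C U)) \<cdot> (cid C U \<otimes>\<^sub>m u)" by simp
  then have h_w: "h \<cdot> (cid C U \<otimes>\<^sub>m ?w) = m U" by (simp only: h_coev m_U)
  \<comment> \<open>The retraction will be
    \<open>h \<cdot> inverse_arrow C (m W) \<cdot> coev C U\<close>. Naturality of the inverse moves
    \<open>u\<close> past it, where \<open>h_w\<close> leaves \<open>m U\<close> composed with its
    own inverse.\<close>
  have "inverse_arrow C (m W) \<cdot> ?w = (cid C U \<otimes>\<^sub>m ?w) \<cdot> inverse_arrow C (m U)"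
    by (rule inverse_nat) (use m_nat[of ?w] in auto)
  then have "h \<cdot> inverse_arrow C (m W) \<cdot> ?w = (h \<cdot> (cid C U \<otimes>\<^sub>m ?w)) \<cdot> inverse_arrow C (m U)"
    by simp
  also have "\<dots> = cid C U" by (simp add: h_w)
  finally show thesis
    by (intro that[of "h \<cdot> inverse_arrow C (m W) \<cdot> coev C U"]) auto
qed

text \<open>The complement is the kernel \<open>k\<close> of a retraction \<open>p\<close> of
  \<open>u\<close>. Since \<open>p\<close> kills \<open>1 - u p\<close>, this idempotent factors
  through \<open>k\<close>, and the factor is the second projection.\<close>

lemma ex_complement:
  assumes "is_mono C u" "tgt C u = \<one>\<^sub>C"
  shows "\<exists>v. is_complement C u v"
proof -
  note [simp] = mono_arr[OF assms(1)] assms(2)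
  obtain p where p [simp]: "p \<in> Ar C" "src C p = \<one>\<^sub>C" "tgt C p = src C u" and pu: "p \<cdot> u = cid C (src C u)"
    using subunit_retraction[OF assms] .
  obtain k where k: "is_kernel C p k" using ex_kernel[of p] by auto
  note km = kernel_mono[OF k]
  have [simp]: "k \<in> Ar C" "tgt C k = \<one>\<^sub>C" and pk: "p \<cdot> k = czero C (src C k) (src C u)" using kernelD[OF k] by auto
  let ?m = "cid C \<one>\<^sub>C \<boxplus> neg (u \<cdot> p)"
  have "p \<cdot> ?m = p \<boxplus> neg ((p \<cdot> u) \<cdot> p)" by simp
  then have "p \<cdot> ?m = czero C \<one>\<^sub>C (src C u)" by (simp add: pu)
  then obtain q where q [simp]: "q \<in> Ar C" "src C q = \<one>\<^sub>C" "tgt C q = src C k" and kq: "k \<cdot> q = ?m"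
    using kernel_factor[OF k, of ?m] by auto
  have "k \<cdot> (q \<cdot> k) = (k \<cdot> q) \<cdot> k" by simp
  also have "\<dots> = k \<cdot> cid C (src C k)" unfolding kq by (simp add: pk comp_neg(2)[of k "u \<cdot> p"])
  finally have qk: "q \<cdot> k = cid C (src C k)" by - (rule monoD[OF km], auto)
  have "k \<cdot> (q \<cdot> u) = (k \<cdot> q) \<cdot> u" by simp
  also have "\<dots> = k \<cdot> czero C (src C u) (src C k)" unfolding kq by (simp add: pu)
  finally have qu: "q \<cdot> u = czero C (src C u) (src C k)" by - (rule monoD[OF km], auto)
  have "u \<cdot> p \<boxplus> k \<cdot> q = ?m \<boxplus> u \<cdot> p" unfolding kq by (rule add_comm) auto
  also have "\<dots> = cid C \<one>\<^sub>C" by simp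
  finally have "is_biproduct C (tgt C u) (src C u) (src C k) u k p q"
    unfolding is_biproduct_def using pu qk qu pk by simp
  then show ?thesis unfolding is_complement_def by blast
qed

lemma biproductD:
  assumes "is_biproduct C S A B i j p q"
  shows "i \<in> Ar C" "j \<in> Ar C" "p \<in> Ar C" "q \<in> Ar C" "src C i = A" "src C j = B" "src C p = S" "src C q = S"
    "tgt C i = S" "tgt C j = S" "tgt C p = A" "tgt C q = B"
    "p \<cdot> i = cid C A" "q \<cdot> j = cid C B" "q \<cdot> i = czero C A B" "p \<cdot> j = czero C B A" "i \<cdot> p \<boxplus> j \<cdot> q = cid C S"
  using assms unfolding is_biproduct_def by auto

lemma biproduct_sym:
  assumes "is_biproduct C S A B i j p q"
  shows "is_biproduct C S B A j i q p"
  using biproductD[OF assms] add_comm[of "i \<cdot> p" "j \<cdot> q"] unfolding is_biproduct_def by simp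

lemma biproduct_mono:
  assumes "is_biproduct C S A B i j p q"
  shows "is_mono C i"
  unfolding is_mono_def
proof (intro conjI allI ballI impI)
  note b [simp] = biproductD(1-12)[OF assms] and pi = biproductD(13)[OF assms]
  fix X x y assume "x \<in> Hom C X (src C i)" "y \<in> Hom C X (src C i)" "i \<cdot> x = i \<cdot> y"
  then have x: "x \<in> Ar C" "y \<in> Ar C" "tgt C x = A" "tgt C y = A" "src C x = X" "src C y = X" "p \<cdot> (i \<cdot> x) = p \<cdot> (i \<cdot> y)" by auto
  then show "x = y" using comp_pull[OF pi, of x] comp_pull[OF pi, of y] by simp
qed (use biproductD[OF assms] in auto)

lemma complement_is_complement:
  assumes "is_mono C u" "tgt C u = \<one>\<^sub>C"
  obtains p q where "is_biproduct C \<one>\<^sub>C (src C u) (src C (complement C u)) u (complement C u) p q"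
proof -
  have "is_complement C u (complement C u)"
    unfolding complement_def using ex_complement[OF assms] by (rule someI_ex)
  then show thesis using that assms unfolding is_complement_def by auto
qed

text \<open>Both sides are idempotents with image \<open>u\<close>, and each fixes the other.
  Because scalars commute, the two products agree, so an idempotent is determined by its image and
  any retraction of \<open>u\<close> computes it.\<close>

lemma idem_eq_if_same_image:
  assumes "u \<in> Ar C" "tgt C u = \<one>\<^sub>C"
    "y \<in> Ar C" "src C y = \<one>\<^sub>C" "tgt C y = src C u" "u \<cdot> y \<cdot> u = u"
    "y' \<in> Ar C" "src C y' = \<one>\<^sub>C" "tgt C y' = src C u" "u \<cdot> y' \<cdot> u = u"
  shows "u \<cdot> y = u \<cdot> y'"
proof -
  have "u \<cdot> y = (u \<cdot> y' \<cdot> u) \<cdot> y" using assms by simp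
  also have "\<dots> = (u \<cdot> y') \<cdot> (u \<cdot> y)" using assms(1-5,7-9) by simp
  also have "\<dots> = (u \<cdot> y) \<cdot> (u \<cdot> y')" using assms(1-5,7-9) by (intro scalar_comm) auto
  also have "\<dots> = (u \<cdot> y \<cdot> u) \<cdot> y'" using assms(1-5,7-9) by simp
  also have "\<dots> = u \<cdot> y'" using assms by simp
  finally show ?thesis .
qed

text \<open>Frees \<open>subunit_idem\<close> from the chosen complement: the idempotent may be
  computed from any retraction of \<open>u\<close>. Existence is checked on the projections of the
  biproduct, and the last step changes the retraction.\<close>

lemma subunit_idem_eq:
  assumes "is_mono C u" "tgt C u = \<one>\<^sub>C" and p: "p \<in> Ar C" "src C p = \<one>\<^sub>C" "tgt C p = src C u" "p \<cdot> u = cid C (src C u)"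
  shows "subunit_idem C u = u \<cdot> p"
proof -
  note [simp] = mono_arr[OF assms(1)] assms(2)
  let ?v = "complement C u"
  obtain p' q where bi: "is_biproduct C \<one>\<^sub>C (src C u) (src C ?v) u ?v p' q"
    using complement_is_complement[OF assms(1,2)] .
  note b [simp] = biproductD(2-4,7,8,10-12)[OF bi] and pi = biproductD(13)[OF bi] and qj = biproductD(14)[OF bi]
    and qi = biproductD(15)[OF bi] and pj = biproductD(16)[OF bi] and sum = biproductD(17)[OF bi]
  have bi': "is_biproduct C \<one>\<^sub>C (src C ?v) (src C u) ?v u q p'" by (rule biproduct_sym[OF bi])
  have up: "u \<cdot> p' \<cdot> u = u" by (simp add: pi)
  have upv: "(u \<cdot> p') \<cdot> ?v = czero C (src C ?v) \<one>\<^sub>C" by (simp add: pj)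
  have split: "x = u \<cdot> (p' \<cdot> x) \<boxplus> ?v \<cdot> (q \<cdot> x)" if "x \<in> Ar C" "tgt C x = \<one>\<^sub>C" for x
  proof -
    have "x = (u \<cdot> p' \<boxplus> ?v \<cdot> q) \<cdot> x" unfolding sum using that by simp
    also have "\<dots> = u \<cdot> (p' \<cdot> x) \<boxplus> ?v \<cdot> (q \<cdot> x)" using that by simp
    finally show ?thesis .
  qed
  have split': "x = x \<cdot> (u \<cdot> p') \<boxplus> x \<cdot> (?v \<cdot> q)" if "x \<in> Ar C" "src C x = \<one>\<^sub>C" for x
  proof -
    have "x = x \<cdot> (u \<cdot> p' \<boxplus> ?v \<cdot> q)" unfolding sum using that by simp
    also have "\<dots> = x \<cdot> (u \<cdot> p') \<boxplus> x \<cdot> (?v \<cdot> q)" using that by simp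
    finally show ?thesis .
  qed
  have ker: "is_kernel C (u \<cdot> p') ?v"
  proof (rule kernelI)
    show "is_mono C ?v" by (rule biproduct_mono[OF bi'])
    fix x assume x: "x \<in> Ar C" "tgt C x = src C (u \<cdot> p')" "(u \<cdot> p') \<cdot> x = czero C (src C x) (tgt C (u \<cdot> p'))"
    then have "x = ?v \<cdot> (q \<cdot> x)" using split[of x] by simp
    then show "\<exists>w\<in>Ar C. src C w = src C x \<and> tgt C w = src C ?v \<and> ?v \<cdot> w = x"
      using x by (intro bexI[of _ "q \<cdot> x"]) auto
  qed (use upv in auto)
  have "is_epi C q"
    unfolding is_epi_def
  proof (intro conjI allI ballI impI)
    fix X x y assume "x \<in> Hom C (tgt C q) X" "y \<in> Hom C (tgt C q) X" and xy: "x \<cdot> q = y \<cdot> q"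
    then have [simp]: "x \<in> Ar C" "y \<in> Ar C" "src C x = src C ?v" "src C y = src C ?v" by auto
    have "(x \<cdot> q) \<cdot> ?v = (y \<cdot> q) \<cdot> ?v" using xy by simp
    then show "x = y" by (simp add: qj)
  qed auto
  then have coker: "is_cokernel C (u \<cdot> p') q"
  proof (rule cokernelI)
    have "q \<cdot> (u \<cdot> p') = (q \<cdot> u) \<cdot> p'" by simp
    then show "q \<cdot> (u \<cdot> p') = czero C (src C (u \<cdot> p')) (tgt C q)" by (simp only: qi) simp
    fix x assume x: "x \<in> Ar C" "src C x = tgt C (u \<cdot> p')" "x \<cdot> (u \<cdot> p') = czero C (src C (u \<cdot> p')) (tgt C x)"
    then have "x = (x \<cdot> ?v) \<cdot> q" using split'[of x] by simp
    then show "\<exists>w\<in>Ar C. src C w = tgt C q \<and> tgt C w = tgt C x \<and> w \<cdot> q = x"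
      using x by (intro bexI[of _ "x \<cdot> ?v"]) auto
  qed auto
  have keru: "is_kernel C q u"
  proof (rule kernelI[OF assms(1)])
    fix x assume x: "x \<in> Ar C" "tgt C x = src C q" "q \<cdot> x = czero C (src C x) (tgt C q)"
    then have "x = u \<cdot> (p' \<cdot> x)" using split[of x] by simp
    then show "\<exists>w\<in>Ar C. src C w = src C x \<and> tgt C w = src C u \<and> u \<cdot> w = x"
      using x by (intro bexI[of _ "p' \<cdot> x"]) auto
  qed (auto simp: qi)
  have "(u \<cdot> p') \<cdot> (u \<cdot> p') = (u \<cdot> p' \<cdot> u) \<cdot> p'" by simp
  then have idem: "(u \<cdot> p') \<cdot> (u \<cdot> p') = u \<cdot> p'" by (simp only: up)
  have "subunit_idem C u = u \<cdot> p'"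
    unfolding subunit_idem_def
  proof (rule the_equality)
    show "u \<cdot> p' \<in> \<R> \<and> (u \<cdot> p') \<cdot> (u \<cdot> p') = u \<cdot> p' \<and> is_image C (u \<cdot> p') u \<and> is_kernel C (u \<cdot> p') ?v"
      using idem ker coker keru unfolding is_image_def by auto
    \<comment> \<open>Uniqueness: \<open>e\<close> factors through its image as
      \<open>u \<cdot> y\<close>. Since \<open>1 - e\<close> kills \<open>e\<close>, it factors
      through the cokernel of \<open>e\<close> and so kills \<open>u\<close>. This gives
      \<open>u \<cdot> y \<cdot> u = u\<close>, and \<open>idem_eq_if_same_image\<close>
      applies.\<close>
    fix e assume e: "e \<in> \<R> \<and> e \<cdot> e = e \<and> is_image C e u \<and> is_kernel C e ?v"
    then have [simp]: "e \<in> Ar C" "src C e = \<one>\<^sub>C" "tgt C e = \<one>\<^sub>C" and ee: "e \<cdot> e = e" by auto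
    obtain q' where q': "is_cokernel C e q'" "is_kernel C q' u" using e unfolding is_image_def by blast
    have [simp]: "q' \<in> Ar C" "src C q' = \<one>\<^sub>C" using cokernelD[OF q'(1)] by auto
    obtain y where y [simp]: "y \<in> Ar C" "src C y = \<one>\<^sub>C" "tgt C y = src C u" and uy: "u \<cdot> y = e"
      using kernel_factor[OF q'(2), of e] cokernelD[OF q'(1)] by auto
    have "(cid C \<one>\<^sub>C \<boxplus> neg e) \<cdot> e = czero C \<one>\<^sub>C \<one>\<^sub>C" by (simp add: ee)
    then obtain x where x [simp]: "x \<in> Ar C" "src C x = tgt C q'" "tgt C x = \<one>\<^sub>C" and xq: "x \<cdot> q' = cid C \<one>\<^sub>C \<boxplus> neg e"
      using cokernel_factor[OF q'(1), of "cid C \<one>\<^sub>C \<boxplus> neg e"] by auto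
    have "u \<boxplus> neg (e \<cdot> u) = (x \<cdot> q') \<cdot> u" unfolding xq by simp
    also have "\<dots> = czero C (src C u) \<one>\<^sub>C" using kernelD(4)[OF q'(2)] by simp
    finally have "u = e \<cdot> u" by (rule eq_if_add_neg_zero) auto
    then have "u = (u \<cdot> y) \<cdot> u" by (simp only: uy)
    then have "u \<cdot> y \<cdot> u = u" by simp
    then have "u \<cdot> y = u \<cdot> p'" by (intro idem_eq_if_same_image) (auto simp: up)
    then show "e = u \<cdot> p'" using uy by simp
  qed
  also have "u \<cdot> p' = u \<cdot> p" by (rule idem_eq_if_same_image) (use up p in auto)
  finally show ?thesis .
qed

end

subsection \<open>Support idempotents\<close>

context rigid_abelian_tensor_category
begin

text \<open>Along the splitting of the unit by \<open>k\<close>, the morphism \<alpha> is zero on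
  \<open>k\<close> and a monomorphism on the complement. It is kept general because it serves both
  for adjuncts and, in \<open>supp_idem_multiple\<close>, for a scalar itself.\<close>

lemma kernel_complement:
  assumes "is_kernel C \<alpha> k" "src C \<alpha> = \<one>\<^sub>C"
  obtains u p where "u \<in> Ar C" "p \<in> Ar C" "tgt C u = \<one>\<^sub>C" "src C p = \<one>\<^sub>C" "tgt C p = src C u"
    "p \<cdot> u = cid C (src C u)" "subunit_idem C (complement C k) = u \<cdot> p" "is_mono C (\<alpha> \<cdot> u)" "\<alpha> \<cdot> u \<cdot> p = \<alpha>"
proof -
  note k [simp] = kernelD(1-3)[OF assms(1)] and \<alpha>k = kernelD(4)[OF assms(1)]
  have [simp]: "src C \<alpha> = \<one>\<^sub>C" by (rule assms)
  have km: "is_mono C k" by (rule kernel_mono[OF assms(1)])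
  let ?u = "complement C k"
  obtain p q where bi: "is_biproduct C \<one>\<^sub>C (src C k) (src C ?u) k ?u p q"
    using complement_is_complement[OF km] by auto
  note [simp] = biproductD(2-4,7,8,10-12)[OF bi] and qu = biproductD(14)[OF bi]
    and qk = biproductD(15)[OF bi] and sum = biproductD(17)[OF bi]
  have um: "is_mono C ?u" by (rule biproduct_mono[OF biproduct_sym[OF bi]])
  have "\<alpha> = \<alpha> \<cdot> (k \<cdot> p \<boxplus> ?u \<cdot> q)" unfolding sum by simp
  also have "\<dots> = (\<alpha> \<cdot> k) \<cdot> p \<boxplus> \<alpha> \<cdot> (?u \<cdot> q)" by simp
  also have "\<dots> = \<alpha> \<cdot> (?u \<cdot> q)" unfolding \<alpha>k by simp
  finally have \<alpha>: "\<alpha> \<cdot> ?u \<cdot> q = \<alpha>" ..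
  have mono: "is_mono C (\<alpha> \<cdot> ?u)"
  proof (rule monoI)
    fix x assume x: "x \<in> Ar C" "tgt C x = src C (\<alpha> \<cdot> ?u)" "(\<alpha> \<cdot> ?u) \<cdot> x = czero C (src C x) (tgt C (\<alpha> \<cdot> ?u))"
    then obtain y where y: "y \<in> Ar C" "src C y = src C x" "tgt C y = src C k" "k \<cdot> y = ?u \<cdot> x"
      using kernel_factor[OF assms(1), of "?u \<cdot> x"] by auto
    have "x = (q \<cdot> ?u) \<cdot> x" unfolding qu using x by simp
    also have "\<dots> = (q \<cdot> k) \<cdot> y" using x y by simp
    also have "\<dots> = czero C (src C x) (src C (\<alpha> \<cdot> ?u))" unfolding qk using y by simp
    finally show "x = czero C (src C x) (src C (\<alpha> \<cdot> ?u))" .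
  qed simp
  show thesis
    by (rule that[of ?u q]) (use \<alpha> mono qu subunit_idem_eq[OF um, of q] in auto)
qed

lemma supp_decomp:
  assumes "f \<in> Ar C"
  obtains u p where "u \<in> Ar C" "p \<in> Ar C" "tgt C u = \<one>\<^sub>C" "src C p = \<one>\<^sub>C" "tgt C p = src C u"
    "p \<cdot> u = cid C (src C u)" "supp_idem C f = u \<cdot> p" "is_mono C (adjunct C f \<cdot> u)"
    "adjunct C f \<cdot> u \<cdot> p = adjunct C f"
proof -
  have k: "is_kernel C (adjunct C f) (SOME k. is_kernel C (adjunct C f) k)"
    by (rule someI_ex) (use assms ex_kernel in auto)
  show thesis
    by (rule kernel_complement[OF k adjunct_arr(2)[OF assms]], rule that) (simp_all add: supp_idem_def Supp_def)
qed

lemma supp_idem_scalar [simp]: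
  assumes "f \<in> Ar C"
  shows "supp_idem C f \<in> Ar C" "src C (supp_idem C f) = \<one>\<^sub>C" "tgt C (supp_idem C f) = \<one>\<^sub>C"
    "supp_idem C f \<cdot> supp_idem C f = supp_idem C f"
proof -
  obtain u p where up: "u \<in> Ar C" "p \<in> Ar C" "tgt C u = \<one>\<^sub>C" "src C p = \<one>\<^sub>C" "tgt C p = src C u"
    "p \<cdot> u = cid C (src C u)" "supp_idem C f = u \<cdot> p"
    using supp_decomp[OF assms] by metis
  have "(u \<cdot> p) \<cdot> (u \<cdot> p) = u \<cdot> (p \<cdot> u) \<cdot> p" using up(1-5) by simp
  also have "\<dots> = u \<cdot> p" unfolding up(6) using up(1-5) by simp
  finally have "(u \<cdot> p) \<cdot> (u \<cdot> p) = u \<cdot> p" .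
  then show "supp_idem C f \<in> Ar C" "src C (supp_idem C f) = \<one>\<^sub>C" "tgt C (supp_idem C f) = \<one>\<^sub>C"
    "supp_idem C f \<cdot> supp_idem C f = supp_idem C f"
    unfolding up(7) using up(1-5) by simp_all
qed

text \<open>The adjunct of \<open>z \<star> f\<close> is a monomorphism after
  \<open>p \<cdot> z\<close>, so it vanishes exactly if \<open>p \<cdot> z\<close> does, and
  \<open>u\<close> is split mono. Thus \<open>f\<close> and its support have the same annihilator;
  later arguments about supports use this in place of the definition.\<close>

lemma smul_eq_zero_iff:
  assumes z: "z \<in> \<R>" and f: "f \<in> Ar C"
  shows "z \<star> f = czero C (src C f) (tgt C f) \<longleftrightarrow> z \<cdot> supp_idem C f = czero C \<one>\<^sub>C \<one>\<^sub>C"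
proof -
  obtain u p where up [simp]: "u \<in> Ar C" "p \<in> Ar C" "tgt C u = \<one>\<^sub>C" "src C p = \<one>\<^sub>C" "tgt C p = src C u"
    and pu: "p \<cdot> u = cid C (src C u)" and e: "supp_idem C f = u \<cdot> p" and mono: "is_mono C (adjunct C f \<cdot> u)"
    and adj: "adjunct C f \<cdot> u \<cdot> p = adjunct C f"
    using supp_decomp[OF f] by metis
  have z' [simp]: "z \<in> Ar C" "src C z = \<one>\<^sub>C" "tgt C z = \<one>\<^sub>C" using z by auto
  have ez: "z \<cdot> supp_idem C f = u \<cdot> p \<cdot> z"
    using scalar_comm[OF z, of "supp_idem C f"] f unfolding e by simp
  have pz: "p \<cdot> z = czero C \<one>\<^sub>C (src C u) \<longleftrightarrow> u \<cdot> p \<cdot> z = czero C \<one>\<^sub>C \<one>\<^sub>C"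
  proof
    assume "u \<cdot> p \<cdot> z = czero C \<one>\<^sub>C \<one>\<^sub>C"
    then have "p \<cdot> (u \<cdot> p \<cdot> z) = czero C \<one>\<^sub>C (src C u)" by simp
    moreover have "p \<cdot> (u \<cdot> p \<cdot> z) = cid C (src C u) \<cdot> (p \<cdot> z)" by (rule comp_pull[OF pu]) auto
    ultimately show "p \<cdot> z = czero C \<one>\<^sub>C (src C u)" by simp
  qed simp
  have "z \<star> f = czero C (src C f) (tgt C f) \<longleftrightarrow> adjunct C (z \<star> f) = czero C \<one>\<^sub>C (dual C (src C f) \<otimes>\<^sub>o tgt C f)"
    using adjunct_eq_zeroD[of "z \<star> f"] z f by auto
  also have "adjunct C (z \<star> f) = (adjunct C f \<cdot> u \<cdot> p) \<cdot> z"
    unfolding adj using z f by (rule adjunct_smul)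
  also have "\<dots> = (adjunct C f \<cdot> u) \<cdot> (p \<cdot> z)" using f by simp
  also have "(adjunct C f \<cdot> u) \<cdot> (p \<cdot> z) = czero C \<one>\<^sub>C (dual C (src C f) \<otimes>\<^sub>o tgt C f) \<longleftrightarrow> p \<cdot> z = czero C \<one>\<^sub>C (src C u)"
  proof
    assume *: "(adjunct C f \<cdot> u) \<cdot> (p \<cdot> z) = czero C \<one>\<^sub>C (dual C (src C f) \<otimes>\<^sub>o tgt C f)"
    show "p \<cdot> z = czero C \<one>\<^sub>C (src C u)"
      by (rule monoD[OF mono, rotated -1]) (use * f in auto)
  qed (use f in simp)
  finally show ?thesis unfolding pz ez .
qed

definition compl :: "'b \<Rightarrow> 'b" where
  "compl e = cid C \<one>\<^sub>C \<boxplus> neg e"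

lemma compl:
  assumes "e \<in> \<R>" "e \<cdot> e = e"
  shows "compl e \<in> \<R>" "e \<boxplus> compl e = cid C \<one>\<^sub>C" "compl e \<cdot> e = czero C \<one>\<^sub>C \<one>\<^sub>C" "compl e \<cdot> compl e = compl e"
proof -
  have [simp]: "e \<in> Ar C" "src C e = \<one>\<^sub>C" "tgt C e = \<one>\<^sub>C" using assms by auto
  show "compl e \<in> \<R>" by (simp add: compl_def)
  have "e \<boxplus> compl e = (cid C \<one>\<^sub>C \<boxplus> neg e) \<boxplus> e" unfolding compl_def by (rule add_comm) auto
  then show "e \<boxplus> compl e = cid C \<one>\<^sub>C" by simp
  show 1: "compl e \<cdot> e = czero C \<one>\<^sub>C \<one>\<^sub>C" by (simp add: compl_def assms)
  have "compl e \<cdot> compl e = compl e \<boxplus> neg (compl e \<cdot> e)"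
    by (subst (2) compl_def) (simp add: compl_def assms)
  then show "compl e \<cdot> compl e = compl e" unfolding 1 by (simp add: compl_def)
qed

lemma smul_eq_self_if_annihilated:
  assumes "e \<in> \<R>" "m \<in> \<R>" "e \<boxplus> m = cid C \<one>\<^sub>C" "f \<in> Ar C" "m \<star> f = czero C (src C f) (tgt C f)"
  shows "e \<star> f = f"
proof -
  have "f = (e \<boxplus> m) \<star> f" unfolding assms(3) using assms by simp
  also have "\<dots> = e \<star> f \<boxplus> m \<star> f" using assms by (intro add_smul) auto
  also have "\<dots> = e \<star> f" unfolding assms(5) using assms by simp
  finally show ?thesis ..
qed

lemma supp_smul:
  assumes "f \<in> Ar C"
  shows "supp_idem C f \<star> f = f"
proof (rule smul_eq_self_if_annihilated)
  let ?e = "supp_idem C f"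
  note c = compl[of ?e]
  show "compl ?e \<in> \<R>" "?e \<boxplus> compl ?e = cid C \<one>\<^sub>C" using c assms by auto
  show "compl ?e \<star> f = czero C (src C f) (tgt C f)"
    using smul_eq_zero_iff[of "compl ?e" f] c assms by auto
qed (use assms in auto)

text \<open>Minimality of the support among idempotents fixing \<open>f\<close>: what annihilates
  \<open>f\<close> annihilates the support, so \<open>e\<close> fixes the support too.\<close>

lemma supp_factor_if_annihilated:
  assumes "e \<in> \<R>" "m \<in> \<R>" "e \<boxplus> m = cid C \<one>\<^sub>C" "f \<in> Ar C" "m \<star> f = czero C (src C f) (tgt C f)"
  shows "e \<cdot> supp_idem C f = supp_idem C f"
proof -
  have "m \<star> supp_idem C f = czero C \<one>\<^sub>C \<one>\<^sub>C"
    using smul_eq_zero_iff[of m f] assms smul_tunit[of m "supp_idem C f"] by simp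
  then have "e \<star> supp_idem C f = supp_idem C f"
    using assms by (intro smul_eq_self_if_annihilated[of e m]) auto
  then show ?thesis using smul_tunit[of e "supp_idem C f"] assms by simp
qed

lemma supp_factor_if_smul_eq_self:
  assumes "e \<in> \<R>" "e \<cdot> e = e" "f \<in> Ar C" "e \<star> f = f"
  shows "e \<cdot> supp_idem C f = supp_idem C f"
proof (rule supp_factor_if_annihilated)
  note c = compl[OF assms(1,2)]
  show "compl e \<in> \<R>" "e \<boxplus> compl e = cid C \<one>\<^sub>C" by (rule c)+
  have "compl e \<star> (e \<star> f) = czero C (src C f) (tgt C f)"
    using c assms(1,3) by simp
  then show "compl e \<star> f = czero C (src C f) (tgt C f)" using assms by simp
qed (use assms in auto)

text \<open>\<open>Z(\<A>)\<close> is von Neumann regular.\<close>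

lemma supp_idem_multiple:
  assumes "z \<in> \<R>"
  obtains w where "w \<in> \<R>" "supp_idem C z = w \<cdot> z"
proof -
  have [simp]: "z \<in> Ar C" "src C z = \<one>\<^sub>C" "tgt C z = \<one>\<^sub>C" using assms by auto
  obtain k where "is_kernel C z k" using ex_kernel[of z] by auto
  then obtain u p where up [simp]: "u \<in> Ar C" "p \<in> Ar C" "tgt C u = \<one>\<^sub>C" "src C p = \<one>\<^sub>C" "tgt C p = src C u"
    and pu: "p \<cdot> u = cid C (src C u)" and mono: "is_mono C (z \<cdot> u)" and z: "z \<cdot> u \<cdot> p = z"
    using kernel_complement[of z k] by (metis \<open>src C z = \<one>\<^sub>C\<close>)
  \<comment> \<open>The restriction of \<open>z\<close> to the complement of its kernel is again a
    subobject of the unit, so it splits as well. The retraction \<open>r\<close> inverts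
    \<open>z\<close> there and exhibits the idempotent as the multiple \<open>u r z\<close>.\<close>
  obtain r where r [simp]: "r \<in> Ar C" "src C r = \<one>\<^sub>C" "tgt C r = src C u" and rzu: "r \<cdot> (z \<cdot> u) = cid C (src C u)"
    using subunit_retraction[OF mono] by auto
  let ?e = "u \<cdot> p" and ?s = "supp_idem C z"
  have "?e = u \<cdot> (r \<cdot> (z \<cdot> u)) \<cdot> p" unfolding rzu by simp
  also have "\<dots> = (u \<cdot> r) \<cdot> (z \<cdot> u \<cdot> p)" by simp
  also have "\<dots> = (u \<cdot> r) \<cdot> z" unfolding z ..
  finally have e: "?e = (u \<cdot> r) \<cdot> z" .
  have "?e \<cdot> ?e = u \<cdot> (p \<cdot> u) \<cdot> p" by simp
  also have "\<dots> = ?e" unfolding pu by simp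
  finally have ee: "?e \<cdot> ?e = ?e" .
  have "?e \<star> z = z" using smul_from_tunit[of ?e z] z by simp
  \<comment> \<open>\<open>supp_idem C z\<close> is built from the adjunct of \<open>z\<close>,
    whereas \<open>?e\<close> comes from the kernel of \<open>z\<close> itself. Minimality of the
    support compares them, and one absorption is enough to make the support a multiple of
    \<open>z\<close>.\<close>
  then have "?s = ?e \<cdot> ?s" using supp_factor_if_smul_eq_self[of ?e z] ee by simp
  also have "\<dots> = ?s \<cdot> ?e" by (rule scalar_comm) auto
  also have "\<dots> = (?s \<cdot> (u \<cdot> r)) \<cdot> z" unfolding e by simp
  finally show thesis by (intro that[of "?s \<cdot> (u \<cdot> r)"]) auto
qed

text \<open>The tensor product of the monomorphisms \<open>Supp f \<rightarrow> A' \<otimes> B\<close> and \<open>Supp g \<rightarrow> D' \<otimes> E\<close> is a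
  monomorphism factoring through \<open>f \<otimes> g\<close>.\<close>

lemma supp_mult_zero_if_tens_zero:
  assumes [simp]: "f \<in> Ar C" "g \<in> Ar C" and fg: "f \<otimes>\<^sub>m g = czero C (src C f \<otimes>\<^sub>o src C g) (tgt C f \<otimes>\<^sub>o tgt C g)"
  shows "supp_idem C f \<cdot> supp_idem C g = czero C \<one>\<^sub>C \<one>\<^sub>C"
proof -
  obtain u p where up [simp]: "u \<in> Ar C" "p \<in> Ar C" "tgt C u = \<one>\<^sub>C" "src C p = \<one>\<^sub>C" "tgt C p = src C u"
    and e: "supp_idem C f = u \<cdot> p" and mono: "is_mono C (adjunct C f \<cdot> u)"
    using supp_decomp[OF assms(1)] by metis
  obtain v q where vq [simp]: "v \<in> Ar C" "q \<in> Ar C" "tgt C v = \<one>\<^sub>C" "src C q = \<one>\<^sub>C" "tgt C q = src C v"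
    and d: "supp_idem C g = v \<cdot> q" and mono': "is_mono C (adjunct C g \<cdot> v)"
    using supp_decomp[OF assms(2)] by metis
  let ?X = "dual C (src C f)" and ?Y = "dual C (src C g)"
  \<comment> \<open>The dual objects are inserted one factor at a time: braid, tensor on the left
    and reassociate, then repeat for the other factor.\<close>
  have 1: "(cid C ?Y \<otimes>\<^sub>m g) \<otimes>\<^sub>m f = czero C ((?Y \<otimes>\<^sub>o src C g) \<otimes>\<^sub>o src C f) ((?Y \<otimes>\<^sub>o tgt C g) \<otimes>\<^sub>o tgt C f)"
    using tens_zero_assoc[OF tens_zero_braid[OF fg], of "cid C ?Y"] by simp
  have 2: "(cid C ?X \<otimes>\<^sub>m f) \<otimes>\<^sub>m (cid C ?Y \<otimes>\<^sub>m g) =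
    czero C ((?X \<otimes>\<^sub>o src C f) \<otimes>\<^sub>o (?Y \<otimes>\<^sub>o src C g)) ((?X \<otimes>\<^sub>o tgt C f) \<otimes>\<^sub>o (?Y \<otimes>\<^sub>o tgt C g))"
    using tens_zero_assoc[OF tens_zero_braid[of "cid C ?Y \<otimes>\<^sub>m g" f], of "cid C ?X"] 1 by simp
  have "adjunct C f \<otimes>\<^sub>m adjunct C g = ((cid C ?X \<otimes>\<^sub>m f) \<otimes>\<^sub>m (cid C ?Y \<otimes>\<^sub>m g)) \<cdot> (coev C (src C f) \<otimes>\<^sub>m coev C (src C g))"
    by (simp add: adjunct_def)
  also have "\<dots> = czero C (\<one>\<^sub>C \<otimes>\<^sub>o \<one>\<^sub>C) ((?X \<otimes>\<^sub>o tgt C f) \<otimes>\<^sub>o (?Y \<otimes>\<^sub>o tgt C g))"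
    unfolding 2 by simp
  finally have adj: "adjunct C f \<otimes>\<^sub>m adjunct C g = czero C (\<one>\<^sub>C \<otimes>\<^sub>o \<one>\<^sub>C) ((?X \<otimes>\<^sub>o tgt C f) \<otimes>\<^sub>o (?Y \<otimes>\<^sub>o tgt C g))" .
  have "(adjunct C f \<cdot> u) \<otimes>\<^sub>m (adjunct C g \<cdot> v) = (adjunct C f \<otimes>\<^sub>m adjunct C g) \<cdot> (u \<otimes>\<^sub>m v)"
    by simp
  also have "\<dots> = czero C (src C u \<otimes>\<^sub>o src C v) ((?X \<otimes>\<^sub>o tgt C f) \<otimes>\<^sub>o (?Y \<otimes>\<^sub>o tgt C g))"
    unfolding adj by simp
  finally have zero: "(adjunct C f \<cdot> u) \<otimes>\<^sub>m (adjunct C g \<cdot> v) = czero C (src C u \<otimes>\<^sub>o src C v) ((?X \<otimes>\<^sub>o tgt C f) \<otimes>\<^sub>o (?Y \<otimes>\<^sub>o tgt C g))" .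
  \<comment> \<open>A zero monomorphism has a zero source, so the tensor product of the two supports
    is a zero object and the product of the idempotents factors through it.\<close>
  have "cid C (src C u \<otimes>\<^sub>o src C v) = czero C (src C u \<otimes>\<^sub>o src C v) (src C u \<otimes>\<^sub>o src C v)"
    by (rule monoD[OF mono_tens[OF mono mono'], rotated -1]) (auto simp: zero)
  then have "(u \<otimes>\<^sub>m v) \<cdot> cid C (src C u \<otimes>\<^sub>o src C v) \<cdot> (p \<otimes>\<^sub>m q) = czero C (\<one>\<^sub>C \<otimes>\<^sub>o \<one>\<^sub>C) (\<one>\<^sub>C \<otimes>\<^sub>o \<one>\<^sub>C)"
    by simp
  then have "supp_idem C f \<otimes>\<^sub>m supp_idem C g = czero C (\<one>\<^sub>C \<otimes>\<^sub>o \<one>\<^sub>C) (\<one>\<^sub>C \<otimes>\<^sub>o \<one>\<^sub>C)"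
    by (simp add: e d)
  then have "supp_idem C f \<star> supp_idem C g = czero C \<one>\<^sub>C \<one>\<^sub>C"
    by (simp add: scalar_def)
  then show ?thesis using smul_tunit[of "supp_idem C f" "supp_idem C g"] by simp
qed

end

subsection \<open>Congruence modulo an ideal of \<open>Z(\<A>)\<close>\<close>

context rigid_abelian_tensor_category
begin

text \<open>The complements \<open>1 - e\<close> of idempotents \<open>e\<close> in
  \<open>I\<close>, stored with the equation \<open>e \<boxplus> m = 1\<close> because later
  splittings use both summands. Each \<open>m\<close> singles out a direct factor on which
  \<open>e\<close> becomes zero.\<close>

definition coideal_idems :: "'b set \<Rightarrow> 'b set" where
  "coideal_idems I = {m \<in> \<R>. m \<cdot> m = m \<and> (\<exists>e \<in> I. e \<boxplus> m = cid C \<one>\<^sub>C)}"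

text \<open>This is congruence modulo \<open>I_oplus\<close>, see
  \<open>ideal_rel_oplus_iff\<close>. The form with a witness \<open>m\<close> gives an equation in
  \<open>C\<close> that can be composed and tensored at once.\<close>

definition cong_mod :: "'b set \<Rightarrow> 'b \<Rightarrow> 'b \<Rightarrow> bool" where
  "cong_mod I f g \<longleftrightarrow> f \<in> Ar C \<and> g \<in> Ar C \<and> src C f = src C g \<and> tgt C f = tgt C g \<and>
    (\<exists>m \<in> coideal_idems I. m \<star> f = m \<star> g)"

lemma coideal_idems_scalar:
  assumes "m \<in> coideal_idems I"
  shows "m \<in> Ar C" "src C m = \<one>\<^sub>C" "tgt C m = \<one>\<^sub>C" "m \<cdot> m = m"
  using assms unfolding coideal_idems_def by auto

lemma cong_mod_arr:
  assumes "cong_mod I f g"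
  shows "f \<in> Ar C" "g \<in> Ar C" "src C f = src C g" "tgt C f = tgt C g"
  using assms unfolding cong_mod_def by auto

lemma cong_mod_refl [simp]: "ideal I (End_unit C) \<Longrightarrow> f \<in> Ar C \<Longrightarrow> cong_mod I f f"
proof -
  assume I: "ideal I (End_unit C)" and f: "f \<in> Ar C"
  have "cid C \<one>\<^sub>C \<in> coideal_idems I"
    using ideal_End_unitD(2)[OF I] unfolding coideal_idems_def by (auto intro!: bexI[of _ "czero C \<one>\<^sub>C \<one>\<^sub>C"])
  then show "cong_mod I f f" using f unfolding cong_mod_def by auto
qed

text \<open>The complement is \<open>1 - m n = (1 - m) + m (1 - n)\<close>, which lies in
  \<open>I\<close>. Closure under products is what makes the congruence transitive and compatible
  with two-argument operations.\<close>

lemma coideal_idems_mult: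
  assumes I: "ideal I (End_unit C)" and "m \<in> coideal_idems I" "n \<in> coideal_idems I"
  shows "m \<cdot> n \<in> coideal_idems I"
proof -
  note [simp] = coideal_idems_scalar(1-3)[OF assms(2)] coideal_idems_scalar(1-3)[OF assms(3)]
  note idem = coideal_idems_scalar(4)[OF assms(2)] coideal_idems_scalar(4)[OF assms(3)]
  obtain e d where e: "e \<in> I" "e \<boxplus> m = cid C \<one>\<^sub>C" and d: "d \<in> I" "d \<boxplus> n = cid C \<one>\<^sub>C"
    using assms unfolding coideal_idems_def by auto
  have [simp]: "e \<in> Ar C" "src C e = \<one>\<^sub>C" "tgt C e = \<one>\<^sub>C" "d \<in> Ar C" "src C d = \<one>\<^sub>C" "tgt C d = \<one>\<^sub>C"
    using ideal_End_unitD(1)[OF I e(1)] ideal_End_unitD(1)[OF I d(1)] by auto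
  have "(m \<cdot> n) \<cdot> (m \<cdot> n) = m \<cdot> (n \<cdot> m) \<cdot> n" by simp
  also have "n \<cdot> m = m \<cdot> n" by (rule scalar_comm) auto
  also have "m \<cdot> (m \<cdot> n) \<cdot> n = (m \<cdot> m) \<cdot> (n \<cdot> n)" by simp
  finally have mn: "(m \<cdot> n) \<cdot> (m \<cdot> n) = m \<cdot> n" by (simp only: idem)
  have "(e \<boxplus> m \<cdot> d) \<boxplus> m \<cdot> n = e \<boxplus> m \<cdot> (d \<boxplus> n)" by simp
  also have "\<dots> = cid C \<one>\<^sub>C" unfolding d by (simp add: e)
  finally have "(e \<boxplus> m \<cdot> d) \<boxplus> m \<cdot> n = cid C \<one>\<^sub>C" .
  moreover have "e \<boxplus> m \<cdot> d \<in> I"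
    using e d by (intro ideal_End_unitD(3)[OF I] ideal_End_unitD(5)[OF I]) auto
  ultimately show ?thesis
    unfolding coideal_idems_def using mn by (intro CollectI conjI bexI[of _ "e \<boxplus> m \<cdot> d"]) auto
qed

lemma smul_eq_mult_coideal:
  assumes I: "ideal I (End_unit C)" and "m \<in> coideal_idems I" "n \<in> coideal_idems I" "f \<in> Ar C" "g \<in> Ar C"
    and "m \<star> f = m \<star> g"
  shows "(m \<cdot> n) \<star> f = (m \<cdot> n) \<star> g" "(n \<cdot> m) \<star> f = (n \<cdot> m) \<star> g"
proof -
  note [simp] = coideal_idems_scalar(1-3)[OF assms(2)] coideal_idems_scalar(1-3)[OF assms(3)] assms(4,5)
  have 1: "(n \<cdot> m) \<star> x = n \<star> (m \<star> x)" if "x \<in> Ar C" for x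
    by (rule smul_smul[symmetric]) (use that in auto)
  show 2: "(n \<cdot> m) \<star> f = (n \<cdot> m) \<star> g" by (simp only: 1 assms)
  show "(m \<cdot> n) \<star> f = (m \<cdot> n) \<star> g"
    using 2 scalar_comm[of m n] by simp
qed

lemma coideal_idems_common:
  assumes I: "ideal I (End_unit C)" and "cong_mod I f g" "cong_mod I f' g'"
  obtains m where "m \<in> coideal_idems I" "m \<star> f = m \<star> g" "m \<star> f' = m \<star> g'"
proof -
  obtain m n where mn: "m \<in> coideal_idems I" "m \<star> f = m \<star> g" "n \<in> coideal_idems I" "n \<star> f' = n \<star> g'"
    using assms unfolding cong_mod_def by auto
  note a = cong_mod_arr[OF assms(2)] cong_mod_arr[OF assms(3)]
  show thesis
    by (rule that[of "m \<cdot> n"])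
      (use mn coideal_idems_mult[OF I] smul_eq_mult_coideal(1)[OF I mn(1,3) a(1,2)] smul_eq_mult_coideal(2)[OF I mn(3,1) a(5,6)] in auto)
qed

lemma cong_mod_sym: "cong_mod I f g \<Longrightarrow> cong_mod I g f"
  unfolding cong_mod_def by metis

lemma cong_mod_trans:
  assumes I: "ideal I (End_unit C)" and "cong_mod I f g" "cong_mod I g h"
  shows "cong_mod I f h"
  using coideal_idems_common[OF assms] cong_mod_arr[OF assms(2)] cong_mod_arr[OF assms(3)]
  unfolding cong_mod_def by metis

lemma cong_mod_add:
  assumes I: "ideal I (End_unit C)" and "cong_mod I f g" "cong_mod I f' g'" "src C f = src C f'" "tgt C f = tgt C f'"
  shows "cong_mod I (f \<boxplus> f') (g \<boxplus> g')"
proof -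
  note a = cong_mod_arr[OF assms(2)] cong_mod_arr[OF assms(3)]
  obtain m where m: "m \<in> coideal_idems I" "m \<star> f = m \<star> g" "m \<star> f' = m \<star> g'"
    using coideal_idems_common[OF assms(1-3)] .
  have "m \<star> (f \<boxplus> f') = m \<star> f \<boxplus> m \<star> f'" "m \<star> (g \<boxplus> g') = m \<star> g \<boxplus> m \<star> g'"
    using a assms(4,5) coideal_idems_scalar[OF m(1)] by (auto intro!: smul_add)
  then have "m \<star> (f \<boxplus> f') = m \<star> (g \<boxplus> g')" by (simp only: m)
  then show ?thesis using a assms(4,5) m(1) unfolding cong_mod_def by auto
qed

lemma cong_mod_comp:
  assumes I: "ideal I (End_unit C)" and "cong_mod I f g" "cong_mod I f' g'" "src C f' = tgt C f"
  shows "cong_mod I (f' \<cdot> f) (g' \<cdot> g)"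
proof -
  note a = cong_mod_arr[OF assms(2)] cong_mod_arr[OF assms(3)]
  obtain m where m: "m \<in> coideal_idems I" "m \<star> f = m \<star> g" "m \<star> f' = m \<star> g'"
    using coideal_idems_common[OF assms(1-3)] .
  note [simp] = coideal_idems_scalar(1-3)[OF m(1)]
  \<comment> \<open>Idempotency of \<open>m\<close> allows one copy of it to be placed on each
    factor.\<close>
  have 1: "m \<star> (y \<cdot> x) = (m \<star> y) \<cdot> (m \<star> x)" if "x \<in> Ar C" "y \<in> Ar C" "src C y = tgt C x" for x y
    using that by (simp add: smul_comp coideal_idems_scalar(4)[OF m(1)])
  have "m \<star> (f' \<cdot> f) = m \<star> (g' \<cdot> g)" using a assms(4) by (simp add: 1 m)
  then show ?thesis using a assms(4) m(1) unfolding cong_mod_def by auto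
qed

lemma cong_mod_tens:
  assumes I: "ideal I (End_unit C)" and "cong_mod I f g" "cong_mod I f' g'"
  shows "cong_mod I (f' \<otimes>\<^sub>m f) (g' \<otimes>\<^sub>m g)"
proof -
  note a = cong_mod_arr[OF assms(2)] cong_mod_arr[OF assms(3)]
  obtain m where m: "m \<in> coideal_idems I" "m \<star> f = m \<star> g" "m \<star> f' = m \<star> g'"
    using coideal_idems_common[OF assms(1-3)] .
  note [simp] = coideal_idems_scalar(1-3)[OF m(1)]
  have 1: "m \<star> (y \<otimes>\<^sub>m x) = (m \<star> y) \<otimes>\<^sub>m (m \<star> x)" if "x \<in> Ar C" "y \<in> Ar C" for x y
    using that by (simp add: smul_tens coideal_idems_scalar(4)[OF m(1)])
  have "m \<star> (f' \<otimes>\<^sub>m f) = m \<star> (g' \<otimes>\<^sub>m g)" using a by (simp add: 1 m)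
  then show ?thesis using a m(1) unfolding cong_mod_def by auto
qed

lemma cong_mod_smul:
  assumes I: "ideal I (End_unit C)" and "m \<in> coideal_idems I" "f \<in> Ar C"
  shows "cong_mod I (m \<star> f) f"
  using assms coideal_idems_scalar[OF assms(2)] unfolding cong_mod_def by (auto intro!: bexI[of _ m])

text \<open>If \<open>m\<close> kills \<open>f\<close>, then minimality makes the support a multiple
  of \<open>1 - m\<close>, which is in \<open>I\<close>. Conversely the complement of the support is
  itself an admissible \<open>m\<close>.\<close>

lemma cong_mod_zero_iff:
  assumes I: "ideal I (End_unit C)" and f: "f \<in> Ar C"
  shows "cong_mod I f (czero C (src C f) (tgt C f)) \<longleftrightarrow> supp_idem C f \<in> I"
proof
  assume "cong_mod I f (czero C (src C f) (tgt C f))"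
  then obtain m where m: "m \<in> coideal_idems I" "m \<star> f = m \<star> czero C (src C f) (tgt C f)"
    unfolding cong_mod_def by auto
  note [simp] = coideal_idems_scalar(1-3)[OF m(1)]
  obtain e where e: "e \<in> I" "e \<boxplus> m = cid C \<one>\<^sub>C" using m unfolding coideal_idems_def by auto
  have "e \<cdot> supp_idem C f = supp_idem C f"
    using m(2) ideal_End_unitD(1)[OF I e(1)] e f by (intro supp_factor_if_annihilated[of e m]) auto
  then show "supp_idem C f \<in> I" using ideal_End_unitD(4)[OF I e(1), of "supp_idem C f"] f by simp
next
  assume s: "supp_idem C f \<in> I"
  note c = compl[of "supp_idem C f"]
  have "compl (supp_idem C f) \<in> coideal_idems I"
    unfolding coideal_idems_def using s c f by auto
  moreover have "compl (supp_idem C f) \<star> f = czero C (src C f) (tgt C f)"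
    using smul_eq_zero_iff[of "compl (supp_idem C f)" f] c f by auto
  ultimately show "cong_mod I f (czero C (src C f) (tgt C f))"
    using f coideal_idems_scalar[of "compl (supp_idem C f)" I] unfolding cong_mod_def
    by (auto intro!: bexI[of _ "compl (supp_idem C f)"])
qed

text \<open>Adding \<open>- f\<close> and \<open>- g\<close> to both sides of the congruence
  exchanges the two morphisms, and symmetry restores the order.\<close>

lemma cong_mod_neg:
  assumes I: "ideal I (End_unit C)" and "cong_mod I f g"
  shows "cong_mod I (neg f) (neg g)"
proof -
  note a = cong_mod_arr[OF assms(2)]
  have "cong_mod I (neg g \<boxplus> (f \<boxplus> neg f)) (neg g \<boxplus> (g \<boxplus> neg f))"
    by (intro cong_mod_add cong_mod_refl assms) (use a in auto)
  moreover have "neg g \<boxplus> (g \<boxplus> neg f) = neg f"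
  proof -
    have "neg g \<boxplus> (g \<boxplus> neg f) = (neg g \<boxplus> g) \<boxplus> neg f"
      by (rule add_assoc[symmetric]) (use a in auto)
    then show ?thesis using a by simp
  qed
  moreover have "neg g \<boxplus> (f \<boxplus> neg f) = neg g" using a by simp
  ultimately show ?thesis using cong_mod_sym by simp
qed

lemma cong_mod_iff_diff:
  assumes I: "ideal I (End_unit C)" and "f \<in> Ar C" "g \<in> Ar C" "src C f = src C g" "tgt C f = tgt C g"
  shows "cong_mod I f g \<longleftrightarrow> cong_mod I (f \<boxplus> neg g) (czero C (src C g) (tgt C g))"
proof
  assume "cong_mod I f g"
  then have "cong_mod I (f \<boxplus> neg g) (g \<boxplus> neg g)"
    by (intro cong_mod_add cong_mod_refl assms) (use assms in auto)
  then show "cong_mod I (f \<boxplus> neg g) (czero C (src C g) (tgt C g))" using assms by simp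
next
  assume "cong_mod I (f \<boxplus> neg g) (czero C (src C g) (tgt C g))"
  then have "cong_mod I ((f \<boxplus> neg g) \<boxplus> g) (czero C (src C g) (tgt C g) \<boxplus> g)"
    by (intro cong_mod_add cong_mod_refl assms) (use assms in auto)
  then show "cong_mod I f g" using assms by simp
qed

lemma tensor_ideal_supp:
  assumes I: "ideal I (End_unit C)"
  shows "tensor_ideal C {f \<in> Ar C. supp_idem C f \<in> I}"
proof -
  define Z where "Z = {f \<in> Ar C. supp_idem C f \<in> I}"
  have Z_arr: "f \<in> Ar C" and Z_cong: "cong_mod I f (czero C (src C f) (tgt C f))" if "f \<in> Z" for f
    using that cong_mod_zero_iff[OF I, of f] by (auto simp: Z_def)
  have Z_I: "f \<in> Z" if "cong_mod I f (czero C A B)" "A \<in> Ob C" "B \<in> Ob C" for f A B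
    using that cong_mod_zero_iff[OF I, of f] cong_mod_arr[OF that(1)] by (auto simp: Z_def)
  have "\<And>A B. \<lbrakk>A \<in> Ob C; B \<in> Ob C\<rbrakk> \<Longrightarrow> czero C A B \<in> Z"
    using Z_I[OF cong_mod_refl[OF I]] by simp
  moreover have "f \<boxplus> g \<in> Z" if "f \<in> Z" "g \<in> Z" "src C f = src C g" "tgt C f = tgt C g" for f g
    using cong_mod_add[OF I Z_cong[OF that(1)] Z_cong[OF that(2)] that(3,4)] Z_arr[OF that(1)] Z_arr[OF that(2)] that(3,4)
    by (intro Z_I[of _ "src C g" "tgt C g"]) auto
  moreover have "neg f \<in> Z" if "f \<in> Z" for f
    using cong_mod_neg[OF I Z_cong[OF that]] Z_arr[OF that] by (intro Z_I[of _ "src C f" "tgt C f"]) auto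
  moreover have "g \<cdot> f \<in> Z" if "f \<in> Z" "g \<in> Ar C" "src C g = tgt C f" for f g
    using cong_mod_comp[OF I Z_cong[OF that(1)] cong_mod_refl[OF I that(2)] that(3)] Z_arr[OF that(1)] that(2,3)
    by (intro Z_I[of _ "src C f" "tgt C g"]) auto
  moreover have "f \<cdot> g \<in> Z" if "f \<in> Z" "g \<in> Ar C" "tgt C g = src C f" for f g
    using cong_mod_comp[OF I cong_mod_refl[OF I that(2)] Z_cong[OF that(1)] that(3)[symmetric]] Z_arr[OF that(1)] that(2,3)
    by (intro Z_I[of _ "src C g" "tgt C f"]) auto
  moreover have "f \<otimes>\<^sub>m g \<in> Z" if "f \<in> Z" "g \<in> Ar C" for f g
    using cong_mod_tens[OF I cong_mod_refl[OF I that(2)] Z_cong[OF that(1)]] Z_arr[OF that(1)] that(2)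
    by (intro Z_I[of _ "src C f \<otimes>\<^sub>o src C g" "tgt C f \<otimes>\<^sub>o tgt C g"]) auto
  moreover have "g \<otimes>\<^sub>m f \<in> Z" if "f \<in> Z" "g \<in> Ar C" for f g
    using cong_mod_tens[OF I Z_cong[OF that(1)] cong_mod_refl[OF I that(2)]] Z_arr[OF that(1)] that(2)
    by (intro Z_I[of _ "src C g \<otimes>\<^sub>o src C f" "tgt C g \<otimes>\<^sub>o tgt C f"]) auto
  ultimately show ?thesis unfolding Z_def[symmetric]
    by (intro tensor_idealI subsetI) (simp_all add: Z_arr)
qed

subsection \<open>Fractions\<close>

lemma serre_ideal_iff:
  assumes "ideal I (End_unit C)"
  shows "A \<in> serre_ideal C I \<longleftrightarrow> A \<in> Ob C \<and> cong_mod I (cid C A) (czero C A A)"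
  using cong_mod_zero_iff[OF assms, of "cid C A"] unfolding serre_ideal_def by auto

text \<open>The image of the idempotent \<open>m\<close> on \<open>A\<close> is obtained as the
  kernel of the complementary \<open>e\<close>, so that both maps of the splitting are fixed by
  \<open>m\<close>.\<close>

lemma idem_split:
  assumes "e \<in> \<R>" "m \<in> \<R>" "e \<boxplus> m = cid C \<one>\<^sub>C" "m \<cdot> m = m" "A \<in> Ob C"
  obtains i p where "i \<in> Ar C" "p \<in> Ar C" "tgt C i = A" "src C p = A" "tgt C p = src C i"
    "p \<cdot> i = cid C (src C i)" "i \<cdot> p = m \<star> cid C A" "m \<star> i = i" "m \<star> p = p"
proof -
  have [simp]: "e \<in> Ar C" "src C e = \<one>\<^sub>C" "tgt C e = \<one>\<^sub>C" "m \<in> Ar C" "src C m = \<one>\<^sub>C" "tgt C m = \<one>\<^sub>C" "A \<in> Ob C"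
    using assms by auto
  have "(e \<boxplus> m) \<cdot> m = e \<cdot> m \<boxplus> m" by (simp add: assms(4))
  then have "m = e \<cdot> m \<boxplus> m" unfolding assms(3) by simp
  also have "\<dots> = m \<boxplus> e \<cdot> m" by (rule add_comm) auto
  finally have "m \<boxplus> e \<cdot> m = m \<boxplus> czero C \<one>\<^sub>C \<one>\<^sub>C" by simp
  then have em: "e \<cdot> m = czero C \<one>\<^sub>C \<one>\<^sub>C" by (rule add_left_cancel) auto
  then have me: "m \<cdot> e = czero C \<one>\<^sub>C \<one>\<^sub>C" using scalar_comm[of m e] by simp
  obtain i where i: "is_kernel C (e \<star> cid C A) i" using ex_kernel[of "e \<star> cid C A"] by auto
  have [simp]: "i \<in> Ar C" "tgt C i = A" and ei: "e \<star> i = czero C (src C i) A" using kernelD[OF i] by (auto simp: smul_comp)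
  have "(e \<boxplus> m) \<star> i = e \<star> i \<boxplus> m \<star> i" by (rule add_smul) auto
  then have mi: "m \<star> i = i" unfolding assms(3) ei by simp
  obtain p where [simp]: "p \<in> Ar C" "src C p = A" "tgt C p = src C i" and ip: "i \<cdot> p = m \<star> cid C A"
    using kernel_factor[OF i, of "m \<star> cid C A"] by (auto simp: smul_comp em me)
  have "i \<cdot> (p \<cdot> i) = (i \<cdot> p) \<cdot> i" by simp
  also have "\<dots> = i \<cdot> cid C (src C i)" unfolding ip by (simp add: smul_comp mi)
  finally have pi: "p \<cdot> i = cid C (src C i)" by - (rule monoD[OF kernel_mono[OF i]], auto)
  have "m \<star> p = p \<cdot> (m \<star> cid C A)" by (simp add: smul_comp)
  also have "\<dots> = (p \<cdot> i) \<cdot> p" unfolding ip[symmetric] by simp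
  also have "\<dots> = p" unfolding pi by simp
  finally have "m \<star> p = p" .
  then show thesis using pi ip mi by (intro that[of i p]) auto
qed

text \<open>On the part cut out by a suitable \<open>m\<close>, the kernel and cokernel of
  \<open>s\<close> vanish, so \<open>s\<close> is an isomorphism there, and its inverse extends by
  zero. Conversely an inverse modulo \<open>I\<close> makes the kernel and cokernel maps congruent
  to zero, hence their objects too.\<close>

lemma inverted_iff:
  assumes I: "ideal I (End_unit C)"
  shows "s \<in> inverted C (serre_ideal C I) \<longleftrightarrow> s \<in> Ar C \<and> (\<exists>t \<in> Ar C. src C t = tgt C s \<and> tgt C t = src C s \<and>
    cong_mod I (t \<cdot> s) (cid C (src C s)) \<and> cong_mod I (s \<cdot> t) (cid C (tgt C s)))"
proof
  assume "s \<in> inverted C (serre_ideal C I)"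
  then obtain k q where k: "is_kernel C s k" "src C k \<in> serre_ideal C I" and q: "is_cokernel C s q" "tgt C q \<in> serre_ideal C I"
    unfolding inverted_def by auto
  define A B where "A = src C s" and "B = tgt C s"
  have [simp]: "s \<in> Ar C" "src C s = A" "tgt C s = B" "k \<in> Ar C" "tgt C k = A" "q \<in> Ar C" "src C q = B" "A \<in> Ob C" "B \<in> Ob C"
    using kernelD[OF k(1)] cokernelD[OF q(1)] by (auto simp: A_def B_def)
  \<comment> \<open>One \<open>m\<close> annihilates the identities of both the kernel and the
    cokernel object, and therefore \<open>k\<close> and \<open>q\<close>.\<close>
  obtain m where m: "m \<in> coideal_idems I" "m \<star> cid C (src C k) = m \<star> czero C (src C k) (src C k)"
    "m \<star> cid C (tgt C q) = m \<star> czero C (tgt C q) (tgt C q)"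
    using coideal_idems_common[OF I] k(2) q(2) unfolding serre_ideal_iff[OF I] by metis
  note [simp] = coideal_idems_scalar(1-3)[OF m(1)]
  obtain e where e: "e \<in> I" "e \<boxplus> m = cid C \<one>\<^sub>C" using m unfolding coideal_idems_def by auto
  note eR = ideal_End_unitD(1)[OF I e(1)]
  have "m \<star> k = k \<cdot> (m \<star> cid C (src C k))" "m \<star> q = (m \<star> cid C (tgt C q)) \<cdot> q" by (auto simp: smul_comp)
  then have mk: "m \<star> k = czero C (src C k) A" and mq: "m \<star> q = czero C B (tgt C q)"
    unfolding m(2,3) by auto
  obtain i p where [simp]: "i \<in> Ar C" "p \<in> Ar C" "tgt C i = A" "src C p = A" "tgt C p = src C i"
    and pi: "p \<cdot> i = cid C (src C i)" and ip: "i \<cdot> p = m \<star> cid C A" and mi: "m \<star> i = i" and "m \<star> p = p"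
    using idem_split[OF eR _ e(2) coideal_idems_scalar(4)[OF m(1)], of A] by auto
  obtain j r where [simp]: "j \<in> Ar C" "r \<in> Ar C" "tgt C j = B" "src C r = B" "tgt C r = src C j"
    and rj: "r \<cdot> j = cid C (src C j)" and jr: "j \<cdot> r = m \<star> cid C B" and "m \<star> j = j" and mr: "m \<star> r = r"
    using idem_split[OF eR _ e(2) coideal_idems_scalar(4)[OF m(1)], of B] by auto
  \<comment> \<open>\<open>s\<close> restricted to the images of \<open>m\<close> on
    \<open>A\<close> and \<open>B\<close>. A morphism killed by it factors, after inclusion into
    \<open>A\<close>, through \<open>k\<close>; it is fixed by \<open>m\<close> while
    \<open>m \<star> k\<close> is zero. Dually for epimorphisms.\<close>
  let ?s = "r \<cdot> s \<cdot> i"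
  have js: "j \<cdot> ?s = s \<cdot> i"
  proof -
    have "j \<cdot> ?s = (j \<cdot> r) \<cdot> (s \<cdot> i)" by simp
    also have "\<dots> = s \<cdot> (m \<star> i)" unfolding jr by (simp add: smul_comp)
    finally show ?thesis by (simp only: mi)
  qed
  have sp: "?s \<cdot> p = r \<cdot> s"
  proof -
    have "?s \<cdot> p = (r \<cdot> s) \<cdot> (i \<cdot> p)" by simp
    also have "\<dots> = (m \<star> r) \<cdot> s" unfolding ip by (simp add: smul_comp)
    finally show ?thesis by (simp only: mr)
  qed
  have "is_mono C ?s"
  proof (rule monoI)
    fix x assume x: "x \<in> Ar C" "tgt C x = src C ?s" "?s \<cdot> x = czero C (src C x) (tgt C ?s)"
    have "s \<cdot> (i \<cdot> x) = (j \<cdot> ?s) \<cdot> x" unfolding js using x(1,2) by simp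
    also have "\<dots> = j \<cdot> (?s \<cdot> x)" using x(1,2) by simp
    also have "\<dots> = czero C (src C x) B" unfolding x(3) using x(1) by simp
    finally obtain y where y: "y \<in> Ar C" "src C y = src C x" "tgt C y = src C k" "k \<cdot> y = i \<cdot> x"
      using kernel_factor[OF k(1), of "i \<cdot> x"] x(1,2) by auto
    have "i \<cdot> x = (m \<star> i) \<cdot> x" by (simp only: mi)
    also have "\<dots> = (m \<star> k) \<cdot> y" using x(1,2) y by (simp add: smul_comp)
    also have "\<dots> = czero C (src C x) A" unfolding mk using y by simp
    finally have ix: "i \<cdot> x = czero C (src C x) A" .
    have "x = (p \<cdot> i) \<cdot> x" unfolding pi using x(1,2) by simp
    also have "\<dots> = czero C (src C x) (src C ?s)" using x(1,2) ix by simp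
    finally show "x = czero C (src C x) (src C ?s)" .
  qed simp
  moreover have "is_epi C ?s"
  proof (rule epiI)
    fix x assume x: "x \<in> Ar C" "src C x = tgt C ?s" "x \<cdot> ?s = czero C (src C ?s) (tgt C x)"
    have "(x \<cdot> r) \<cdot> s = x \<cdot> (?s \<cdot> p)" unfolding sp using x(1,2) by simp
    also have "\<dots> = (x \<cdot> ?s) \<cdot> p" using x(1,2) by simp
    also have "\<dots> = czero C A (tgt C x)" unfolding x(3) using x(1) by simp
    finally obtain y where y: "y \<in> Ar C" "src C y = tgt C q" "tgt C y = tgt C x" "y \<cdot> q = x \<cdot> r"
      using cokernel_factor[OF q(1), of "x \<cdot> r"] x(1,2) by auto
    have "x \<cdot> r = x \<cdot> (m \<star> r)" by (simp only: mr)
    also have "\<dots> = y \<cdot> (m \<star> q)" using x(1,2) y by (simp add: smul_comp)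
    also have "\<dots> = czero C B (tgt C x)" unfolding mq using y by simp
    finally have xr: "x \<cdot> r = czero C B (tgt C x)" .
    have "x = x \<cdot> (r \<cdot> j)" unfolding rj using x(1,2) by simp
    also have "\<dots> = (x \<cdot> r) \<cdot> j" using x(1,2) by simp
    also have "\<dots> = czero C (tgt C ?s) (tgt C x)" unfolding xr using x(1) by simp
    finally show "x = czero C (tgt C ?s) (tgt C x)" .
  qed simp
  ultimately have iso: "is_iso C ?s" by (rule mono_epi_iso)
  let ?z = "inverse_arrow C ?s"
  note z = inverse_arrow_arr[OF iso]
  have z' [simp]: "?z \<in> Ar C" "src C ?z = src C j" "tgt C ?z = src C i" using z by auto
  \<comment> \<open>The inverse on the two images, extended by zero; both composites with
    \<open>s\<close> are the action of \<open>m\<close>, which is congruent to the identity.\<close>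
  let ?t = "i \<cdot> ?z \<cdot> r"
  have "?t \<cdot> s = i \<cdot> ?z \<cdot> (?s \<cdot> p)" unfolding sp by simp
  also have "\<dots> = i \<cdot> p" using inverse_arrow_comp_left(2)[OF iso, of p] by simp
  finally have ts: "?t \<cdot> s = m \<star> cid C A" unfolding ip .
  have "s \<cdot> ?t = (s \<cdot> i) \<cdot> ?z \<cdot> r" by simp
  also have "\<dots> = (j \<cdot> ?s) \<cdot> ?z \<cdot> r" by (simp only: js)
  also have "\<dots> = j \<cdot> (?s \<cdot> ?z \<cdot> r)" by simp
  also have "\<dots> = j \<cdot> r" by (subst inverse_arrow_comp_right(2)[OF iso]) auto
  finally have st: "s \<cdot> ?t = m \<star> cid C B" unfolding jr .
  have "cong_mod I (?t \<cdot> s) (cid C A)" "cong_mod I (s \<cdot> ?t) (cid C B)"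
    unfolding ts st by (auto intro!: cong_mod_smul I m)
  then show "s \<in> Ar C \<and> (\<exists>t \<in> Ar C. src C t = tgt C s \<and> tgt C t = src C s \<and>
    cong_mod I (t \<cdot> s) (cid C (src C s)) \<and> cong_mod I (s \<cdot> t) (cid C (tgt C s)))"
    by (intro conjI bexI[of _ ?t]) auto
next
  assume "s \<in> Ar C \<and> (\<exists>t \<in> Ar C. src C t = tgt C s \<and> tgt C t = src C s \<and>
    cong_mod I (t \<cdot> s) (cid C (src C s)) \<and> cong_mod I (s \<cdot> t) (cid C (tgt C s)))"
  then obtain t where [simp]: "s \<in> Ar C" "t \<in> Ar C" "src C t = tgt C s" "tgt C t = src C s"
    and ts: "cong_mod I (t \<cdot> s) (cid C (src C s))" and st: "cong_mod I (s \<cdot> t) (cid C (tgt C s))" by auto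
  obtain k where k: "is_kernel C s k" using ex_kernel[of s] by auto
  obtain q where q: "is_cokernel C s q" using ex_cokernel[of s] by auto
  have [simp]: "k \<in> Ar C" "tgt C k = src C s" "q \<in> Ar C" "src C q = tgt C s"
    using kernelD[OF k] cokernelD[OF q] by auto
  \<comment> \<open>Since \<open>s \<cdot> k\<close> is zero, this makes \<open>k\<close> congruent
    to zero. Cancelling the monomorphism \<open>k\<close> then kills the identity of its source by
    the same \<open>m\<close>.\<close>
  have "cong_mod I ((t \<cdot> s) \<cdot> k) (cid C (src C s) \<cdot> k)" by (intro cong_mod_comp I ts cong_mod_refl) auto
  then have "cong_mod I (czero C (src C k) (src C s)) k" using kernelD(4)[OF k] by simp
  then obtain m where m: "m \<in> coideal_idems I" "m \<star> czero C (src C k) (src C s) = m \<star> k" unfolding cong_mod_def by auto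
  note [simp] = coideal_idems_scalar(1-3)[OF m(1)]
  have "m \<star> cid C (src C k) = czero C (src C k) (src C k)"
    by (rule monoD[OF kernel_mono[OF k]]) (use m in \<open>auto simp: smul_comp\<close>)
  then have K: "src C k \<in> serre_ideal C I"
    unfolding serre_ideal_iff[OF I] cong_mod_def using m(1) by (auto intro!: bexI[of _ m])
  have "cong_mod I (q \<cdot> (s \<cdot> t)) (q \<cdot> cid C (tgt C s))" by (intro cong_mod_comp I st cong_mod_refl) auto
  moreover have "q \<cdot> (s \<cdot> t) = (q \<cdot> s) \<cdot> t" by simp
  ultimately have "cong_mod I (czero C (tgt C s) (tgt C q)) q" using cokernelD(4)[OF q] by simp
  then obtain n where n: "n \<in> coideal_idems I" "n \<star> czero C (tgt C s) (tgt C q) = n \<star> q" unfolding cong_mod_def by auto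
  note [simp] = coideal_idems_scalar(1-3)[OF n(1)]
  have "n \<star> cid C (tgt C q) = czero C (tgt C q) (tgt C q)"
    by (rule epiD[OF cokernel_epi[OF q]]) (use n in \<open>auto simp: smul_comp\<close>)
  then have Q: "tgt C q \<in> serre_ideal C I"
    unfolding serre_ideal_iff[OF I] cong_mod_def using n(1) by (auto intro!: bexI[of _ n])
  show "s \<in> inverted C (serre_ideal C I)"
    unfolding inverted_def using k q K Q by auto
qed

end

subsection \<open>Quotients of \<open>\<otimes>\<close>-categories with the same objects\<close>

text \<open>\<open>D\<close> has the objects of \<open>C\<close>, and every operation on morphisms
  is the image under the surjection \<open>F\<close>. No axiom is assumed of \<open>D\<close>:
  equations between operations pass to the image, and inverses, biproducts and zero objects are
  transported with them.\<close>

locale strict_quotient = tensor_category C for C :: "('o, 'm, 'x) tensor_cat_scheme" (structure) +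
  fixes D :: "('o, 'n, 'y) tensor_cat_scheme" and F :: "'m \<Rightarrow> 'n"
  assumes Ob_D [simp]: "Ob D = Ob C"
    and Ar_D: "Ar D = F ` Ar C"
    and src_D [simp]: "f \<in> Ar C \<Longrightarrow> src D (F f) = src C f"
    and tgt_D [simp]: "f \<in> Ar C \<Longrightarrow> tgt D (F f) = tgt C f"
    and cid_D [simp]: "A \<in> Ob C \<Longrightarrow> cid D A = F (cid C A)"
    and comp_D [simp]: "\<lbrakk>f \<in> Ar C; g \<in> Ar C; src C g = tgt C f\<rbrakk> \<Longrightarrow> ccomp D (F g) (F f) = F (g \<cdot> f)"
    and zero_D [simp]: "\<lbrakk>A \<in> Ob C; B \<in> Ob C\<rbrakk> \<Longrightarrow> czero D A B = F (czero C A B)"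
    and add_D [simp]: "\<lbrakk>f \<in> Ar C; g \<in> Ar C; src C f = src C g; tgt C f = tgt C g\<rbrakk>
      \<Longrightarrow> cplus D (F f) (F g) = F (f \<boxplus> g)"
    and tunit_D [simp]: "tunit D = tunit C"
    and tens_ob_D [simp]: "tens_ob D = tens_ob C"
    and tens_D [simp]: "\<lbrakk>f \<in> Ar C; g \<in> Ar C\<rbrakk> \<Longrightarrow> tens D (F f) (F g) = F (f \<otimes>\<^sub>m g)"
    and assoc_D [simp]: "\<lbrakk>A \<in> Ob C; B \<in> Ob C; E \<in> Ob C\<rbrakk> \<Longrightarrow> assoc D A B E = F (assoc C A B E)"
    and lunit_D [simp]: "A \<in> Ob C \<Longrightarrow> lunit D A = F (lunit C A)"
    and runit_D [simp]: "A \<in> Ob C \<Longrightarrow> runit D A = F (runit C A)"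
    and braid_D [simp]: "\<lbrakk>A \<in> Ob C; B \<in> Ob C\<rbrakk> \<Longrightarrow> braid D A B = F (braid C A B)"
begin

lemma F_Ar [simp]: "f \<in> Ar C \<Longrightarrow> F f \<in> Ar D"
  by (simp add: Ar_D)

lemma ArE:
  assumes "y \<in> Ar D"
  obtains f where "f \<in> Ar C" "y = F f"
  using assms by (auto simp: Ar_D)

lemma F_iso [simp]:
  assumes "is_iso C f"
  shows "is_iso D (F f)"
  unfolding is_iso_def inverse_arrows_def using assms is_iso_arr[OF assms]
  by (intro exI[of _ "F (inverse_arrow C f)"]) auto

lemma category_quotient: "category D"
  by unfold_locales (auto elim!: ArE)

lemma comm_group_quotient:
  assumes [simp]: "A \<in> Ob C" "B \<in> Ob C"
  shows "comm_group (hom_group D A B)"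
proof (rule comm_groupI)
  fix x y assume "x \<in> carrier (hom_group D A B)" "y \<in> carrier (hom_group D A B)"
  then obtain f g where fg: "f \<in> Ar C" "g \<in> Ar C" "x = F f" "y = F g"
    "src C f = A" "src C g = A" "tgt C f = B" "tgt C g = B"
    by (auto simp: hom_group_def elim!: ArE)
  then show "x \<otimes>\<^bsub>hom_group D A B\<^esub> y \<in> carrier (hom_group D A B)"
    by (simp add: hom_group_def)
  have "f \<boxplus> g = g \<boxplus> f" by (rule add_comm) (use fg in auto)
  then show "x \<otimes>\<^bsub>hom_group D A B\<^esub> y = y \<otimes>\<^bsub>hom_group D A B\<^esub> x"
    using fg by (simp add: hom_group_def)
  fix z assume "z \<in> carrier (hom_group D A B)"
  then obtain h where h: "h \<in> Ar C" "z = F h" "src C h = A" "tgt C h = B"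
    by (auto simp: hom_group_def elim!: ArE)
  then show "x \<otimes>\<^bsub>hom_group D A B\<^esub> y \<otimes>\<^bsub>hom_group D A B\<^esub> z = x \<otimes>\<^bsub>hom_group D A B\<^esub> (y \<otimes>\<^bsub>hom_group D A B\<^esub> z)"
    using fg by (simp add: hom_group_def)
next
  show "\<one>\<^bsub>hom_group D A B\<^esub> \<in> carrier (hom_group D A B)" by (simp add: hom_group_def)
  fix x assume "x \<in> carrier (hom_group D A B)"
  then obtain f where f: "f \<in> Ar C" "x = F f" "src C f = A" "tgt C f = B"
    by (auto simp: hom_group_def elim!: ArE)
  then show "\<one>\<^bsub>hom_group D A B\<^esub> \<otimes>\<^bsub>hom_group D A B\<^esub> x = x"
    by (simp add: hom_group_def)
  show "\<exists>y\<in>carrier (hom_group D A B). y \<otimes>\<^bsub>hom_group D A B\<^esub> x = \<one>\<^bsub>hom_group D A B\<^esub>"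
    using f by (intro bexI[of _ "F (neg f)"]) (auto simp: hom_group_def)
qed

lemma additive_category_quotient: "additive_category D"
proof (intro additive_category.intro[OF category_quotient] additive_category_axioms.intro)
  show "comm_group (hom_group D A B)" if "A \<in> Ob D" "B \<in> Ob D" for A B
    using comm_group_quotient that by simp
next
  obtain Z where Z: "is_zero_object C Z" using ex_zero_object by blast
  then have "is_zero_object D Z"
  proof (unfold is_zero_object_def, intro conjI ballI)
    fix A assume "A \<in> Ob D"
    then have ex: "\<exists>!f. f \<in> Hom C A Z" "\<exists>!f. f \<in> Hom C Z A"
      using Z unfolding is_zero_object_def Ob_D by blast+
    obtain f where f: "f \<in> Hom C A Z" and f1: "\<And>f'. f' \<in> Hom C A Z \<Longrightarrow> f' = f"
      using ex(1) by blast
    obtain g where g: "g \<in> Hom C Z A" and g1: "\<And>f'. f' \<in> Hom C Z A \<Longrightarrow> f' = g"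
      using ex(2) by blast
    show "\<exists>!f. f \<in> Hom D A Z"
    proof (rule ex1I[of _ "F f"])
      show "F f \<in> Hom D A Z" using f by simp
      fix x assume "x \<in> Hom D A Z"
      then obtain h where h: "h \<in> Ar C" "x = F h" "src C h = A" "tgt C h = Z" by (auto elim!: ArE)
      then show "x = F f" using f1[of h] by simp
    qed
    show "\<exists>!f. f \<in> Hom D Z A"
    proof (rule ex1I[of _ "F g"])
      show "F g \<in> Hom D Z A" using g by simp
      fix x assume "x \<in> Hom D Z A"
      then obtain h where h: "h \<in> Ar C" "x = F h" "src C h = Z" "tgt C h = A" by (auto elim!: ArE)
      then show "x = F g" using g1[of h] by simp
    qed
  qed simp
  then show "\<exists>Z. is_zero_object D Z" by blast
next
  fix A B assume "A \<in> Ob D" "B \<in> Ob D"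
  then have [simp]: "A \<in> Ob C" "B \<in> Ob C" by simp_all
  then obtain S i j p q where S: "S \<in> Ob C" "is_biproduct C S A B i j p q"
    using ex_biproduct[of A B] by auto
  then have "is_biproduct D S A B (F i) (F j) (F p) (F q)"
    unfolding is_biproduct_def by simp
  then show "\<exists>S\<in>Ob D. \<exists>i j p q. is_biproduct D S A B i j p q"
    using S(1) by (metis Ob_D)
qed (auto elim!: ArE)

lemma symmetric_monoidal_category_quotient: "symmetric_monoidal_category D"
proof (rule symmetric_monoidal_category.intro[OF category_quotient], unfold_locales)
  show "ccomp D (assoc D A B (tens_ob D E G)) (assoc D (tens_ob D A B) E G) =
    ccomp D (tens D (cid D A) (assoc D B E G)) (ccomp D (assoc D A (tens_ob D B E) G) (tens D (assoc D A B E) (cid D G)))"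
    if "A \<in> Ob D" "B \<in> Ob D" "E \<in> Ob D" "G \<in> Ob D" for A B E G
    using that pentagon[of A B E G] by simp
  show "ccomp D (tens D (cid D A) (lunit D B)) (assoc D A (tunit D) B) = tens D (runit D A) (cid D B)"
    if "A \<in> Ob D" "B \<in> Ob D" for A B
    using that triangle[of A B] by simp
  show "ccomp D (assoc D B E A) (ccomp D (braid D A (tens_ob D B E)) (assoc D A B E)) =
     ccomp D (tens D (cid D B) (braid D A E)) (ccomp D (assoc D B A E) (tens D (braid D A B) (cid D E)))"
    if "A \<in> Ob D" "B \<in> Ob D" "E \<in> Ob D" for A B E
    using that hexagon[of A B E] by simp
qed (auto elim!: ArE simp: assoc_nat lunit_nat runit_nat braid_nat braid_symmetric)

lemma tensor_category_quotient: "tensor_category D"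
  by (rule tensor_category.intro[OF additive_category_quotient symmetric_monoidal_category_quotient], unfold_locales)
    (auto elim!: ArE)

end

section \<open>Comparison of two quotients of the same tensor category\<close>

lemma is_functor_id: "category C \<Longrightarrow> is_functor C C id id"
  unfolding is_functor_def by auto

text \<open>\<open>HF\<close> makes \<open>H\<close> surjective on morphisms and
  \<open>same_kernel\<close> makes it injective. As objects and structure are shared,
  \<open>H\<close> is an isomorphism of categories with identity structure maps.\<close>

locale strict_quotient_pair = Q1: strict_quotient C D F + Q2: strict_quotient C E G
  for C :: "('o, 'm, 'x) tensor_cat_scheme" (structure) and D :: "('o, 'n, 'y) tensor_cat_scheme" and F
    and E :: "('o, 'k, 'z) tensor_cat_scheme" and G +
  fixes H :: "'n \<Rightarrow> 'k"
  assumes HF [simp]: "f \<in> Ar C \<Longrightarrow> H (F f) = G f"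
    and same_kernel: "\<lbrakk>f \<in> Ar C; g \<in> Ar C; G f = G g\<rbrakk> \<Longrightarrow> F f = F g"
begin

lemma functor_H: "is_functor D E (\<lambda>A. A) H"
  unfolding is_functor_def
  using Q1.category_quotient Q2.category_quotient by (auto elim!: Q1.ArE)

lemma tensor_functor_H:
  "is_tensor_functor D E (\<lambda>A. A) H (\<lambda>A B. cid E (tens_ob E A B)) (cid E (tunit E))"
proof -
  have iso: "is_iso E (G (cid C A))" if "A \<in> Ob C" for A
    using that by simp
  show ?thesis
    unfolding is_tensor_functor_def
    using Q1.tensor_category_quotient Q2.tensor_category_quotient functor_H iso
    by (auto elim!: Q1.ArE)
qed

lemma equivalence_H: "is_equivalence D E (\<lambda>A. A) H"
proof -
  \<comment> \<open>The inverse of \<open>H\<close>, through an arbitrary lift along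
    \<open>G\<close>; by \<open>same_kernel\<close> the lift does not affect the value.\<close>
  define K where "K y = F (SOME f. f \<in> Ar C \<and> G f = y)" for y
  have KG [simp]: "K (G f) = F f" if "f \<in> Ar C" for f
  proof -
    have "\<exists>f'. f' \<in> Ar C \<and> G f' = G f" using that by blast
    then have "(SOME f'. f' \<in> Ar C \<and> G f' = G f) \<in> Ar C \<and> G (SOME f'. f' \<in> Ar C \<and> G f' = G f) = G f"
      by (rule someI_ex)
    then show ?thesis unfolding K_def using same_kernel that by blast
  qed
  have fK: "is_functor E D (\<lambda>A. A) K"
    unfolding is_functor_def
    using Q1.category_quotient Q2.category_quotient by (auto elim!: Q2.ArE)
  have f1: "is_functor D D ((\<lambda>A. A) \<circ> (\<lambda>A. A)) (K \<circ> H)"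
    unfolding is_functor_def
    using Q1.category_quotient by (auto elim!: Q1.ArE)
  have f2: "is_functor E E ((\<lambda>A. A) \<circ> (\<lambda>A. A)) (H \<circ> K)"
    unfolding is_functor_def
    using Q2.category_quotient by (auto elim!: Q2.ArE)
  have "natural_iso D D id id ((\<lambda>A. A) \<circ> (\<lambda>A. A)) (K \<circ> H) (cid D)"
    unfolding natural_iso_def using f1 is_functor_id[OF Q1.category_quotient] by (auto elim!: Q1.ArE)
  moreover have "natural_iso E E ((\<lambda>A. A) \<circ> (\<lambda>A. A)) (H \<circ> K) id id (cid E)"
    unfolding natural_iso_def using f2 is_functor_id[OF Q2.category_quotient] by (auto elim!: Q2.ArE)
  ultimately show ?thesis
    unfolding is_equivalence_def using functor_H fK by blast
qed

end

subsection \<open>The quotient by a \<open>\<otimes>\<close>-ideal\<close>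

context tensor_category
begin

definition ideal_rel :: "'b set \<Rightarrow> 'b \<Rightarrow> 'b \<Rightarrow> bool" where
  "ideal_rel \<II> f g \<longleftrightarrow> f \<in> Ar C \<and> (\<exists>d \<in> \<II>. src C d = src C f \<and> tgt C d = tgt C f \<and> g = f \<boxplus> d)"

context
  fixes \<II>
  assumes \<II>: "tensor_ideal C \<II>"
begin

lemma ideal_relD:
  assumes "ideal_rel \<II> f g"
  shows "f \<in> Ar C" "g \<in> Ar C" "src C g = src C f" "tgt C g = tgt C f"
  using assms tensor_idealD(1)[OF \<II>] unfolding ideal_rel_def by auto

lemma ideal_relI:
  assumes "f \<in> Ar C" "d \<in> \<II>" "src C d = src C f" "tgt C d = tgt C f"
  shows "ideal_rel \<II> f (f \<boxplus> d)"
  using assms unfolding ideal_rel_def by blast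

lemma ideal_relE:
  assumes "ideal_rel \<II> f g"
  obtains d where "d \<in> \<II>" "d \<in> Ar C" "src C d = src C f" "tgt C d = tgt C f" "g = f \<boxplus> d"
  using assms tensor_idealD(1)[OF \<II>] unfolding ideal_rel_def by auto

lemma ideal_rel_refl: "f \<in> Ar C \<Longrightarrow> ideal_rel \<II> f f"
  using ideal_relI[of f "czero C (src C f) (tgt C f)"] tensor_idealD(2)[OF \<II>] by simp

lemma ideal_rel_sym:
  assumes "ideal_rel \<II> f g"
  shows "ideal_rel \<II> g f"
proof -
  obtain d where d: "d \<in> \<II>" "d \<in> Ar C" "src C d = src C f" "tgt C d = tgt C f" "g = f \<boxplus> d"
    using ideal_relE[OF assms] .
  have "ideal_rel \<II> g (g \<boxplus> neg d)"
    using ideal_relD[OF assms] d(1-4) tensor_idealD(4)[OF \<II>] by (intro ideal_relI) auto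
  then show ?thesis using d ideal_relD[OF assms] by simp
qed

lemma ideal_rel_trans:
  assumes "ideal_rel \<II> f g" "ideal_rel \<II> g h"
  shows "ideal_rel \<II> f h"
proof -
  obtain d where d: "d \<in> \<II>" "d \<in> Ar C" "src C d = src C f" "tgt C d = tgt C f" "g = f \<boxplus> d"
    using ideal_relE[OF assms(1)] .
  obtain e where e: "e \<in> \<II>" "e \<in> Ar C" "src C e = src C g" "tgt C e = tgt C g" "h = g \<boxplus> e"
    using ideal_relE[OF assms(2)] .
  have "ideal_rel \<II> f (f \<boxplus> (d \<boxplus> e))"
    using d e ideal_relD[OF assms(1)] tensor_idealD(3)[OF \<II>, of d e] by (intro ideal_relI) auto
  then show ?thesis using d e ideal_relD[OF assms(1)] by simp
qed

lemma ideal_rel_add: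
  assumes "ideal_rel \<II> f g" "ideal_rel \<II> f' g'" "src C f = src C f'" "tgt C f = tgt C f'"
  shows "ideal_rel \<II> (f \<boxplus> f') (g \<boxplus> g')"
proof -
  note a = ideal_relD[OF assms(1)] ideal_relD[OF assms(2)] assms(3,4)
  obtain d where d: "d \<in> \<II>" "d \<in> Ar C" "src C d = src C f" "tgt C d = tgt C f" "g = f \<boxplus> d"
    using ideal_relE[OF assms(1)] .
  obtain e where e: "e \<in> \<II>" "e \<in> Ar C" "src C e = src C f'" "tgt C e = tgt C f'" "g' = f' \<boxplus> e"
    using ideal_relE[OF assms(2)] .
  have "g \<boxplus> g' = f \<boxplus> ((d \<boxplus> f') \<boxplus> e)" using a d e by simp
  also have "d \<boxplus> f' = f' \<boxplus> d" by (rule add_comm) (use a d in auto)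
  also have "f \<boxplus> ((f' \<boxplus> d) \<boxplus> e) = (f \<boxplus> f') \<boxplus> (d \<boxplus> e)" using a d e by simp
  finally have *: "g \<boxplus> g' = (f \<boxplus> f') \<boxplus> (d \<boxplus> e)" .
  show ?thesis unfolding * using a(1-3,5-) d(1-4) e(1-4) tensor_idealD(3)[OF \<II>, of d e] by (intro ideal_relI) auto
qed

lemma ideal_rel_comp:
  assumes "ideal_rel \<II> f g" "ideal_rel \<II> f' g'" "src C f' = tgt C f"
  shows "ideal_rel \<II> (f' \<cdot> f) (g' \<cdot> g)"
proof -
  note a = ideal_relD(1)[OF assms(1)] ideal_relD(1)[OF assms(2)] assms(3)
  obtain d where d: "d \<in> \<II>" "d \<in> Ar C" "src C d = src C f" "tgt C d = tgt C f" "g = f \<boxplus> d"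
    using ideal_relE[OF assms(1)] .
  obtain e where e: "e \<in> \<II>" "e \<in> Ar C" "src C e = src C f'" "tgt C e = tgt C f'" "g' = f' \<boxplus> e"
    using ideal_relE[OF assms(2)] .
  \<comment> \<open>The factor \<open>f' \<boxplus> e\<close> in front of \<open>d\<close> stays
    unexpanded: as one arrow it is absorbed by the ideal in a single step.\<close>
  have *: "g' \<cdot> g = f' \<cdot> f \<boxplus> (e \<cdot> f \<boxplus> (f' \<boxplus> e) \<cdot> d)"
  proof -
    have "g' \<cdot> g = (f' \<boxplus> e) \<cdot> f \<boxplus> (f' \<boxplus> e) \<cdot> d" unfolding d(5) e(5) using a d(1-4) e(1-4) by (intro comp_add) auto
    also have "(f' \<boxplus> e) \<cdot> f = f' \<cdot> f \<boxplus> e \<cdot> f" using a d(1-4) e(1-4) by (intro comp_add) auto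
    also have "(f' \<cdot> f \<boxplus> e \<cdot> f) \<boxplus> (f' \<boxplus> e) \<cdot> d = f' \<cdot> f \<boxplus> (e \<cdot> f \<boxplus> (f' \<boxplus> e) \<cdot> d)"
      using a d(1-4) e(1-4) by (intro add_assoc) (auto simp del: comp_add)
    finally show ?thesis .
  qed
  have "e \<cdot> f \<boxplus> (f' \<boxplus> e) \<cdot> d \<in> \<II>"
    using a d(1-4) e(1-4)
    by (intro tensor_idealD(3)[OF \<II>] tensor_idealD(6)[OF \<II>] tensor_idealD(5)[OF \<II>]) (auto simp del: comp_add)
  then show ?thesis unfolding * using a d(1-4) e(1-4) by (intro ideal_relI) auto
qed

lemma ideal_rel_tens:
  assumes "ideal_rel \<II> f g" "ideal_rel \<II> f' g'"
  shows "ideal_rel \<II> (f' \<otimes>\<^sub>m f) (g' \<otimes>\<^sub>m g)"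
proof -
  note a = ideal_relD(1)[OF assms(1)] ideal_relD(1)[OF assms(2)]
  obtain d where d: "d \<in> \<II>" "d \<in> Ar C" "src C d = src C f" "tgt C d = tgt C f" "g = f \<boxplus> d"
    using ideal_relE[OF assms(1)] .
  obtain e where e: "e \<in> \<II>" "e \<in> Ar C" "src C e = src C f'" "tgt C e = tgt C f'" "g' = f' \<boxplus> e"
    using ideal_relE[OF assms(2)] .
  have *: "g' \<otimes>\<^sub>m g = (f' \<otimes>\<^sub>m f) \<boxplus> ((e \<otimes>\<^sub>m f) \<boxplus> ((f' \<boxplus> e) \<otimes>\<^sub>m d))"
  proof -
    have "g' \<otimes>\<^sub>m g = ((f' \<boxplus> e) \<otimes>\<^sub>m f) \<boxplus> ((f' \<boxplus> e) \<otimes>\<^sub>m d)" unfolding d(5) e(5) using a d(1-4) e(1-4) by (intro tens_add) auto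
    also have "(f' \<boxplus> e) \<otimes>\<^sub>m f = (f' \<otimes>\<^sub>m f) \<boxplus> (e \<otimes>\<^sub>m f)" using a d(1-4) e(1-4) by (intro tens_add) auto
    also have "((f' \<otimes>\<^sub>m f) \<boxplus> (e \<otimes>\<^sub>m f)) \<boxplus> ((f' \<boxplus> e) \<otimes>\<^sub>m d) = (f' \<otimes>\<^sub>m f) \<boxplus> ((e \<otimes>\<^sub>m f) \<boxplus> ((f' \<boxplus> e) \<otimes>\<^sub>m d))"
      using a d(1-4) e(1-4) by (intro add_assoc) (auto simp del: tens_add)
    finally show ?thesis .
  qed
  have "(e \<otimes>\<^sub>m f) \<boxplus> ((f' \<boxplus> e) \<otimes>\<^sub>m d) \<in> \<II>"
    using a d(1-4) e(1-4)
    by (intro tensor_idealD(3)[OF \<II>] tensor_idealD(7)[OF \<II>] tensor_idealD(8)[OF \<II>]) (auto simp del: tens_add)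
  then show ?thesis unfolding * using a d(1-4) e(1-4) by (intro ideal_relI) auto
qed

lemma ideal_class_eq_Collect:
  assumes "f \<in> Ar C"
  shows "ideal_class C \<II> f = {g. ideal_rel \<II> f g}"
  using assms tensor_idealD(1)[OF \<II>] unfolding ideal_class_def ideal_rel_def by auto

lemma ideal_class_eq_iff:
  assumes "f \<in> Ar C" "g \<in> Ar C"
  shows "ideal_class C \<II> f = ideal_class C \<II> g \<longleftrightarrow> ideal_rel \<II> f g"
  unfolding ideal_class_eq_Collect[OF assms(1)] ideal_class_eq_Collect[OF assms(2)]
  using ideal_rel_sym ideal_rel_trans ideal_rel_refl[OF assms(2)] by blast

lemma ideal_rel_zero_iff:
  assumes "f \<in> Ar C"
  shows "ideal_rel \<II> f (czero C (src C f) (tgt C f)) \<longleftrightarrow> f \<in> \<II>"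
proof
  assume "ideal_rel \<II> f (czero C (src C f) (tgt C f))"
  then have "ideal_rel \<II> (czero C (src C f) (tgt C f)) f" by (rule ideal_rel_sym)
  then obtain d where "d \<in> \<II>" "d \<in> Ar C" "src C d = src C f" "tgt C d = tgt C f" "f = czero C (src C f) (tgt C f) \<boxplus> d"
    using assms by (auto elim!: ideal_relE)
  then show "f \<in> \<II>" by simp
next
  assume "f \<in> \<II>"
  then have "ideal_rel \<II> f (f \<boxplus> neg f)" using assms tensor_idealD(4)[OF \<II>] by (intro ideal_relI) auto
  then show "ideal_rel \<II> f (czero C (src C f) (tgt C f))" using assms by simp
qed

lemma ideal_rel_rep:
  assumes "f \<in> Ar C"
  shows "ideal_rel \<II> (SOME g. g \<in> ideal_class C \<II> f) f"
proof -
  have "f \<in> ideal_class C \<II> f" using ideal_rel_refl[OF assms] ideal_class_eq_Collect[OF assms] by simp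
  then have "(SOME g. g \<in> ideal_class C \<II> f) \<in> ideal_class C \<II> f" by (rule someI)
  then show ?thesis using ideal_class_eq_Collect[OF assms] ideal_rel_sym by simp
qed

text \<open>The operations of the quotient use a chosen representative of each class. It is
  congruent to the given one, and congruence is compatible with every operation.\<close>

lemma strict_quotient_ideal: "strict_quotient C (ideal_quotient C \<II>) (ideal_class C \<II>)"
proof -
  show ?thesis
  proof (rule strict_quotient.intro[OF tensor_category_axioms], unfold_locales)
    fix f g assume fg: "f \<in> Ar C" "g \<in> Ar C"
    note rr = ideal_rel_rep[OF fg(1)] ideal_rel_rep[OF fg(2)]
    note d = ideal_relD[OF rr(1)] ideal_relD[OF rr(2)]
    show "src (ideal_quotient C \<II>) (ideal_class C \<II> f) = src C f" "tgt (ideal_quotient C \<II>) (ideal_class C \<II> f) = tgt C f"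
      using d by (simp_all add: ideal_quotient_def Let_def)
    show "ccomp (ideal_quotient C \<II>) (ideal_class C \<II> g) (ideal_class C \<II> f) = ideal_class C \<II> (g \<cdot> f)" if "src C g = tgt C f"
      using ideal_rel_comp[OF rr] that d ideal_class_eq_iff by (simp add: ideal_quotient_def Let_def)
    show "cplus (ideal_quotient C \<II>) (ideal_class C \<II> f) (ideal_class C \<II> g) = ideal_class C \<II> (f \<boxplus> g)"
      if "src C f = src C g" "tgt C f = tgt C g"
      using ideal_rel_add[OF rr] that d ideal_class_eq_iff by (simp add: ideal_quotient_def Let_def)
    show "tens (ideal_quotient C \<II>) (ideal_class C \<II> f) (ideal_class C \<II> g) = ideal_class C \<II> (f \<otimes>\<^sub>m g)"
      using ideal_rel_tens[OF rr(2,1)] d ideal_class_eq_iff by (simp add: ideal_quotient_def Let_def)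
  qed (simp_all add: ideal_quotient_def Let_def)
qed

lemma integral_quotient_iff:
  "integral_tensor_cat (ideal_quotient C \<II>) \<longleftrightarrow> (\<forall>f \<in> Ar C. \<forall>g \<in> Ar C. f \<otimes>\<^sub>m g \<in> \<II> \<longrightarrow> f \<in> \<II> \<or> g \<in> \<II>)"
proof -
  interpret Q: strict_quotient C "ideal_quotient C \<II>" "ideal_class C \<II>" by (rule strict_quotient_ideal)
  have zero: "ideal_class C \<II> f = ideal_class C \<II> (czero C A B) \<longleftrightarrow> f \<in> \<II>"
    if "f \<in> Ar C" "A = src C f" "B = tgt C f" for f A B
    using that ideal_rel_zero_iff[of f] ideal_class_eq_iff[of f "czero C A B"] by simp
  show ?thesis
    unfolding integral_tensor_cat_def Q.Ar_D by (simp add: zero)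
qed

end

lemma prime_tensor_ideal_iff:
  "prime_tensor_ideal C \<P> \<longleftrightarrow> tensor_ideal C \<P> \<and> \<P> \<noteq> Ar C \<and> (\<forall>f \<in> Ar C. \<forall>g \<in> Ar C. f \<otimes>\<^sub>m g \<in> \<P> \<longrightarrow> f \<in> \<P> \<or> g \<in> \<P>)"
  unfolding prime_tensor_ideal_def using integral_quotient_iff by auto

end

subsection \<open>The Serre quotient\<close>

context rigid_abelian_tensor_category
begin

context
  fixes I
  assumes I: "ideal I (End_unit C)"
begin

abbreviation "\<S> \<equiv> serre_ideal C I"

lemma inverted_arr: "s \<in> inverted C \<S> \<Longrightarrow> s \<in> Ar C"
  unfolding inverted_def by auto

lemma invertedE:
  assumes "s \<in> inverted C \<S>"
  obtains t where "t \<in> Ar C" "src C t = tgt C s" "tgt C t = src C s"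
    "cong_mod I (t \<cdot> s) (cid C (src C s))" "cong_mod I (s \<cdot> t) (cid C (tgt C s))"
  using assms inverted_iff[OF I] by auto

lemma invertedI:
  assumes "s \<in> Ar C" "t \<in> Ar C" "src C t = tgt C s" "tgt C t = src C s"
    "cong_mod I (t \<cdot> s) (cid C (src C s))" "cong_mod I (s \<cdot> t) (cid C (tgt C s))"
  shows "s \<in> inverted C \<S>"
  using assms inverted_iff[OF I] by auto

lemma inverted_cid [simp]: "A \<in> Ob C \<Longrightarrow> cid C A \<in> inverted C \<S>"
  by (rule invertedI[of _ "cid C A"]) (auto intro: cong_mod_refl I)

lemma inverted_comp:
  assumes "s \<in> inverted C \<S>" "s' \<in> inverted C \<S>" "src C s' = tgt C s"
  shows "s' \<cdot> s \<in> inverted C \<S>"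
proof -
  note [simp] = inverted_arr[OF assms(1)] inverted_arr[OF assms(2)] assms(3)
  obtain t where [simp]: "t \<in> Ar C" "src C t = tgt C s" "tgt C t = src C s"
    and ts: "cong_mod I (t \<cdot> s) (cid C (src C s))" and st: "cong_mod I (s \<cdot> t) (cid C (tgt C s))"
    using invertedE[OF assms(1)] .
  obtain t' where [simp]: "t' \<in> Ar C" "src C t' = tgt C s'" "tgt C t' = tgt C s"
    and ts': "cong_mod I (t' \<cdot> s') (cid C (tgt C s))" and st': "cong_mod I (s' \<cdot> t') (cid C (tgt C s'))"
    using invertedE[OF assms(2)] assms(3) by metis
  have "cong_mod I (t \<cdot> ((t' \<cdot> s') \<cdot> s)) (t \<cdot> (cid C (tgt C s) \<cdot> s))"
    by (intro cong_mod_comp I cong_mod_refl ts') auto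
  then have 1: "cong_mod I ((t \<cdot> t') \<cdot> (s' \<cdot> s)) (cid C (src C s))"
    using cong_mod_trans[OF I _ ts] by simp
  have "cong_mod I (s' \<cdot> ((s \<cdot> t) \<cdot> t')) (s' \<cdot> (cid C (tgt C s) \<cdot> t'))"
    by (intro cong_mod_comp I cong_mod_refl st) auto
  then have 2: "cong_mod I ((s' \<cdot> s) \<cdot> (t \<cdot> t')) (cid C (tgt C s'))"
    using cong_mod_trans[OF I _ st'] by simp
  show ?thesis
    by (rule invertedI[of _ "t \<cdot> t'"]) (use 1 2 in auto)
qed

lemma inverted_tens:
  assumes "s \<in> inverted C \<S>" "s' \<in> inverted C \<S>"
  shows "s \<otimes>\<^sub>m s' \<in> inverted C \<S>"
proof -
  note [simp] = inverted_arr[OF assms(1)] inverted_arr[OF assms(2)]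
  obtain t where [simp]: "t \<in> Ar C" "src C t = tgt C s" "tgt C t = src C s"
    and ts: "cong_mod I (t \<cdot> s) (cid C (src C s))" and st: "cong_mod I (s \<cdot> t) (cid C (tgt C s))"
    using invertedE[OF assms(1)] .
  obtain t' where [simp]: "t' \<in> Ar C" "src C t' = tgt C s'" "tgt C t' = src C s'"
    and ts': "cong_mod I (t' \<cdot> s') (cid C (src C s'))" and st': "cong_mod I (s' \<cdot> t') (cid C (tgt C s'))"
    using invertedE[OF assms(2)] .
  show ?thesis
    by (rule invertedI[of _ "t \<otimes>\<^sub>m t'"]) (use cong_mod_tens[OF I ts' ts] cong_mod_tens[OF I st' st] in auto)
qed

lemma cong_cid_inverted:
  assumes "cong_mod I s (cid C A)" "A \<in> Ob C"
  shows "s \<in> inverted C \<S>"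
  using cong_mod_arr[OF assms(1)] assms by (intro invertedI[of s "cid C A"]) auto

lemma cong_mod_cancel_right:
  assumes "s \<in> inverted C \<S>" "cong_mod I (h \<cdot> s) (h' \<cdot> s)" "h \<in> Ar C" "h' \<in> Ar C" "src C h = tgt C s" "src C h' = tgt C s"
  shows "cong_mod I h h'"
proof -
  note [simp] = inverted_arr[OF assms(1)] assms(3-)
  obtain t where [simp]: "t \<in> Ar C" "src C t = tgt C s" "tgt C t = src C s"
    and st: "cong_mod I (s \<cdot> t) (cid C (tgt C s))"
    using invertedE[OF assms(1)] .
  have 1: "cong_mod I (x \<cdot> (s \<cdot> t)) x" if "x \<in> Ar C" "src C x = tgt C s" for x
    using cong_mod_comp[OF I st cong_mod_refl[OF I], of x] that by simp
  have "cong_mod I ((h \<cdot> s) \<cdot> t) ((h' \<cdot> s) \<cdot> t)"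
    by (intro cong_mod_comp I cong_mod_refl assms) auto
  then have "cong_mod I (h \<cdot> (s \<cdot> t)) (h' \<cdot> (s \<cdot> t))" by simp
  then have "cong_mod I h (h' \<cdot> (s \<cdot> t))" using 1[of h] cong_mod_sym cong_mod_trans[OF I] by (metis assms(3,5))
  then show ?thesis using 1[of h'] cong_mod_trans[OF I] by (metis assms(4,6))
qed

text \<open>The fraction \<open>(s, f)\<close> represents the class of \<open>h\<close> modulo \<open>I\<^sub>\<oplus>\<close>, that is \<open>f s\<^sup>-\<^sup>1 = h\<close>.\<close>

definition represents :: "'b \<times> 'b \<Rightarrow> 'b \<Rightarrow> bool" where
  "represents = (\<lambda>(s, f) h. (s, f) \<in> fractions C \<S> \<and> h \<in> Ar C \<and> src C h = tgt C s \<and> tgt C h = tgt C f \<and>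
     cong_mod I f (h \<cdot> s))"

lemma representsD:
  assumes "represents (s, f) h"
  shows "s \<in> inverted C \<S>" "s \<in> Ar C" "f \<in> Ar C" "src C s = src C f" "h \<in> Ar C" "src C h = tgt C s" "tgt C h = tgt C f"
    "cong_mod I f (h \<cdot> s)"
  using assms inverted_arr unfolding represents_def fractions_def by auto

lemma representsI:
  assumes "s \<in> inverted C \<S>" "f \<in> Ar C" "src C s = src C f" "h \<in> Ar C" "src C h = tgt C s" "tgt C h = tgt C f"
    "cong_mod I f (h \<cdot> s)"
  shows "represents (s, f) h"
  using assms unfolding represents_def fractions_def by auto

text \<open>An inverse \<open>t\<close> of the denominator modulo \<open>I\<close> clears it:
  \<open>f \<cdot> t\<close> is the honest morphism standing for the fraction.\<close>

lemma ex_represents: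
  assumes "(s, f) \<in> fractions C \<S>"
  obtains h where "represents (s, f) h"
proof -
  have s: "s \<in> inverted C \<S>" and [simp]: "f \<in> Ar C" "src C s = src C f"
    using assms unfolding fractions_def by auto
  note [simp] = inverted_arr[OF s]
  obtain t where [simp]: "t \<in> Ar C" "src C t = tgt C s" "tgt C t = src C s"
    and ts: "cong_mod I (t \<cdot> s) (cid C (src C s))"
    using invertedE[OF s] .
  have "cong_mod I (f \<cdot> (t \<cdot> s)) (f \<cdot> cid C (src C s))"
    by (intro cong_mod_comp I cong_mod_refl ts) auto
  then have "represents (s, f) (f \<cdot> t)"
    by (intro representsI s) (auto intro: cong_mod_sym)
  then show thesis by (rule that)
qed

lemma represents_cid: "h \<in> Ar C \<Longrightarrow> A = src C h \<Longrightarrow> represents (cid C A, h) h"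
  by (rule representsI) (auto intro: cong_mod_refl I)

lemma represents_cong:
  assumes "represents (s, f) h" "cong_mod I h h'"
  shows "represents (s, f) h'"
proof -
  note d = representsD[OF assms(1)] and a = cong_mod_arr[OF assms(2)]
  have "cong_mod I (h \<cdot> s) (h' \<cdot> s)" by (intro cong_mod_comp I cong_mod_refl assms) (use d in auto)
  then show ?thesis using d a cong_mod_trans[OF I d(8)] by (intro representsI) auto
qed

lemma represents_unique:
  assumes "represents (s, f) h" "represents (s, f) h'"
  shows "cong_mod I h h'"
proof -
  note d = representsD[OF assms(1)] and d' = representsD[OF assms(2)]
  show ?thesis
    by (rule cong_mod_cancel_right[OF d(1)]) (use d d' cong_mod_trans[OF I cong_mod_sym[OF d(8)] d'(8)] in auto)
qed

text \<open>A class of fractions is recorded by the one morphism that all its members represent. In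
  particular no transitivity argument with Ore squares occurs.\<close>

lemma fraction_class_eq:
  assumes "represents (s, f) h"
  shows "fraction_class C \<S> (s, f) = {x. represents x h}"
proof -
  note d = representsD[OF assms]
  note [simp] = d(2-7)
  \<comment> \<open>As \<open>t\<close> and \<open>t \<cdot> v\<close> are invertible modulo
    \<open>I\<close>, so is \<open>v\<close>, with \<open>w\<close> a right inverse. From
    \<open>g v = f u\<close> and \<open>s u = t v\<close> the congruence for \<open>f\<close> passes
    to \<open>g\<close> after \<open>v\<close>, and \<open>w\<close> removes
    \<open>v\<close>.\<close>
  have "represents (t, g) h" if tg: "(t, g) \<in> fractions C \<S>" "tgt C s = tgt C t" "tgt C f = tgt C g"
    and uv: "common_denominator C \<S> s t u v" "f \<cdot> u = g \<cdot> v" for t g u v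
  proof -
    have t: "t \<in> inverted C \<S>" and [simp]: "g \<in> Ar C" "src C t = src C g" "tgt C t = tgt C s" "tgt C g = tgt C f"
      using tg unfolding fractions_def by auto
    note [simp] = inverted_arr[OF t]
    have [simp]: "u \<in> Ar C" "v \<in> Ar C" "src C v = src C u" "tgt C u = src C f" "tgt C v = src C g"
      and eq: "s \<cdot> u = t \<cdot> v" and tv: "t \<cdot> v \<in> inverted C \<S>"
      using uv unfolding common_denominator_def by auto
    obtain t' where [simp]: "t' \<in> Ar C" "src C t' = tgt C s" "tgt C t' = src C g"
      and ts': "cong_mod I (t' \<cdot> t) (cid C (src C g))" and tt': "cong_mod I (t \<cdot> t') (cid C (tgt C s))"
      using invertedE[OF t] by auto
    have t': "t' \<in> inverted C \<S>" using ts' tt' by (intro invertedI[of t' t]) auto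
    have "t' \<cdot> (t \<cdot> v) \<in> inverted C \<S>" by (intro inverted_comp t' tv) auto
    moreover have "cong_mod I ((t' \<cdot> t) \<cdot> v) (cid C (src C g) \<cdot> v)"
      by (intro cong_mod_comp I cong_mod_refl ts') auto
    ultimately obtain w where [simp]: "w \<in> Ar C" "src C w = src C g" "tgt C w = src C u"
      and vw: "cong_mod I ((t' \<cdot> (t \<cdot> v)) \<cdot> w) (cid C (src C g))" and cv: "cong_mod I (t' \<cdot> (t \<cdot> v)) v"
      by (auto elim!: invertedE)
    have "cong_mod I ((t' \<cdot> (t \<cdot> v)) \<cdot> w) (v \<cdot> w)"
      by (intro cong_mod_comp I cong_mod_refl cv) auto
    then have vw': "cong_mod I (v \<cdot> w) (cid C (src C g))"
      using vw cong_mod_trans[OF I] cong_mod_sym by blast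
    have "cong_mod I (f \<cdot> u) ((h \<cdot> s) \<cdot> u)" by (intro cong_mod_comp I cong_mod_refl d(8)) auto
    then have "cong_mod I (g \<cdot> v) (h \<cdot> (t \<cdot> v))" using uv(2) eq by simp
    then have "cong_mod I ((g \<cdot> v) \<cdot> w) ((h \<cdot> (t \<cdot> v)) \<cdot> w)"
      by - (rule cong_mod_comp[OF I cong_mod_refl[OF I]], auto)
    then have c: "cong_mod I (g \<cdot> v \<cdot> w) (h \<cdot> t \<cdot> v \<cdot> w)" by simp
    have "cong_mod I (g \<cdot> (v \<cdot> w)) (g \<cdot> cid C (src C g))" by (intro cong_mod_comp I cong_mod_refl vw') auto
    then have c1: "cong_mod I (g \<cdot> v \<cdot> w) g" by simp
    have "cong_mod I ((h \<cdot> t) \<cdot> (v \<cdot> w)) ((h \<cdot> t) \<cdot> cid C (src C g))" by (intro cong_mod_comp I cong_mod_refl vw') auto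
    then have c2: "cong_mod I (h \<cdot> t \<cdot> v \<cdot> w) (h \<cdot> t)" by simp
    have "cong_mod I g (h \<cdot> t)"
      by (rule cong_mod_trans[OF I cong_mod_sym[OF c1] cong_mod_trans[OF I c c2]])
    then show ?thesis by (intro representsI t) auto
  qed
  \<comment> \<open>The inverses \<open>s'\<close> and \<open>t'\<close> only work up to a scalar,
    while a common denominator asks for strict equality. Multiplying both by one \<open>m\<close>
    valid for all four congruences makes \<open>s u\<close> and \<open>t v\<close> equal to the
    action of \<open>m\<close>, which is inverted.\<close>
  moreover have "\<exists>u v. common_denominator C \<S> s t u v \<and> f \<cdot> u = g \<cdot> v" if tg: "represents (t, g) h" for t g
  proof -
    note e = representsD[OF tg]
    have [simp]: "t \<in> Ar C" "g \<in> Ar C" "src C t = src C g" "tgt C t = tgt C s" "tgt C g = tgt C f"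
      using e d(6,7) by auto
    obtain s' where [simp]: "s' \<in> Ar C" "src C s' = tgt C s" "tgt C s' = src C f"
      and ss': "cong_mod I (s \<cdot> s') (cid C (tgt C s))"
      using invertedE[OF d(1)] by auto
    obtain t' where [simp]: "t' \<in> Ar C" "src C t' = tgt C s" "tgt C t' = src C g"
      and tt': "cong_mod I (t \<cdot> t') (cid C (tgt C s))"
      using invertedE[OF e(1)] by auto
    obtain m where m: "m \<in> coideal_idems I" "m \<star> f = m \<star> (h \<cdot> s)" "m \<star> (s \<cdot> s') = m \<star> cid C (tgt C s)"
      using coideal_idems_common[OF I d(8) ss'] .
    obtain n where n: "n \<in> coideal_idems I" "n \<star> g = n \<star> (h \<cdot> t)" "n \<star> (t \<cdot> t') = n \<star> cid C (tgt C s)"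
      using coideal_idems_common[OF I e(8) tt'] .
    let ?m = "m \<cdot> n"
    note [simp] = coideal_idems_scalar(1-3)[OF coideal_idems_mult[OF I m(1) n(1)]]
    have mn1: "?m \<star> f = ?m \<star> (h \<cdot> s)"
      by (rule smul_eq_mult_coideal(1)[OF I m(1) n(1) _ _ m(2)]) auto
    have mn2: "?m \<star> (s \<cdot> s') = ?m \<star> cid C (tgt C s)"
      by (rule smul_eq_mult_coideal(1)[OF I m(1) n(1) _ _ m(3)]) auto
    have mn3: "?m \<star> g = ?m \<star> (h \<cdot> t)"
      by (rule smul_eq_mult_coideal(2)[OF I n(1) m(1) _ _ n(2)]) auto
    have mn4: "?m \<star> (t \<cdot> t') = ?m \<star> cid C (tgt C s)"
      by (rule smul_eq_mult_coideal(2)[OF I n(1) m(1) _ _ n(3)]) auto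
    have su: "s \<cdot> (?m \<star> s') = ?m \<star> cid C (tgt C s)" and tv: "t \<cdot> (?m \<star> t') = ?m \<star> cid C (tgt C s)"
      using mn2 mn4 by (simp_all add: smul_comp)
    have "f \<cdot> (?m \<star> s') = (?m \<star> f) \<cdot> s'" by (simp add: smul_comp)
    also have "\<dots> = h \<cdot> (?m \<star> (s \<cdot> s'))" unfolding mn1 by (simp add: smul_comp)
    also have "\<dots> = h \<cdot> (?m \<star> (t \<cdot> t'))" unfolding mn2 mn4 ..
    also have "\<dots> = (?m \<star> (h \<cdot> t)) \<cdot> t'" by (simp add: smul_comp)
    also have "\<dots> = g \<cdot> (?m \<star> t')" unfolding mn3[symmetric] by (simp add: smul_comp)
    finally have "f \<cdot> (?m \<star> s') = g \<cdot> (?m \<star> t')" .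
    moreover have "?m \<star> cid C (tgt C s) \<in> inverted C \<S>"
      by (rule cong_cid_inverted[OF cong_mod_smul[OF I coideal_idems_mult[OF I m(1) n(1)]]]) auto
    ultimately show ?thesis
      unfolding common_denominator_def using su tv by (intro exI[of _ "?m \<star> s'"] exI[of _ "?m \<star> t'"]) simp
  qed
  moreover have "(t, g) \<in> fractions C \<S> \<and> tgt C s = tgt C t \<and> tgt C f = tgt C g" if "represents (t, g) h" for t g
    using representsD[OF that] d(6,7) unfolding fractions_def by auto
  ultimately show ?thesis unfolding fraction_class_def by blast
qed

lemma localize_eq: "h \<in> Ar C \<Longrightarrow> localize C \<S> h = {x. represents x h}"
  unfolding localize_def by (rule fraction_class_eq[OF represents_cid]) auto

lemma fraction_class_eq_localize:
  assumes "represents (s, f) h"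
  shows "fraction_class C \<S> (s, f) = localize C \<S> h"
  using fraction_class_eq[OF assms] localize_eq[OF representsD(5)[OF assms]] by simp

lemma localize_eq_iff:
  assumes "h \<in> Ar C" "h' \<in> Ar C"
  shows "localize C \<S> h = localize C \<S> h' \<longleftrightarrow> cong_mod I h h'"
proof
  assume "localize C \<S> h = localize C \<S> h'"
  then have "represents (cid C (src C h), h) h'"
    using represents_cid[OF assms(1) refl] unfolding assms[THEN localize_eq] by blast
  then show "cong_mod I h h'"
    using represents_unique[OF represents_cid[OF assms(1) refl]] by blast
next
  assume "cong_mod I h h'"
  then show "localize C \<S> h = localize C \<S> h'"
    unfolding assms[THEN localize_eq] using represents_cong cong_mod_sym by auto
qed

text \<open>Evaluates the operations of the Serre quotient, which are unions over choices: one
  admissible choice shows that the family is nonempty, and independence of the choice does the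
  rest.\<close>

lemma Union_eq_if_all_eq: "x \<in> X \<Longrightarrow> (\<And>y. y \<in> X \<Longrightarrow> y = L) \<Longrightarrow> \<Union>X = L"
  by blast

text \<open>For each operation, identity denominators provide one choice. Any other choice yields a
  fraction representing the expected morphism of \<open>C\<close>, so it lies in the same
  class.\<close>

lemma strict_quotient_serre: "strict_quotient C (serre_quot_by C I) (localize C \<S>)"
proof (rule strict_quotient.intro[OF tensor_category_axioms], unfold_locales)
  let ?D = "serre_quot_by C I" and ?Q = "localize C \<S>"
  show "Ar ?D = ?Q ` Ar C"
  proof
    show "Ar ?D \<subseteq> ?Q ` Ar C"
    proof
      fix X assume "X \<in> Ar ?D"
      then obtain s f where sf: "(s, f) \<in> fractions C \<S>" "X = fraction_class C \<S> (s, f)"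
        by (auto simp: serre_quot_by_def serre_quotient_def Let_def)
      then obtain h where "represents (s, f) h" using ex_represents by blast
      then show "X \<in> ?Q ` Ar C" using sf fraction_class_eq_localize representsD(5) by blast
    qed
    show "?Q ` Ar C \<subseteq> Ar ?D"
    proof
      fix X assume "X \<in> ?Q ` Ar C"
      then obtain h where h: "h \<in> Ar C" "X = ?Q h" by auto
      then have "(cid C (src C h), h) \<in> fractions C \<S>" unfolding fractions_def by auto
      then show "X \<in> Ar ?D" using h(2)
        by (auto simp: serre_quot_by_def serre_quotient_def Let_def localize_def)
    qed
  qed
  fix f assume f [simp]: "f \<in> Ar C"
  have mem: "(s, h) \<in> ?Q k \<longleftrightarrow> represents (s, h) k" if "k \<in> Ar C" for s h k
    using localize_eq[OF that] by auto
  have "(cid C (src C f), f) \<in> ?Q f" using represents_cid[OF f refl] mem[OF f] by simp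
  then have "(SOME r. r \<in> ?Q f) \<in> ?Q f" by (rule someI)
  then obtain s h where "(SOME r. r \<in> ?Q f) = (s, h)" "represents (s, h) f"
    using mem[OF f] by (metis surj_pair)
  then show "src ?D (?Q f) = src C f" "tgt ?D (?Q f) = tgt C f"
    using representsD[of s h f] by (auto simp: serre_quot_by_def serre_quotient_def Let_def)
  fix g assume g [simp]: "g \<in> Ar C"
  show "ccomp ?D (?Q g) (?Q f) = ?Q (g \<cdot> f)" if gf [simp]: "src C g = tgt C f"
  proof -
    let ?P = "\<lambda>s h t k u w. (s, h) \<in> ?Q f \<and> (t, k) \<in> ?Q g \<and> u \<in> inverted C \<S> \<and> w \<in> Ar C \<and> src C u = src C w \<and>
       tgt C u = src C s \<and> tgt C w = src C t \<and> h \<cdot> u = t \<cdot> w"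
    have "ccomp ?D (?Q g) (?Q f) = \<Union> {fraction_class C \<S> (s \<cdot> u, k \<cdot> w) | s h t k u w. ?P s h t k u w}"
      by (simp add: serre_quot_by_def serre_quotient_def Let_def)
    also have "\<dots> = ?Q (g \<cdot> f)"
    proof (rule Union_eq_if_all_eq)
      have "?P (cid C (src C f)) f (cid C (tgt C f)) g (cid C (src C f)) f"
        using represents_cid[OF f] represents_cid[OF g] by (simp add: mem)
      then show "fraction_class C \<S> (cid C (src C f) \<cdot> cid C (src C f), g \<cdot> f) \<in>
        {fraction_class C \<S> (s \<cdot> u, k \<cdot> w) | s h t k u w. ?P s h t k u w}" by blast
      fix X assume "X \<in> {fraction_class C \<S> (s \<cdot> u, k \<cdot> w) | s h t k u w. ?P s h t k u w}"
      then obtain s h t k u w where X: "X = fraction_class C \<S> (s \<cdot> u, k \<cdot> w)"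
        and P: "represents (s, h) f" "represents (t, k) g" "u \<in> inverted C \<S>" and [simp]: "w \<in> Ar C" "src C u = src C w"
          "tgt C u = src C s" "tgt C w = src C t" and eq: "h \<cdot> u = t \<cdot> w" by (auto simp: mem)
      note a = representsD[OF P(1)] and b = representsD[OF P(2)]
      note [simp] = inverted_arr[OF P(3)] a(2-4,6,7) b(2-4) b(6,7)[symmetric]
      \<comment> \<open>Along the Ore square: \<open>k w\<close> is congruent to
        \<open>g t w = g h u\<close>, and this to \<open>g f s u\<close>.\<close>
      have "cong_mod I (k \<cdot> w) ((g \<cdot> t) \<cdot> w)" by (intro cong_mod_comp I cong_mod_refl b) auto
      moreover have "(g \<cdot> t) \<cdot> w = g \<cdot> (h \<cdot> u)" unfolding eq using b(6) by simp
      moreover have "cong_mod I (g \<cdot> (h \<cdot> u)) (g \<cdot> ((f \<cdot> s) \<cdot> u))" by (intro cong_mod_comp I cong_mod_refl a) auto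
      ultimately have "cong_mod I (k \<cdot> w) (g \<cdot> ((f \<cdot> s) \<cdot> u))" using cong_mod_trans[OF I] by metis
      then have "represents (s \<cdot> u, k \<cdot> w) (g \<cdot> f)"
        by (intro representsI inverted_comp P a) auto
      then show "X = ?Q (g \<cdot> f)" unfolding X by (rule fraction_class_eq_localize)
    qed
    finally show ?thesis .
  qed
  show "cplus ?D (?Q f) (?Q g) = ?Q (f \<boxplus> g)" if gf: "src C f = src C g" "tgt C f = tgt C g"
  proof -
    note gf' [simp] = gf[symmetric]
    let ?P = "\<lambda>s h t k u v. (s, h) \<in> ?Q f \<and> (t, k) \<in> ?Q g \<and> common_denominator C \<S> s t u v"
    have "cplus ?D (?Q f) (?Q g) = \<Union> {fraction_class C \<S> (s \<cdot> u, h \<cdot> u \<boxplus> k \<cdot> v) | s h t k u v. ?P s h t k u v}"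
      by (simp add: serre_quot_by_def serre_quotient_def Let_def)
    also have "\<dots> = ?Q (f \<boxplus> g)"
    proof (rule Union_eq_if_all_eq)
      let ?i = "cid C (src C f)"
      have "?P ?i f ?i g ?i ?i"
        using represents_cid[OF f] represents_cid[OF g] by (simp add: mem common_denominator_def)
      then show "fraction_class C \<S> (?i \<cdot> ?i, f \<cdot> ?i \<boxplus> g \<cdot> ?i) \<in>
        {fraction_class C \<S> (s \<cdot> u, h \<cdot> u \<boxplus> k \<cdot> v) | s h t k u v. ?P s h t k u v}" by blast
      fix X assume "X \<in> {fraction_class C \<S> (s \<cdot> u, h \<cdot> u \<boxplus> k \<cdot> v) | s h t k u v. ?P s h t k u v}"
      then obtain s h t k u v where X: "X = fraction_class C \<S> (s \<cdot> u, h \<cdot> u \<boxplus> k \<cdot> v)"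
        and P: "represents (s, h) f" "represents (t, k) g" "common_denominator C \<S> s t u v" by (auto simp: mem)
      have [simp]: "u \<in> Ar C" "v \<in> Ar C" "src C v = src C u" "tgt C u = src C s" "tgt C v = src C t"
        and eq: "s \<cdot> u = t \<cdot> v" and su: "s \<cdot> u \<in> inverted C \<S>"
        using P(3) unfolding common_denominator_def by auto
      note a = representsD[OF P(1)] and b = representsD[OF P(2)]
      have [simp]: "s \<in> Ar C" "h \<in> Ar C" "src C s = src C h" "tgt C s = src C f" "tgt C h = tgt C f"
        "t \<in> Ar C" "k \<in> Ar C" "src C t = src C k" "tgt C t = src C f" "tgt C k = tgt C f"
        using a(2-4) b(2-4) a(6,7)[symmetric] b(6,7)[symmetric] by simp_all
      have "cong_mod I (h \<cdot> u) ((f \<cdot> s) \<cdot> u)" "cong_mod I (k \<cdot> v) ((g \<cdot> t) \<cdot> v)"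
        by (intro cong_mod_comp I cong_mod_refl a b; simp)+
      then have "cong_mod I (h \<cdot> u \<boxplus> k \<cdot> v) ((f \<cdot> s) \<cdot> u \<boxplus> (g \<cdot> t) \<cdot> v)"
        by (intro cong_mod_add I) auto
      also have "(f \<cdot> s) \<cdot> u \<boxplus> (g \<cdot> t) \<cdot> v = (f \<boxplus> g) \<cdot> (s \<cdot> u)"
        using eq by simp
      finally have "represents (s \<cdot> u, h \<cdot> u \<boxplus> k \<cdot> v) (f \<boxplus> g)"
        by (intro representsI su) (auto simp del: comp_add)
      then show "X = ?Q (f \<boxplus> g)" unfolding X by (rule fraction_class_eq_localize)
    qed
    finally show ?thesis .
  qed
  show "tens ?D (?Q f) (?Q g) = ?Q (f \<otimes>\<^sub>m g)"
  proof -
    let ?P = "\<lambda>s h t k. (s, h) \<in> ?Q f \<and> (t, k) \<in> ?Q g"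
    have "tens ?D (?Q f) (?Q g) = \<Union> {fraction_class C \<S> (s \<otimes>\<^sub>m t, h \<otimes>\<^sub>m k) | s h t k. ?P s h t k}"
      by (simp add: serre_quot_by_def serre_quotient_def Let_def)
    also have "\<dots> = ?Q (f \<otimes>\<^sub>m g)"
    proof (rule Union_eq_if_all_eq)
      have "?P (cid C (src C f)) f (cid C (src C g)) g"
        using represents_cid[OF f] represents_cid[OF g] by (simp add: mem)
      then show "fraction_class C \<S> (cid C (src C f) \<otimes>\<^sub>m cid C (src C g), f \<otimes>\<^sub>m g) \<in>
        {fraction_class C \<S> (s \<otimes>\<^sub>m t, h \<otimes>\<^sub>m k) | s h t k. ?P s h t k}" by blast
      fix X assume "X \<in> {fraction_class C \<S> (s \<otimes>\<^sub>m t, h \<otimes>\<^sub>m k) | s h t k. ?P s h t k}"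
      then obtain s h t k where X: "X = fraction_class C \<S> (s \<otimes>\<^sub>m t, h \<otimes>\<^sub>m k)"
        and P: "represents (s, h) f" "represents (t, k) g" by (auto simp: mem)
      note a = representsD[OF P(1)] and b = representsD[OF P(2)]
      have "cong_mod I (h \<otimes>\<^sub>m k) ((f \<cdot> s) \<otimes>\<^sub>m (g \<cdot> t))"
        by (intro cong_mod_tens I a b)
      then have "represents (s \<otimes>\<^sub>m t, h \<otimes>\<^sub>m k) (f \<otimes>\<^sub>m g)"
        using a(1-7) b(1-7) by (intro representsI inverted_tens) auto
      then show "X = ?Q (f \<otimes>\<^sub>m g)" unfolding X by (rule fraction_class_eq_localize)
    qed
    finally show ?thesis .
  qed
qed (simp_all add: serre_quot_by_def serre_quotient_def Let_def)

text \<open>The two descriptions of \<open>I_oplus\<close> meet here: localization detects the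
  congruence, and the congruence to zero detects the support.\<close>

lemma ideal_oplus_eq: "ideal_oplus C I = {f \<in> Ar C. supp_idem C f \<in> I}"
proof -
  interpret Q: strict_quotient C "serre_quot_by C I" "localize C \<S>" by (rule strict_quotient_serre)
  have "localize C \<S> f = czero (serre_quot_by C I) (src C f) (tgt C f) \<longleftrightarrow> supp_idem C f \<in> I" if "f \<in> Ar C" for f
    using that localize_eq_iff[of f "czero C (src C f) (tgt C f)"] cong_mod_zero_iff[OF I that] by simp
  then show ?thesis unfolding ideal_oplus_def by (simp cong: conj_cong)
qed

lemma tensor_ideal_oplus: "tensor_ideal C (ideal_oplus C I)"
  unfolding ideal_oplus_eq by (rule tensor_ideal_supp[OF I])

lemma ideal_rel_oplus_iff:
  assumes "f \<in> Ar C" "g \<in> Ar C"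
  shows "ideal_rel (ideal_oplus C I) f g \<longleftrightarrow> cong_mod I f g"
proof
  note Z = tensor_ideal_oplus
  have Z_iff: "d \<in> ideal_oplus C I \<longleftrightarrow> d \<in> Ar C \<and> cong_mod I d (czero C (src C d) (tgt C d))" for d
    using cong_mod_zero_iff[OF I, of d] ideal_oplus_eq by auto
  { assume "ideal_rel (ideal_oplus C I) f g"
    then obtain d where d: "d \<in> ideal_oplus C I" "d \<in> Ar C" "src C d = src C f" "tgt C d = tgt C f" "g = f \<boxplus> d"
      by (rule ideal_relE[OF Z])
    have "cong_mod I d (czero C (src C f) (tgt C f))" using d Z_iff[of d] by simp
    then have "cong_mod I (f \<boxplus> d) (f \<boxplus> czero C (src C f) (tgt C f))"
      by (intro cong_mod_add I cong_mod_refl assms) (use d in auto)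
    then show "cong_mod I f g" using d assms cong_mod_sym by simp }
  assume fg: "cong_mod I f g"
  note a = cong_mod_arr[OF fg]
  have "cong_mod I (f \<boxplus> neg g) (czero C (src C g) (tgt C g))"
    using cong_mod_iff_diff[OF I a] fg by simp
  then have "f \<boxplus> neg g \<in> ideal_oplus C I" using Z_iff[of "f \<boxplus> neg g"] a by simp
  then have "ideal_rel (ideal_oplus C I) g (g \<boxplus> (f \<boxplus> neg g))"
    using a by (intro ideal_relI[OF Z]) auto
  moreover have "g \<boxplus> (f \<boxplus> neg g) = f"
  proof -
    have "f \<boxplus> neg g = neg g \<boxplus> f" by (rule add_comm) (use a in auto)
    moreover have "g \<boxplus> (neg g \<boxplus> f) = (g \<boxplus> neg g) \<boxplus> f" by (rule add_assoc[symmetric]) (use a in auto)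
    ultimately show ?thesis using a by simp
  qed
  ultimately show "ideal_rel (ideal_oplus C I) f g" using ideal_rel_sym[OF Z] by simp
qed

text \<open>The chosen representative is congruent to \<open>f\<close>, and congruent morphisms have
  the same localization, so the choice is harmless.\<close>

lemma oplus_functor_class:
  assumes "f \<in> Ar C"
  shows "oplus_functor C I (ideal_class C (ideal_oplus C I) f) = localize C \<S> f"
proof -
  note r = ideal_rel_rep[OF tensor_ideal_oplus assms]
  show ?thesis
    unfolding oplus_functor_def using ideal_rel_oplus_iff r ideal_relD[OF tensor_ideal_oplus r] localize_eq_iff
    by (metis assms)
qed

lemma strict_quotient_pair_oplus:
  "strict_quotient_pair C (ideal_quotient C (ideal_oplus C I)) (ideal_class C (ideal_oplus C I))
    (serre_quot_by C I) (localize C \<S>) (oplus_functor C I)"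
proof (intro strict_quotient_pair.intro strict_quotient_pair_axioms.intro)
  show "strict_quotient C (ideal_quotient C (ideal_oplus C I)) (ideal_class C (ideal_oplus C I))"
    by (rule strict_quotient_ideal[OF tensor_ideal_oplus])
  show "ideal_class C (ideal_oplus C I) f = ideal_class C (ideal_oplus C I) g"
    if "f \<in> Ar C" "g \<in> Ar C" "localize C \<S> f = localize C \<S> g" for f g
    using that ideal_class_eq_iff[OF tensor_ideal_oplus] ideal_rel_oplus_iff localize_eq_iff by simp
qed (rule strict_quotient_serre oplus_functor_class; assumption?)+

end

end

subsection \<open>Hull topologies\<close>

text \<open>Common ground of the two spectra; \<open>T\<close> is the improper ideal. Primality is
  stated with intersections, the form needed for intersections of open sets. It follows from
  products of elements for rings and from tensor products of morphisms for tensor ideals.\<close>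

locale hull_space =
  fixes S \<J> :: "'a set set" and T :: "'a set"
  assumes T_in: "T \<in> \<J>"
    and subset_T: "I \<in> \<J> \<Longrightarrow> I \<subseteq> T"
    and S_subset: "S \<subseteq> \<J>"
    and T_notin: "T \<notin> S"
    and Inter_in: "\<lbrakk>\<K> \<subseteq> \<J>; \<K> \<noteq> {}\<rbrakk> \<Longrightarrow> \<Inter>\<K> \<in> \<J>"
    and prime: "\<lbrakk>I \<in> \<J>; J \<in> \<J>; P \<in> S; I \<inter> J \<subseteq> P\<rbrakk> \<Longrightarrow> I \<subseteq> P \<or> J \<subseteq> P"
begin

text \<open>The ideal generated by \<open>X\<close>. A prime contains it exactly if it contains
  \<open>X\<close>, so open sets may be described by arbitrary subsets of \<open>T\<close>; unions
  of open sets then merely pool the generators.\<close>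

definition gen :: "'a set \<Rightarrow> 'a set" where
  "gen X = \<Inter>{J \<in> \<J>. X \<subseteq> J}"

lemma gen_in: "X \<subseteq> T \<Longrightarrow> gen X \<in> \<J>"
  unfolding gen_def using T_in by (intro Inter_in) auto

lemma gen_subset_iff: "P \<in> S \<Longrightarrow> gen X \<subseteq> P \<longleftrightarrow> X \<subseteq> P"
  unfolding gen_def using S_subset by blast

lemma ex_ideal_iff: "(\<exists>I \<in> \<J>. U = S - {P \<in> S. I \<subseteq> P}) \<longleftrightarrow> (\<exists>X \<subseteq> T. U = {P \<in> S. \<not> X \<subseteq> P})"
proof
  assume "\<exists>I \<in> \<J>. U = S - {P \<in> S. I \<subseteq> P}"
  then obtain I where I: "I \<in> \<J>" "U = S - {P \<in> S. I \<subseteq> P}" by blast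
  then show "\<exists>X \<subseteq> T. U = {P \<in> S. \<not> X \<subseteq> P}"
    using subset_T[OF I(1)] by (intro exI[of _ I]) auto
next
  assume "\<exists>X \<subseteq> T. U = {P \<in> S. \<not> X \<subseteq> P}"
  then obtain X where X: "X \<subseteq> T" "U = {P \<in> S. \<not> X \<subseteq> P}" by blast
  have "{P \<in> S. gen X \<subseteq> P} = {P \<in> S. X \<subseteq> P}" by (intro Collect_cong conj_cong refl gen_subset_iff)
  then have "U = S - {P \<in> S. gen X \<subseteq> P}" using X(2) by blast
  then show "\<exists>I \<in> \<J>. U = S - {P \<in> S. I \<subseteq> P}" using gen_in[OF X(1)] by blast
qed

lemma istopology_hull: "istopology (\<lambda>U. \<exists>I \<in> \<J>. U = S - {P \<in> S. I \<subseteq> P})"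
  unfolding istopology_def
proof (intro conjI allI impI)
  fix U V assume "\<exists>I \<in> \<J>. U = S - {P \<in> S. I \<subseteq> P}" "\<exists>I \<in> \<J>. V = S - {P \<in> S. I \<subseteq> P}"
  then obtain I J where IJ: "I \<in> \<J>" "U = S - {P \<in> S. I \<subseteq> P}" "J \<in> \<J>" "V = S - {P \<in> S. J \<subseteq> P}"
    by blast
  have "I \<inter> J \<in> \<J>" using Inter_in[of "{I, J}"] IJ by simp
  moreover have "U \<inter> V = S - {P \<in> S. I \<inter> J \<subseteq> P}" using IJ prime[of I J] by auto
  ultimately show "\<exists>I \<in> \<J>. U \<inter> V = S - {P \<in> S. I \<subseteq> P}" by blast
next
  fix \<K> assume "\<forall>U\<in>\<K>. \<exists>I \<in> \<J>. U = S - {P \<in> S. I \<subseteq> P}"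
  then have "\<forall>U\<in>\<K>. \<exists>X \<subseteq> T. U = {P \<in> S. \<not> X \<subseteq> P}" unfolding ex_ideal_iff .
  then obtain X where X: "\<And>U. U \<in> \<K> \<Longrightarrow> X U \<subseteq> T \<and> U = {P \<in> S. \<not> X U \<subseteq> P}" by metis
  have "\<Union>\<K> = {P \<in> S. \<not> (\<Union>U\<in>\<K>. X U) \<subseteq> P}"
    using X by (auto; blast)
  moreover have "(\<Union>U\<in>\<K>. X U) \<subseteq> T" using X by blast
  ultimately show "\<exists>I \<in> \<J>. \<Union>\<K> = S - {P \<in> S. I \<subseteq> P}" unfolding ex_ideal_iff by blast
qed

lemma openin_hull_topology:
  "openin (hull_topology S \<J>) U \<longleftrightarrow> (\<exists>X \<subseteq> T. U = {P \<in> S. \<not> X \<subseteq> P})"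
  unfolding hull_topology_def topology_inverse'[OF istopology_hull] by (rule ex_ideal_iff)

lemma topspace_hull_topology: "topspace (hull_topology S \<J>) = S"
proof (rule antisym)
  show "topspace (hull_topology S \<J>) \<subseteq> S" unfolding topspace_def openin_hull_topology by blast
  have "openin (hull_topology S \<J>) {P \<in> S. \<not> T \<subseteq> P}" unfolding openin_hull_topology by blast
  moreover have "\<not> T \<subseteq> P" if "P \<in> S" for P
    using that subset_T[of P] S_subset T_notin by (metis subset_antisym subset_iff)
  then have "{P \<in> S. \<not> T \<subseteq> P} = S" by blast
  ultimately show "S \<subseteq> topspace (hull_topology S \<J>)" using openin_subset by metis
qed

end

section \<open>Quasi-compactness of the prime spectrum of a commutative ring\<close>

lemma (in cring) ex_primeideal_superset:
  assumes "ideal I R" "\<one> \<notin> I"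
  obtains P where "primeideal P R" "I \<subseteq> P"
proof -
  let ?A = "{J. ideal J R \<and> I \<subseteq> J \<and> \<one> \<notin> J}"
  have "\<exists>M\<in>?A. \<forall>X\<in>?A. M \<subseteq> X \<longrightarrow> X = M"
  proof (rule subset_Zorn_nonempty)
    show "?A \<noteq> {}" using assms by blast
    fix \<C> assume c: "\<C> \<noteq> {}" "subset.chain ?A \<C>"
    then have "subset.chain {J. ideal J R} \<C>" unfolding pred_on.chain_def by blast
    then have "ideal (\<Union>\<C>) R" using chain_Union_is_ideal[of \<C>] c(1) by simp
    then show "\<Union>\<C> \<in> ?A" using c unfolding pred_on.chain_def by blast
  qed
  then obtain M where "M \<in> ?A" and max: "\<forall>X\<in>?A. M \<subseteq> X \<longrightarrow> X = M" by (rule bexE)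
  then have M: "ideal M R" "I \<subseteq> M" "\<one> \<notin> M" by simp_all
  have "maximalideal M R"
  proof (rule maximalidealI[OF M(1)])
    show "carrier R \<noteq> M" using M(3) by auto
    show "J = M \<or> J = carrier R" if "ideal J R" "M \<subseteq> J" "J \<subseteq> carrier R" for J
      using that max M(2) ideal.one_imp_carrier by blast
  qed
  then show thesis using that maximalideal_prime M(2) by blast
qed

lemma (in cring) hull_space_ring_Spec: "hull_space (ring_Spec R) {I. ideal I R} (carrier R)"
proof
  show "carrier R \<in> {I. ideal I R}" using oneideal by simp
  show "I \<subseteq> carrier R" if "I \<in> {I. ideal I R}" for I using that ideal.Icarr by fastforce
  show "ring_Spec R \<subseteq> {I. ideal I R}" using primeideal.axioms(1) by (auto simp: ring_Spec_def)
  show "carrier R \<notin> ring_Spec R" using primeideal.I_notcarr by (fastforce simp: ring_Spec_def)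
  show "\<Inter>\<K> \<in> {I. ideal I R}" if "\<K> \<subseteq> {I. ideal I R}" "\<K> \<noteq> {}" for \<K>
    using i_Intersect[of \<K>] that by blast
  show "I \<subseteq> P \<or> J \<subseteq> P" if "I \<in> {I. ideal I R}" "J \<in> {I. ideal I R}" "P \<in> ring_Spec R" "I \<inter> J \<subseteq> P" for I J P
  proof (rule ccontr)
    assume "\<not> (I \<subseteq> P \<or> J \<subseteq> P)"
    then obtain x y where xy: "x \<in> I" "x \<notin> P" "y \<in> J" "y \<notin> P" by blast
    interpret I: ideal I R using that by simp
    interpret J: ideal J R using that by simp
    interpret P: primeideal P R using that by (simp add: ring_Spec_def)
    have "x \<otimes> y \<in> I \<inter> J" using xy I.I_r_closed J.I_l_closed I.Icarr J.Icarr by auto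
    then have "x \<otimes> y \<in> P" using that by blast
    then show False using P.I_prime[of x y] xy I.Icarr J.Icarr by blast
  qed
qed

lemma (in cring) compact_space_ring_Spec: "compact_space (ring_Spec_topology R)"
proof -
  interpret H: hull_space "ring_Spec R" "{I. ideal I R}" "carrier R" by (rule hull_space_ring_Spec)
  show ?thesis
    unfolding compact_space_def compactin_def ring_Spec_topology_def H.topspace_hull_topology
  proof (intro conjI allI impI)
    fix \<U> assume a: "(\<forall>U \<in> \<U>. openin (hull_topology (ring_Spec R) {I. ideal I R}) U) \<and> ring_Spec R \<subseteq> \<Union>\<U>"
    then have "\<forall>U \<in> \<U>. \<exists>X \<subseteq> carrier R. U = {P \<in> ring_Spec R. \<not> X \<subseteq> P}" unfolding H.openin_hull_topology by blast
    then obtain X where X: "\<And>U. U \<in> \<U> \<Longrightarrow> X U \<subseteq> carrier R \<and> U = {P \<in> ring_Spec R. \<not> X U \<subseteq> P}" by metis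
    define Z where "Z = (\<Union>U\<in>\<U>. X U)"
    have Z: "Z \<subseteq> carrier R" using X unfolding Z_def by blast
    \<comment> \<open>The ideal generated by all generators \<open>Z\<close> of the cover, written
      as the union over finite subsets so that membership of the unit already names finitely many
      generators. If the unit were missing, a prime above \<open>A\<close> would escape the
      cover.\<close>
    define A where "A = {x \<in> carrier R. \<exists>F. finite F \<and> F \<subseteq> Z \<and> x \<in> Idl F}"
    have id: "ideal (Idl F) R" if "F \<subseteq> Z" for F using genideal_ideal that Z by blast
    have mono: "Idl F \<subseteq> Idl G" if "F \<subseteq> G" "G \<subseteq> Z" for F G
      using subset_Idl_subset[of G F] that Z by blast
    have "ideal A R"
    proof (rule idealI[OF ring_axioms])
      show "subgroup A (add_monoid R)"
      proof
        show "A \<subseteq> carrier (add_monoid R)" by (auto simp: A_def)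
        show "\<one>\<^bsub>add_monoid R\<^esub> \<in> A"
          using additive_subgroup.zero_closed[OF ideal.axioms(1)[OF id[of "{}"]]] by (auto simp: A_def)
        fix x assume "x \<in> A"
        then obtain F where F: "finite F" "F \<subseteq> Z" "x \<in> Idl F" and x: "x \<in> carrier R" by (auto simp: A_def)
        show "inv\<^bsub>add_monoid R\<^esub> x \<in> A"
          using additive_subgroup.a_inv_closed[OF ideal.axioms(1)[OF id[OF F(2)]] F(3)] F x
          by (auto simp: A_def a_inv_def[symmetric])
        fix y assume "y \<in> A"
        then obtain G where G: "finite G" "G \<subseteq> Z" "y \<in> Idl G" and y: "y \<in> carrier R" by (auto simp: A_def)
        have "x \<in> Idl (F \<union> G)" "y \<in> Idl (F \<union> G)" using mono[of F "F \<union> G"] mono[of G "F \<union> G"] F G by blast+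
        then have "x \<oplus> y \<in> Idl (F \<union> G)" using additive_subgroup.a_closed[OF ideal.axioms(1)[OF id[of "F \<union> G"]]] F G by blast
        then show "x \<otimes>\<^bsub>add_monoid R\<^esub> y \<in> A" using F G x y by (auto simp: A_def intro!: exI[of _ "F \<union> G"])
      qed
      fix a x assume "a \<in> A" and x: "x \<in> carrier R"
      then obtain F where F: "finite F" "F \<subseteq> Z" "a \<in> Idl F" and a: "a \<in> carrier R" by (auto simp: A_def)
      show "x \<otimes> a \<in> A" "a \<otimes> x \<in> A"
        using ideal.I_l_closed[OF id[OF F(2)] F(3) x] ideal.I_r_closed[OF id[OF F(2)] F(3) x] F a x by (auto simp: A_def)
    qed
    have "Z \<subseteq> A"
    proof
      fix z assume "z \<in> Z"
      then show "z \<in> A" using Z genideal_self'[of z] by (auto simp: A_def intro!: exI[of _ "{z}"])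
    qed
    have "\<one> \<in> A"
    proof (rule ccontr)
      assume "\<one> \<notin> A"
      then obtain P where P: "primeideal P R" "A \<subseteq> P" using ex_primeideal_superset \<open>ideal A R\<close> by blast
      then have "P \<in> \<Union>\<U>" using a by (auto simp: ring_Spec_def)
      then obtain U where "U \<in> \<U>" "P \<in> U" by blast
      then have "\<not> X U \<subseteq> P" "X U \<subseteq> Z" using X unfolding Z_def by blast+
      then show False using \<open>Z \<subseteq> A\<close> P(2) by blast
    qed
    \<comment> \<open>No prime contains all of \<open>F\<close>, as it would contain the unit.
      Choosing for each element of \<open>F\<close> a member of the cover from which it comes gives
      the finite subcover.\<close>
    then obtain F where F: "finite F" "F \<subseteq> Z" "\<one> \<in> Idl F" by (auto simp: A_def)
    then have "\<forall>z\<in>F. \<exists>U\<in>\<U>. z \<in> X U" unfolding Z_def by blast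
    then obtain V where V: "\<And>z. z \<in> F \<Longrightarrow> V z \<in> \<U> \<and> z \<in> X (V z)" by metis
    have "ring_Spec R \<subseteq> \<Union>(V ` F)"
    proof
      fix P assume P: "P \<in> ring_Spec R"
      interpret P: primeideal P R using P by (simp add: ring_Spec_def)
      have "\<one> \<notin> P" using P.one_imp_carrier P.I_notcarr by blast
      then have "\<not> F \<subseteq> P" using F genideal_minimal[OF P.ideal_axioms] by blast
      then obtain z where "z \<in> F" "z \<notin> P" by blast
      then show "P \<in> \<Union>(V ` F)" using V[of z] X[of "V z"] P by blast
    qed
    then show "\<exists>\<F>. finite \<F> \<and> \<F> \<subseteq> \<U> \<and> ring_Spec R \<subseteq> \<Union>\<F>"
      using F(1) V by (intro exI[of _ "V ` F"]) auto
  qed simp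
qed

subsection \<open>The section of \<open>\<pi>\<close>\<close>

context tensor_category
begin

lemma tensor_ideal_Inter:
  assumes "\<And>J. J \<in> \<K> \<Longrightarrow> tensor_ideal C J" "\<K> \<noteq> {}"
  shows "tensor_ideal C (\<Inter>\<K>)"
proof (rule tensor_idealI)
  show "\<Inter>\<K> \<subseteq> Ar C" using assms tensor_idealD(1) by blast
qed (auto intro: tensor_idealD(2-)[OF assms(1)])

lemma hull_space_tensor_Spec: "hull_space (tensor_Spec C) {\<II>. tensor_ideal C \<II>} (Ar C)"
proof
  show "Ar C \<in> {\<II>. tensor_ideal C \<II>}" by (auto intro: tensor_idealI)
  show "I \<subseteq> Ar C" if "I \<in> {\<II>. tensor_ideal C \<II>}" for I using that tensor_idealD(1) by blast
  show "tensor_Spec C \<subseteq> {\<II>. tensor_ideal C \<II>}" by (auto simp: tensor_Spec_def prime_tensor_ideal_iff)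
  show "Ar C \<notin> tensor_Spec C" by (auto simp: tensor_Spec_def prime_tensor_ideal_iff)
  show "\<Inter>\<K> \<in> {\<II>. tensor_ideal C \<II>}" if "\<K> \<subseteq> {\<II>. tensor_ideal C \<II>}" "\<K> \<noteq> {}" for \<K>
    using tensor_ideal_Inter[of \<K>] that by blast
  show "I \<subseteq> P \<or> J \<subseteq> P" if "I \<in> {\<II>. tensor_ideal C \<II>}" "J \<in> {\<II>. tensor_ideal C \<II>}" "P \<in> tensor_Spec C" "I \<inter> J \<subseteq> P" for I J P
  proof (rule ccontr)
    assume "\<not> (I \<subseteq> P \<or> J \<subseteq> P)"
    then obtain x y where xy: "x \<in> I" "x \<notin> P" "y \<in> J" "y \<notin> P" by blast
    have I: "tensor_ideal C I" and J: "tensor_ideal C J" using that by auto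
    have "x \<in> Ar C" "y \<in> Ar C" using xy tensor_idealD(1)[OF I] tensor_idealD(1)[OF J] by auto
    moreover from this have "x \<otimes>\<^sub>m y \<in> P" using xy tensor_idealD(7)[OF I] tensor_idealD(8)[OF J] that(4) by auto
    ultimately have "x \<in> P \<or> y \<in> P" using that(3) unfolding tensor_Spec_def prime_tensor_ideal_iff mem_Collect_eq by metis
    then show False using xy by simp
  qed
qed

text \<open>Composition and tensor product of scalars differ only by unitors, so primality
  transfers. It is proper because the identity of the unit acts as the identity on every
  morphism.\<close>

lemma ideal_at_unit_in_ring_Spec:
  assumes "\<P> \<in> tensor_Spec C"
  shows "ideal_at_unit C \<P> \<in> ring_Spec (End_unit C)"
proof -
  have P: "tensor_ideal C \<P>" and proper: "\<P> \<noteq> Ar C"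
    and prime: "\<And>f g. \<lbrakk>f \<in> Ar C; g \<in> Ar C; f \<otimes>\<^sub>m g \<in> \<P>\<rbrakk> \<Longrightarrow> f \<in> \<P> \<or> g \<in> \<P>"
    using assms unfolding tensor_Spec_def prime_tensor_ideal_iff by auto
  interpret R: cring "End_unit C" by (rule cring_End_unit)
  have id: "ideal (ideal_at_unit C \<P>) (End_unit C)"
  proof (rule idealI[OF R.ring_axioms])
    have "add_monoid (End_unit C) = hom_group C \<one>\<^sub>C \<one>\<^sub>C"
      by (simp add: End_unit_def hom_group_def)
    then show "subgroup (ideal_at_unit C \<P>) (add_monoid (End_unit C))"
      using P unfolding tensor_ideal_def ideal_at_unit_def by simp
  qed (use tensor_idealD[OF P] in \<open>auto simp: ideal_at_unit_def End_unit_def\<close>)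
  have one: "cid C \<one>\<^sub>C \<notin> \<P>"
  proof
    assume one: "cid C \<one>\<^sub>C \<in> \<P>"
    have "f \<in> \<P>" if [simp]: "f \<in> Ar C" for f
    proof -
      have "lunit C (tgt C f) \<cdot> ((cid C \<one>\<^sub>C \<otimes>\<^sub>m f) \<cdot> luniti (src C f)) \<in> \<P>"
        by (intro tensor_idealD(5)[OF P] tensor_idealD(6)[OF P] tensor_idealD(7)[OF P] one) auto
      then show ?thesis using one_smul[OF that] by (simp add: scalar_def)
    qed
    then show False using proper tensor_idealD(1)[OF P] by blast
  qed
  have "primeideal (ideal_at_unit C \<P>) (End_unit C)"
  proof (rule primeidealI[OF id R.cring_axioms])
    have "cid C \<one>\<^sub>C \<in> carrier (End_unit C)" "cid C \<one>\<^sub>C \<notin> ideal_at_unit C \<P>"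
      using one by (simp_all add: End_unit_def ideal_at_unit_def)
    then show "carrier (End_unit C) \<noteq> ideal_at_unit C \<P>" by metis
    fix z w assume "z \<in> carrier (End_unit C)" "w \<in> carrier (End_unit C)" "z \<otimes>\<^bsub>End_unit C\<^esub> w \<in> ideal_at_unit C \<P>"
    then have z [simp]: "z \<in> Ar C" "src C z = \<one>\<^sub>C" "tgt C z = \<one>\<^sub>C" "w \<in> Ar C" "src C w = \<one>\<^sub>C" "tgt C w = \<one>\<^sub>C" and "z \<cdot> w \<in> \<P>"
      by (auto simp: End_unit_def ideal_at_unit_def)
    then have "z \<star> w \<in> \<P>" using smul_tunit[of z w] by simp
    then have "luniti \<one>\<^sub>C \<cdot> ((z \<star> w) \<cdot> lunit C \<one>\<^sub>C) \<in> \<P>"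
      by (intro tensor_idealD(5)[OF P] tensor_idealD(6)[OF P]) auto
    moreover have "luniti \<one>\<^sub>C \<cdot> ((z \<star> w) \<cdot> lunit C \<one>\<^sub>C) = z \<otimes>\<^sub>m w" by (simp add: scalar_def)
    ultimately have "z \<otimes>\<^sub>m w \<in> \<P>" by simp
    then show "z \<in> ideal_at_unit C \<P> \<or> w \<in> ideal_at_unit C \<P>"
      using prime[of z w] by (auto simp: ideal_at_unit_def)
  qed
  then show ?thesis by (simp add: ring_Spec_def)
qed

end

context rigid_abelian_tensor_category
begin

text \<open>\<open>z\<close> is a multiple of its support by \<open>supp_smul\<close>, and the
  support is a multiple of \<open>z\<close> by regularity; hence every ideal contains both or
  neither.\<close>

lemma supp_idem_in_iff:
  assumes I: "ideal I (End_unit C)" and z: "z \<in> \<R>"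
  shows "supp_idem C z \<in> I \<longleftrightarrow> z \<in> I"
proof
  have [simp]: "z \<in> Ar C" using z by simp
  assume "supp_idem C z \<in> I"
  then have "supp_idem C z \<cdot> z \<in> I" using ideal_End_unitD(4)[OF I] z by blast
  then show "z \<in> I" using supp_smul[of z] smul_tunit[of "supp_idem C z" z] z by simp
next
  assume "z \<in> I"
  then show "supp_idem C z \<in> I"
    using supp_idem_multiple[OF z] ideal_End_unitD(5)[OF I] by metis
qed

lemma ideal_at_unit_oplus:
  assumes I: "ideal I (End_unit C)"
  shows "ideal_at_unit C (ideal_oplus C I) = I"
  unfolding ideal_oplus_eq[OF I] ideal_at_unit_def
  using supp_idem_in_iff[OF I] ideal_End_unitD(1)[OF I] by auto

lemma ideal_oplus_subset_extended:
  assumes I: "ideal I (End_unit C)"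
  shows "ideal_oplus C I \<subseteq> extended_ideal C I"
proof
  fix f assume "f \<in> ideal_oplus C I"
  then have f: "f \<in> Ar C" "supp_idem C f \<in> I" unfolding ideal_oplus_eq[OF I] by auto
  then have "f \<in> generate (hom_group C (src C f) (tgt C f)) {scalar C z h | z h. z \<in> I \<and> h \<in> Hom C (src C f) (tgt C f)}"
    using supp_smul[OF f(1)] by (intro generate.incl CollectI exI[of _ "supp_idem C f"] exI[of _ f]) auto
  then show "f \<in> extended_ideal C I"
    unfolding extended_ideal_def using src_in_Ob[OF f(1)] tgt_in_Ob[OF f(1)] by blast
qed

lemma ideal_oplus_prime:
  assumes "P \<in> ring_Spec (End_unit C)"
  shows "ideal_oplus C P \<in> tensor_Spec C"
proof -
  have prime: "primeideal P (End_unit C)" using assms by (simp add: ring_Spec_def)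
  note P = prime_End_unitD[OF prime]
  note I = P(1)
  have "ideal_oplus C P \<noteq> Ar C"
  proof
    assume "ideal_oplus C P = Ar C"
    then have "cid C \<one>\<^sub>C \<in> ideal_at_unit C (ideal_oplus C P)" by (simp add: ideal_at_unit_def)
    then show False using P(2) ideal_at_unit_oplus[OF I] by simp
  qed
  moreover have "f \<in> ideal_oplus C P \<or> g \<in> ideal_oplus C P"
    if [simp]: "f \<in> Ar C" "g \<in> Ar C" and fg: "f \<otimes>\<^sub>m g \<in> ideal_oplus C P" for f g
  proof -
    have "cong_mod P (f \<otimes>\<^sub>m g) (czero C (src C (f \<otimes>\<^sub>m g)) (tgt C (f \<otimes>\<^sub>m g)))"
      using fg cong_mod_zero_iff[OF I, of "f \<otimes>\<^sub>m g"] unfolding ideal_oplus_eq[OF I] by simp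
    \<comment> \<open>Membership of \<open>f \<otimes> g\<close> becomes actual vanishing after
      multiplication by \<open>m\<close>. Moving \<open>m\<close> to \<open>f\<close> makes the
      product of two supports zero, and \<open>f\<close> is congruent to
      \<open>m \<star> f\<close>.\<close>
    then obtain m where m: "m \<in> coideal_idems P"
      and "m \<star> (f \<otimes>\<^sub>m g) = m \<star> czero C (src C (f \<otimes>\<^sub>m g)) (tgt C (f \<otimes>\<^sub>m g))"
      unfolding cong_mod_def by auto
    moreover note [simp] = coideal_idems_scalar(1-3)[OF m]
    ultimately have "(m \<star> f) \<otimes>\<^sub>m g = czero C (src C (m \<star> f) \<otimes>\<^sub>o src C g) (tgt C (m \<star> f) \<otimes>\<^sub>o tgt C g)"
      by (simp add: smul_tens)
    then have "supp_idem C (m \<star> f) \<cdot> supp_idem C g = czero C \<one>\<^sub>C \<one>\<^sub>C"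
      by (intro supp_mult_zero_if_tens_zero) auto
    then have "supp_idem C (m \<star> f) \<in> P \<or> supp_idem C g \<in> P"
      using P(3)[of "supp_idem C (m \<star> f)" "supp_idem C g"] ideal_End_unitD(2)[OF I] by simp
    moreover have "supp_idem C f \<in> P" if "supp_idem C (m \<star> f) \<in> P"
    proof -
      have "cong_mod P (m \<star> f) (czero C (src C f) (tgt C f))"
        using cong_mod_zero_iff[OF I, of "m \<star> f"] that by simp
      moreover have "cong_mod P f (m \<star> f)" by (rule cong_mod_sym[OF cong_mod_smul[OF I m]]) simp
      ultimately have "cong_mod P f (czero C (src C f) (tgt C f))" using cong_mod_trans[OF I] by blast
      then show ?thesis using cong_mod_zero_iff[OF I, of f] by simp
    qed
    ultimately show ?thesis unfolding ideal_oplus_eq[OF I] by auto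
  qed
  ultimately show ?thesis
    unfolding tensor_Spec_def prime_tensor_ideal_iff using tensor_ideal_oplus[OF I] by blast
qed

text \<open>Since \<open>f\<close> is fixed by its support, every \<open>tr (g f)\<close> is a
  multiple of \<open>supp_idem C f\<close>.\<close>

lemma ideal_oplus_subset_sigma_tr:
  assumes I: "ideal I (End_unit C)"
  shows "ideal_oplus C I \<subseteq> sigma_tr C I"
proof
  fix f assume "f \<in> ideal_oplus C I"
  then have f [simp]: "f \<in> Ar C" and e: "supp_idem C f \<in> I" unfolding ideal_oplus_eq[OF I] by auto
  have "tr C (g \<cdot> f) \<in> I" if [simp]: "g \<in> Ar C" "src C g = tgt C f" "tgt C g = src C f" for g
  proof -
    have "g \<cdot> f = g \<cdot> (supp_idem C f \<star> f)" by (simp add: supp_smul)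
    also have "\<dots> = supp_idem C f \<star> (g \<cdot> f)" by (simp add: smul_comp)
    finally have "tr C (g \<cdot> f) = tr C (g \<cdot> f) \<cdot> supp_idem C f" using tr_smul[of "supp_idem C f" "g \<cdot> f"] by simp
    moreover have "tr C (g \<cdot> f) \<cdot> supp_idem C f \<in> I"
      using tr_arr[of "g \<cdot> f"] by (intro ideal_End_unitD(5)[OF I e]) simp
    ultimately show ?thesis by simp
  qed
  then show "f \<in> sigma_tr C I" by (simp add: sigma_tr_def)
qed

text \<open>Again \<open>f\<close> is fixed by its support: if this scalar lies in the tensor ideal,
  then so does its tensor product with \<open>f\<close>, which is \<open>f\<close> up to
  unitors.\<close>

lemma ideal_oplus_at_unit_subset:
  assumes "\<P> \<in> tensor_Spec C"
  shows "ideal_oplus C (ideal_at_unit C \<P>) \<subseteq> \<P>"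
proof
  have P: "tensor_ideal C \<P>" using assms unfolding tensor_Spec_def prime_tensor_ideal_iff by auto
  have I: "ideal (ideal_at_unit C \<P>) (End_unit C)"
    using ideal_at_unit_in_ring_Spec[OF assms] primeideal.axioms(1) by (auto simp: ring_Spec_def)
  fix f assume "f \<in> ideal_oplus C (ideal_at_unit C \<P>)"
  then have f [simp]: "f \<in> Ar C" and e: "supp_idem C f \<in> \<P>" unfolding ideal_oplus_eq[OF I] by (auto simp: ideal_at_unit_def)
  have "lunit C (tgt C f) \<cdot> ((supp_idem C f \<otimes>\<^sub>m f) \<cdot> luniti (src C f)) \<in> \<P>"
    by (intro tensor_idealD(5)[OF P] tensor_idealD(6)[OF P] tensor_idealD(7)[OF P] e) auto
  then show "f \<in> \<P>" using supp_smul[OF f] by (simp add: scalar_def)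
qed

lemma spectral_map_oplus:
  "spectral_map (ring_Spec_topology (End_unit C)) (tensor_Spec_topology C) (ideal_oplus C)"
proof -
  let ?X = "ring_Spec_topology (End_unit C)" and ?Y = "tensor_Spec_topology C"
  let ?S = "ring_Spec (End_unit C)"
  interpret R: cring "End_unit C" by (rule cring_End_unit)
  interpret X: hull_space "ring_Spec (End_unit C)" "{I. ideal I (End_unit C)}" "carrier (End_unit C)"
    by (rule R.hull_space_ring_Spec)
  interpret Y: hull_space "tensor_Spec C" "{\<II>. tensor_ideal C \<II>}" "Ar C"
    by (rule hull_space_tensor_Spec)
  note open_X = X.openin_hull_topology[folded ring_Spec_topology_def]
    and top_X = X.topspace_hull_topology[folded ring_Spec_topology_def]
    and open_Y = Y.openin_hull_topology[folded tensor_Spec_topology_def]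
    and top_Y = Y.topspace_hull_topology[folded tensor_Spec_topology_def]
  have primeD: "ideal P (End_unit C)" "cid C \<one>\<^sub>C \<notin> P" "\<lbrakk>z \<in> \<R>; w \<in> \<R>; z \<cdot> w \<in> P\<rbrakk> \<Longrightarrow> z \<in> P \<or> w \<in> P" if "P \<in> ?S" for P z w
    using prime_End_unitD[of P] that by (auto simp: ring_Spec_def simp del: Hom_def)
  have pre: "{P \<in> ?S. ideal_oplus C P \<in> {\<P> \<in> tensor_Spec C. \<not> F \<subseteq> \<P>}} = {P \<in> ?S. \<not> supp_idem C ` F \<subseteq> P}" if "F \<subseteq> Ar C" for F
    using that ideal_oplus_prime ideal_oplus_eq[OF primeD(1)] by blast
  have supp: "supp_idem C ` F \<subseteq> carrier (End_unit C)" if "F \<subseteq> Ar C" for F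
    using that by (auto simp: End_unit_def)
  have "continuous_map ?X ?Y (ideal_oplus C)"
    unfolding continuous_map top_X top_Y
  proof (intro conjI allI impI)
    show "ideal_oplus C ` ?S \<subseteq> tensor_Spec C" using ideal_oplus_prime by blast
    fix U assume "openin ?Y U"
    then obtain F where F: "F \<subseteq> Ar C" "U = {\<P> \<in> tensor_Spec C. \<not> F \<subseteq> \<P>}" unfolding open_Y by blast
    show "openin ?X {P \<in> ?S. ideal_oplus C P \<in> U}"
      unfolding F(2) pre[OF F(1)] open_X using supp[OF F(1)] by blast
  qed
  moreover have "compactin ?X {P \<in> ?S. ideal_oplus C P \<in> U}" if U: "openin ?Y U" "compactin ?Y U" for U
  proof -
    obtain F where F: "F \<subseteq> Ar C" "U = {\<P> \<in> tensor_Spec C. \<not> F \<subseteq> \<P>}" using U(1) unfolding open_Y by blast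
    \<comment> \<open>Compactness of \<open>U\<close> is applied to the cover by the basic open sets
      of its generators, which replaces \<open>F\<close> by a finite \<open>G\<close>.\<close>
    let ?D = "\<lambda>f. {\<P> \<in> tensor_Spec C. \<not> {f} \<subseteq> \<P>}"
    have "\<forall>V \<in> ?D ` F. openin ?Y V" unfolding open_Y using F(1) by blast
    moreover have "U \<subseteq> \<Union>(?D ` F)" unfolding F(2) by blast
    ultimately obtain \<F> where \<F>: "finite \<F>" "\<F> \<subseteq> ?D ` F" "U \<subseteq> \<Union>\<F>"
      using U(2) unfolding compactin_def by meson
    then obtain G where G: "finite G" "G \<subseteq> F" "\<F> = ?D ` G" by (meson finite_subset_image)
    have U_G: "U = {\<P> \<in> tensor_Spec C. \<not> G \<subseteq> \<P>}"
      using \<F>(3) G(2) unfolding G(3) F(2) by blast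
    have GA: "G \<subseteq> Ar C" using G(2) F(1) by blast
    have "{P \<in> ?S. ideal_oplus C P \<in> U} = (\<Union>f\<in>G. {P \<in> ?S. supp_idem C f \<notin> P})"
      unfolding U_G pre[OF GA] by blast
    moreover have "closedin ?X {P \<in> ?S. supp_idem C f \<notin> P}" if "f \<in> G" for f
    proof -
      have f: "f \<in> Ar C" using that GA by blast
      have e: "supp_idem C f \<in> \<R>" "supp_idem C f \<cdot> supp_idem C f = supp_idem C f" using f by auto
      note c = compl[OF e]
      \<comment> \<open>A prime contains exactly one of two complementary idempotents: their product
        is zero and their sum is one. So the complement of this open set is open as well.\<close>
      have "supp_idem C f \<in> P \<longleftrightarrow> compl (supp_idem C f) \<notin> P" if P: "P \<in> ?S" for P
        using primeD(3)[OF P c(1) e(1)] ideal_End_unitD(2,3)[OF primeD(1)[OF P]] primeD(2)[OF P] c(2,3) by metis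
      then have "?S - {P \<in> ?S. supp_idem C f \<notin> P} = {P \<in> ?S. \<not> {compl (supp_idem C f)} \<subseteq> P}" by blast
      moreover have "openin ?X {P \<in> ?S. \<not> {compl (supp_idem C f)} \<subseteq> P}"
        unfolding open_X using c(1) by (intro exI[of _ "{compl (supp_idem C f)}"]) (auto simp: End_unit_def)
      ultimately show ?thesis unfolding closedin_def top_X by auto
    qed
    ultimately have "closedin ?X {P \<in> ?S. ideal_oplus C P \<in> U}"
      using G(1) by (auto intro!: closedin_Union)
    then show ?thesis by (rule closedin_compact_space[OF R.compact_space_ring_Spec])
  qed
  ultimately show ?thesis unfolding spectral_map_def top_X by blast
qed

end

theorem proposition5p14:
  fixes C :: "('o, 'm) tensor_cat"
  assumes "rigid_abelian_tensor_category C"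
  shows
    "(\<forall>I. ideal I (End_unit C) \<longrightarrow>
        tensor_ideal C (ideal_oplus C I) \<and>
        ideal_oplus C I = {f \<in> Ar C. supp_idem C f \<in> I}) \<and>
     ideal_at_unit C \<in> tensor_Spec C \<rightarrow> ring_Spec (End_unit C) \<and>
     (\<forall>I. ideal I (End_unit C) \<longrightarrow>
        ideal_oplus C I \<subseteq> extended_ideal C I \<and>
        ideal_at_unit C (ideal_oplus C I) = I) \<and>
     (\<forall>P \<in> ring_Spec (End_unit C).
        ideal_oplus C P \<in> tensor_Spec C \<and>
        ideal_at_unit C (ideal_oplus C P) = P \<and>
        ideal_oplus C P \<subseteq> sigma_tr C P) \<and>
     spectral_map (ring_Spec_topology (End_unit C)) (tensor_Spec_topology C) (ideal_oplus C) \<and>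
     (\<forall>\<P> \<in> tensor_Spec C. ideal_oplus C (ideal_at_unit C \<P>) \<subseteq> \<P>) \<and>
     (\<forall>I. ideal I (End_unit C) \<longrightarrow>
        (let A_mod_I = ideal_quotient C (ideal_oplus C I); A_serre_I = serre_quot_by C I in
          (\<forall>f \<in> Ar C. oplus_functor C I (ideal_class C (ideal_oplus C I) f) =
             localize C (serre_ideal C I) f) \<and>
          is_tensor_functor A_mod_I A_serre_I (\<lambda>A. A) (oplus_functor C I)
            (\<lambda>A B. cid A_serre_I (A \<otimes>\<^sub>o\<^bsub>A_serre_I\<^esub> B)) (cid A_serre_I (tunit A_serre_I)) \<and>
          is_equivalence A_mod_I A_serre_I (\<lambda>A. A) (oplus_functor C I)))"
proof -
  interpret rigid_abelian_tensor_category C by (rule assms)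
  have prime_ideal: "ideal P (End_unit C)" if "P \<in> ring_Spec (End_unit C)" for P
    using that primeideal.axioms(1) by (auto simp: ring_Spec_def)
  have equivalence: "is_tensor_functor (ideal_quotient C (ideal_oplus C I)) (serre_quot_by C I) (\<lambda>A. A) (oplus_functor C I)
        (\<lambda>A B. cid (serre_quot_by C I) (A \<otimes>\<^sub>o\<^bsub>serre_quot_by C I\<^esub> B)) (cid (serre_quot_by C I) (tunit (serre_quot_by C I)))"
      "is_equivalence (ideal_quotient C (ideal_oplus C I)) (serre_quot_by C I) (\<lambda>A. A) (oplus_functor C I)"
    if "ideal I (End_unit C)" for I
    using strict_quotient_pair.tensor_functor_H strict_quotient_pair.equivalence_H strict_quotient_pair_oplus[OF that] by blast+
  show ?thesis
    unfolding Let_def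
    using tensor_ideal_oplus ideal_oplus_eq ideal_at_unit_in_ring_Spec ideal_oplus_subset_extended
      ideal_at_unit_oplus ideal_oplus_prime ideal_oplus_subset_sigma_tr prime_ideal spectral_map_oplus
      ideal_oplus_at_unit_subset oplus_functor_class equivalence
    by (intro conjI allI ballI impI funcsetI) simp_all
qed

end
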